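(* Let $S\subset\mathbb{C}\mathbb{P}^2$ be a real curve composed of two smooth conics which are tangent to each other at two points. Then $$\pi_1(\mathbb{C}\mathbb{P}^2-S,* )\cong\langle x_1,x_2\mid (x_1x_2)^2=(x_2x_1)^2=e\rangle .$$
   Context: $e$ denotes the unit element of the group. A curve (arrangement) is real if its components are defined by equations with real coefficients. In the paper, "two tangent conics" always means two (smooth) conics in $\mathbb{C}\mathbb{P}^2$ which are tangent to each other at two points. *)

theory Defs
  imports "HOL-Analysis.Analysis" "HOL-Algebra.Group"
begin

section \<open>The complex projective plane\<close>

definition proportional :: "complex^3 \<Rightarrow> complex^3 \<Rightarrow> bool"
  where "proportional v w \<longleftrightarrow> v \<noteq> 0 \<and> w \<noteq> 0 \<and> (\<exists>c. c \<noteq> 0 \<and> w = c *s v)"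

lemma part_equivp_proportional: "part_equivp proportional"
proof (rule part_equivpI)
  have "proportional (axis 1 1) (axis 1 1)"
    unfolding proportional_def by (auto simp: axis_eq_0_iff intro!: exI[of _ 1])
  then show "\<exists>x. proportional x x" by blast
  show "symp proportional"
  proof (rule sympI)
    fix v w assume "proportional v w"
    then obtain c where "v \<noteq> 0" "w \<noteq> 0" "c \<noteq> 0" "w = c *s v"
      unfolding proportional_def by blast
    then show "proportional w v"
      unfolding proportional_def by (auto intro!: exI[of _ "inverse c"] simp: vector_smult_assoc)
  qed
  show "transp proportional"
  proof (rule transpI)
    fix u v w assume "proportional u v" "proportional v w"
    then obtain c d where "u \<noteq> 0" "w \<noteq> 0" "c \<noteq> 0" "d \<noteq> 0" "w = d *s (c *s u)"
      unfolding proportional_def by blast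
    then show "proportional u w"
      unfolding proportional_def by (auto intro!: exI[of _ "d * c"] simp: vector_smult_assoc)
  qed
qed

quotient_type cp2 = "complex^3" / partial: proportional
  morphisms rep_cp2 proj
  by (rule part_equivp_proportional)

text \<open>The map \<^const>\<open>proj\<close> sends a nonzero vector to the line it spans; its value at \<open>0\<close> is
  meaningless and is never used.  The topology is the quotient topology from the open subset
  \<open>- {0}\<close> of \<open>complex^3\<close>.\<close>

lemma proj_eq_iff:
  assumes "v \<noteq> 0" "w \<noteq> 0"
  shows "proj v = proj w \<longleftrightarrow> (\<exists>c. c \<noteq> 0 \<and> w = c *s v)"
proof -
  have refl: "proportional u u" if "u \<noteq> 0" for u
    using that unfolding proportional_def by (auto intro!: exI[of _ 1])
  show ?thesis
    using Quotient3_rel[OF Quotient3_cp2, of v w] refl assms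
    by (auto simp: proportional_def)
qed

lemma proj_surj: "\<exists>v. v \<noteq> 0 \<and> proj v = P"
  using Quotient3_abs_rep[OF Quotient3_cp2, of P] Quotient3_rep_reflp[OF Quotient3_cp2, of P]
  by (auto simp: proportional_def)

instantiation cp2 :: topological_space
begin

definition open_cp2 :: "cp2 set \<Rightarrow> bool"
  where "open_cp2 U \<longleftrightarrow> open {v. v \<noteq> 0 \<and> proj v \<in> U}"

instance
proof
  show "open (UNIV :: cp2 set)"
    by (simp add: open_cp2_def open_Collect_neq)
  show "open (U \<inter> V)" if "open U" "open V" for U V :: "cp2 set"
  proof -
    have "{v. v \<noteq> 0 \<and> proj v \<in> U \<inter> V} = {v. v \<noteq> 0 \<and> proj v \<in> U} \<inter> {v. v \<noteq> 0 \<and> proj v \<in> V}"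
      by auto
    with that show ?thesis by (simp add: open_cp2_def open_Int)
  qed
  show "open (\<Union>K)" if "\<forall>U\<in>K. open U" for K :: "cp2 set set"
  proof -
    have "{v. v \<noteq> 0 \<and> proj v \<in> \<Union>K} = (\<Union>U\<in>K. {v. v \<noteq> 0 \<and> proj v \<in> U})"
      by auto
    with that show ?thesis by (auto simp: open_cp2_def)
  qed
qed

end


section \<open>Conics\<close>

definition quadratic_form :: "complex^3^3 \<Rightarrow> complex^3 \<Rightarrow> complex"
  where "quadratic_form A v = (\<Sum>i\<in>UNIV. \<Sum>j\<in>UNIV. A $ i $ j * v $ i * v $ j)"

text \<open>\<open>A\<close> is not assumed symmetric, so a form is induced by many matrices; every form with real
  coefficients is induced by a real matrix.\<close>

definition real_quadratic_form :: "(complex^3 \<Rightarrow> complex) \<Rightarrow> bool"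
  where "real_quadratic_form F \<longleftrightarrow> (\<exists>A. (\<forall>i j. A $ i $ j \<in> \<real>) \<and> F = quadratic_form A)"

definition zero_locus :: "(complex^3 \<Rightarrow> complex) \<Rightarrow> cp2 set"
  where "zero_locus F = {proj v | v. v \<noteq> 0 \<and> F v = 0}"

definition partial_deriv :: "3 \<Rightarrow> (complex^3 \<Rightarrow> complex) \<Rightarrow> complex^3 \<Rightarrow> complex"
  where "partial_deriv i F v = deriv (\<lambda>t. F (v + t *s axis i 1)) 0"

definition smooth_curve :: "(complex^3 \<Rightarrow> complex) \<Rightarrow> bool"
  where "smooth_curve F \<longleftrightarrow> (\<forall>v. v \<noteq> 0 \<and> F v = 0 \<longrightarrow> (\<exists>i. partial_deriv i F v \<noteq> 0))"

definition tangent_line :: "(complex^3 \<Rightarrow> complex) \<Rightarrow> complex^3 \<Rightarrow> cp2 set"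
  where "tangent_line F v = {proj w | w. w \<noteq> 0 \<and> (\<Sum>i\<in>UNIV. partial_deriv i F v * w $ i) = 0}"

definition tangency_points :: "(complex^3 \<Rightarrow> complex) \<Rightarrow> (complex^3 \<Rightarrow> complex) \<Rightarrow> cp2 set"
  where "tangency_points F G =
    {proj v | v. v \<noteq> 0 \<and> F v = 0 \<and> G v = 0 \<and> tangent_line F v = tangent_line G v}"

lemma partial_deriv_quadratic_form:
  "partial_deriv k (quadratic_form A) v = (\<Sum>j\<in>UNIV. (A $ k $ j + A $ j $ k) * v $ j)"
proof -
  let ?e = "axis k 1 :: complex^3"
  define D where "D = (\<Sum>i\<in>UNIV. \<Sum>j\<in>UNIV. A $ i $ j * (?e $ i * v $ j + v $ i * ?e $ j))"
  have "((\<lambda>t. quadratic_form A (v + t *s ?e)) has_field_derivative D) (at 0)"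
    unfolding quadratic_form_def D_def vector_add_component vector_smult_component mult.assoc
    by (intro DERIV_sum DERIV_cmult) (auto intro!: derivative_eq_intros simp: algebra_simps)
  moreover have "D = (\<Sum>j\<in>UNIV. (A $ k $ j + A $ j $ k) * v $ j)"
    using exhaust_3[of k] unfolding D_def sum_3 by (elim disjE) (simp_all add: axis_def algebra_simps)
  ultimately have "((\<lambda>t. quadratic_form A (v + t *s ?e)) has_field_derivative
      (\<Sum>j\<in>UNIV. (A $ k $ j + A $ j $ k) * v $ j)) (at 0)"
    by simp
  then show ?thesis
    unfolding partial_deriv_def by (rule DERIV_imp_deriv)
qed


section \<open>The fundamental group\<close>

definition loops :: "'a::topological_space set \<Rightarrow> 'a \<Rightarrow> (real \<Rightarrow> 'a) set"
  where "loops X b = {p. path p \<and> path_image p \<subseteq> X \<and> pathstart p = b \<and> pathfinish p = b}"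

definition loop_homotopy :: "'a::topological_space set \<Rightarrow> 'a \<Rightarrow> ((real \<Rightarrow> 'a) \<times> (real \<Rightarrow> 'a)) set"
  where "loop_homotopy X b = {(p, q). p \<in> loops X b \<and> q \<in> loops X b \<and> homotopic_paths X p q}"

text \<open>Paths are functions on all of \<open>real\<close>, but only their values on \<open>{0..1}\<close> matter:
  \<^const>\<open>homotopic_paths\<close> identifies paths that agree there.\<close>

definition fundamental_group :: "'a::topological_space set \<Rightarrow> 'a \<Rightarrow> (real \<Rightarrow> 'a) set monoid"
  where "fundamental_group X b =
    \<lparr>carrier = loops X b // loop_homotopy X b,
     mult = (\<lambda>\<alpha> \<beta>. \<Union>p\<in>\<alpha>. \<Union>q\<in>\<beta>. loop_homotopy X b `` {p +++ q}),
     one = loop_homotopy X b `` {\<lambda>_. b}\<rparr>"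

lemma equiv_loop_homotopy: "equiv (loops X b) (loop_homotopy X b)"
proof (rule equivI)
  show "loop_homotopy X b \<subseteq> loops X b \<times> loops X b"
    by (auto simp: loop_homotopy_def)
  show "refl_on (loops X b) (loop_homotopy X b)"
    by (auto simp: refl_on_def loop_homotopy_def loops_def)
  show "sym (loop_homotopy X b)"
    by (simp add: sym_def loop_homotopy_def homotopic_paths_sym_eq)
  show "trans (loop_homotopy X b)"
    unfolding trans_def loop_homotopy_def by (blast intro: homotopic_paths_trans)
qed

lemma loops_join: "p \<in> loops X b \<Longrightarrow> q \<in> loops X b \<Longrightarrow> p +++ q \<in> loops X b"
  by (auto simp: loops_def path_image_join)

lemma loops_reverse: "p \<in> loops X b \<Longrightarrow> reversepath p \<in> loops X b"
  by (auto simp: loops_def)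

lemma loops_const: "b \<in> X \<Longrightarrow> (\<lambda>_. b) \<in> loops X b"
  by (auto simp: loops_def path_def path_image_def pathstart_def pathfinish_def)

lemma loop_homotopy_join:
  "(p, p') \<in> loop_homotopy X b \<Longrightarrow> (q, q') \<in> loop_homotopy X b
    \<Longrightarrow> (p +++ q, p' +++ q') \<in> loop_homotopy X b"
  by (auto simp: loop_homotopy_def loops_join)
     (auto simp: loops_def intro!: homotopic_paths_join)

lemma loop_homotopy_compose:
  assumes p: "p \<in> loops X b" and fg: "homotopic_paths {0..1} f g"
    and "p \<circ> f \<in> loops X b" "p \<circ> g \<in> loops X b"
  shows "(p \<circ> f, p \<circ> g) \<in> loop_homotopy X b"
proof -
  have "continuous_on {0..1} p" "p \<in> {0..1} \<rightarrow> X"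
    using p by (auto simp: loops_def path_def path_image_def)
  then have "homotopic_paths X (p \<circ> f) (p \<circ> g)"
    using fg by (intro homotopic_paths_continuous_image)
  with assms show ?thesis by (simp add: loop_homotopy_def)
qed

text \<open>The library has the unit and inverse laws for \<^const>\<open>homotopic_paths\<close> only in normed
  spaces; every path factors through one in \<open>{0..1}\<close>.\<close>

lemma loop_homotopy_lid:
  assumes "p \<in> loops X b"
  shows "((\<lambda>_. b) +++ p, p) \<in> loop_homotopy X b"
proof -
  have b: "b \<in> X" and p0: "p 0 = b"
    using assms by (auto simp: loops_def path_image_def pathstart_def)
  have eq: "p \<circ> (linepath 0 0 +++ linepath 0 1) = (\<lambda>_. b) +++ p" "p \<circ> linepath 0 1 = p"
    using p0 by (auto simp: joinpaths_def linepath_def fun_eq_iff)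
  have h: "homotopic_paths {0..1} (linepath 0 0 +++ linepath 0 1) (linepath 0 (1::real))"
    using homotopic_paths_lid[of "linepath 0 (1::real)" "{0..1}"]
    by (simp add: closed_segment_eq_real_ivl)
  show ?thesis
    using loop_homotopy_compose[OF assms h] assms loops_join[OF loops_const[OF b] assms]
    by (simp add: eq)
qed

lemma loop_homotopy_linv:
  assumes "p \<in> loops X b"
  shows "(reversepath p +++ p, \<lambda>_. b) \<in> loop_homotopy X b"
proof -
  have b: "b \<in> X" and p1: "p 1 = b"
    using assms by (auto simp: loops_def path_image_def pathstart_def pathfinish_def)
  have eq: "p \<circ> (linepath 1 0 +++ linepath 0 1) = reversepath p +++ p"
    "p \<circ> linepath 1 1 = (\<lambda>_. b)"
    using p1 by (auto simp: joinpaths_def reversepath_def linepath_def fun_eq_iff algebra_simps)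
  have h: "homotopic_paths {0..1} (linepath 1 0 +++ linepath 0 1) (linepath 1 (1::real))"
    using homotopic_paths_linv[of "linepath 0 (1::real)" "{0..1}"]
    by (simp add: closed_segment_eq_real_ivl)
  show ?thesis
    using loop_homotopy_compose[OF assms h] loops_join[OF loops_reverse[OF assms] assms]
      loops_const[OF b]
    by (simp add: eq)
qed

lemma loop_homotopy_assoc:
  assumes "p \<in> loops X b" "q \<in> loops X b" "r \<in> loops X b"
  shows "(p +++ (q +++ r), (p +++ q) +++ r) \<in> loop_homotopy X b"
proof -
  have "homotopic_paths X (p +++ (q +++ r)) ((p +++ q) +++ r)"
    using assms by (intro homotopic_paths_assoc) (simp_all add: loops_def)
  then show ?thesis
    using assms by (simp add: loop_homotopy_def loops_join)
qed

lemma fundamental_group_mult: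
  assumes "p \<in> loops X b" "q \<in> loops X b"
  shows "loop_homotopy X b `` {p} \<otimes>\<^bsub>fundamental_group X b\<^esub> loop_homotopy X b `` {q}
    = loop_homotopy X b `` {p +++ q}"
proof -
  note E = equiv_loop_homotopy[of X b]
  have "(\<lambda>p q. loop_homotopy X b `` {p +++ q}) respects2 loop_homotopy X b"
    by (rule congruent2I') (rule equiv_class_eq[OF E], rule loop_homotopy_join)
  from UN_equiv_class2[OF E E this assms] show ?thesis
    by (simp add: fundamental_group_def)
qed

lemma group_fundamental_group:
  assumes b: "b \<in> X"
  shows "group (fundamental_group X b)"
proof -
  let ?G = "fundamental_group X b" and ?R = "loop_homotopy X b"
  note E = equiv_loop_homotopy[of X b]
  have car: "\<alpha> \<in> carrier ?G \<longleftrightarrow> (\<exists>p\<in>loops X b. \<alpha> = ?R `` {p})" for \<alpha>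
    by (auto simp: fundamental_group_def quotient_def)
  have one: "\<one>\<^bsub>?G\<^esub> = ?R `` {\<lambda>_. b}"
    by (simp add: fundamental_group_def)
  show ?thesis
  proof (rule groupI)
    show "\<one>\<^bsub>?G\<^esub> \<in> carrier ?G"
      using loops_const[OF b] by (auto simp: one car)
    fix \<alpha> assume "\<alpha> \<in> carrier ?G"
    then obtain p where p: "p \<in> loops X b" "\<alpha> = ?R `` {p}" by (auto simp: car)
    show "\<one>\<^bsub>?G\<^esub> \<otimes>\<^bsub>?G\<^esub> \<alpha> = \<alpha>"
      using equiv_class_eq[OF E loop_homotopy_lid[OF p(1)]]
      by (simp add: one p fundamental_group_mult loops_const[OF b])
    show "\<exists>\<beta>\<in>carrier ?G. \<beta> \<otimes>\<^bsub>?G\<^esub> \<alpha> = \<one>\<^bsub>?G\<^esub>"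
      using equiv_class_eq[OF E loop_homotopy_linv[OF p(1)]] p loops_reverse[OF p(1)]
      by (intro bexI[of _ "?R `` {reversepath p}"]) (auto simp: one fundamental_group_mult car)
    fix \<beta> assume "\<beta> \<in> carrier ?G"
    then obtain q where q: "q \<in> loops X b" "\<beta> = ?R `` {q}" by (auto simp: car)
    show "\<alpha> \<otimes>\<^bsub>?G\<^esub> \<beta> \<in> carrier ?G"
      using loops_join[OF p(1) q(1)] by (auto simp: p q fundamental_group_mult car)
    fix \<gamma> assume "\<gamma> \<in> carrier ?G"
    then obtain r where r: "r \<in> loops X b" "\<gamma> = ?R `` {r}" by (auto simp: car)
    have "(p +++ (q +++ r), (p +++ q) +++ r) \<in> ?R"
      by (rule loop_homotopy_assoc) (fact p q r)+
    from equiv_class_eq[OF E this]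
    show "\<alpha> \<otimes>\<^bsub>?G\<^esub> \<beta> \<otimes>\<^bsub>?G\<^esub> \<gamma> = \<alpha> \<otimes>\<^bsub>?G\<^esub> (\<beta> \<otimes>\<^bsub>?G\<^esub> \<gamma>)"
      using p q r by (simp add: fundamental_group_mult loops_join)
  qed
qed


section \<open>Groups given by generators and relations\<close>

text \<open>A word is a list of letters; the letter \<open>(x, True)\<close> stands for the generator \<open>x\<close> and
  \<open>(x, False)\<close> for its formal inverse.  The generators are all elements of the type \<open>'a\<close>, and a
  pair \<open>(u, v)\<close> of words stands for the relation \<open>u = v\<close>.\<close>

type_synonym 'a word = "('a \<times> bool) list"

inductive word_eq :: "('a word \<times> 'a word) set \<Rightarrow> 'a word \<Rightarrow> 'a word \<Rightarrow> bool" for R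
  where
    refl: "word_eq R u u"
  | sym: "word_eq R u v \<Longrightarrow> word_eq R v u"
  | trans: "word_eq R u v \<Longrightarrow> word_eq R v w \<Longrightarrow> word_eq R u w"
  | cancel: "word_eq R (u @ [(x, s), (x, \<not> s)] @ v) (u @ v)"
  | relation: "(l, r) \<in> R \<Longrightarrow> word_eq R (u @ l @ v) (u @ r @ v)"

definition word_eq_rel :: "('a word \<times> 'a word) set \<Rightarrow> ('a word \<times> 'a word) set"
  where "word_eq_rel R = {(u, v). word_eq R u v}"

definition presented_group :: "('a word \<times> 'a word) set \<Rightarrow> 'a word set monoid"
  where "presented_group R =
    \<lparr>carrier = UNIV // word_eq_rel R,
     mult = (\<lambda>\<alpha> \<beta>. \<Union>u\<in>\<alpha>. \<Union>v\<in>\<beta>. word_eq_rel R `` {u @ v}),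
     one = word_eq_rel R `` {[]}\<rparr>"

lemma equiv_word_eq_rel: "equiv UNIV (word_eq_rel R)"
proof (rule equivI)
  show "refl_on UNIV (word_eq_rel R)"
    by (simp add: word_eq_rel_def refl_on_def word_eq.refl)
  show "sym (word_eq_rel R)"
    unfolding word_eq_rel_def sym_def by (blast intro: word_eq.sym)
  show "trans (word_eq_rel R)"
    unfolding word_eq_rel_def trans_def by (blast intro: word_eq.trans)
qed simp

lemma word_eq_context: "word_eq R u v \<Longrightarrow> word_eq R (a @ u @ c) (a @ v @ c)"
proof (induction rule: word_eq.induct)
  case (refl u)
  show ?case by (rule word_eq.refl)
next
  case (sym u v)
  then show ?case by (blast intro: word_eq.sym)
next
  case (trans u v w)
  then show ?case by (blast intro: word_eq.trans)
next
  case (cancel u x s v)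
  show ?case using word_eq.cancel[of R "a @ u" x s "v @ c"] by simp
next
  case (relation l r u v)
  then show ?case using word_eq.relation[of l r R "a @ u" "v @ c"] by simp
qed

lemma word_eq_append: "word_eq R u u' \<Longrightarrow> word_eq R v v' \<Longrightarrow> word_eq R (u @ v) (u' @ v')"
  using word_eq_context[of R u u' "[]" v] word_eq_context[of R v v' u' "[]"]
  by (metis word_eq.trans append_Nil append_Nil2)

lemma presented_group_mult:
  "word_eq_rel R `` {u} \<otimes>\<^bsub>presented_group R\<^esub> word_eq_rel R `` {v} = word_eq_rel R `` {u @ v}"
proof -
  note E = equiv_word_eq_rel[of R]
  have "(\<lambda>u v. word_eq_rel R `` {u @ v}) respects2 word_eq_rel R"
    by (rule congruent2I', rule equiv_class_eq[OF E]) (simp add: word_eq_rel_def word_eq_append)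
  from UN_equiv_class2[OF E E this UNIV_I UNIV_I] show ?thesis
    by (simp add: presented_group_def)
qed

lemma word_eq_linv: "\<exists>v. word_eq R (v @ u) []"
proof (induction u)
  case Nil
  show ?case by (rule exI[of _ "[]"]) (simp add: word_eq.refl)
next
  case (Cons l u)
  then obtain v where v: "word_eq R (v @ u) []" by blast
  obtain x s where l: "l = (x, s)" by (cases l)
  have "word_eq R ((v @ [(x, \<not> s)]) @ l # u) (v @ u)"
    using word_eq.cancel[of R v x "\<not> s" u] by (simp add: l)
  with v show ?case by (blast intro: word_eq.trans)
qed

lemma group_presented_group: "group (presented_group R)"
proof -
  let ?G = "presented_group R" and ?E = "word_eq_rel R"
  have car: "\<alpha> \<in> carrier ?G \<longleftrightarrow> (\<exists>u. \<alpha> = ?E `` {u})" for \<alpha>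
    by (auto simp: presented_group_def quotient_def)
  have one: "\<one>\<^bsub>?G\<^esub> = ?E `` {[]}"
    by (simp add: presented_group_def)
  show ?thesis
  proof (rule groupI)
    show "\<one>\<^bsub>?G\<^esub> \<in> carrier ?G" by (auto simp: one car)
    fix \<alpha> assume "\<alpha> \<in> carrier ?G"
    then obtain u where u: "\<alpha> = ?E `` {u}" by (auto simp: car)
    show "\<one>\<^bsub>?G\<^esub> \<otimes>\<^bsub>?G\<^esub> \<alpha> = \<alpha>" by (simp add: one u presented_group_mult)
    obtain v where "word_eq R (v @ u) []" using word_eq_linv by blast
    then have "?E `` {v @ u} = ?E `` {[]}"
      by (intro equiv_class_eq[OF equiv_word_eq_rel]) (simp add: word_eq_rel_def)
    then show "\<exists>\<beta>\<in>carrier ?G. \<beta> \<otimes>\<^bsub>?G\<^esub> \<alpha> = \<one>\<^bsub>?G\<^esub>"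
      by (intro bexI[of _ "?E `` {v}"]) (auto simp: one u presented_group_mult car)
    fix \<beta> assume "\<beta> \<in> carrier ?G"
    then obtain v where v: "\<beta> = ?E `` {v}" by (auto simp: car)
    show "\<alpha> \<otimes>\<^bsub>?G\<^esub> \<beta> \<in> carrier ?G" by (auto simp: u v presented_group_mult car)
    fix \<gamma> assume "\<gamma> \<in> carrier ?G"
    then obtain w where w: "\<gamma> = ?E `` {w}" by (auto simp: car)
    show "\<alpha> \<otimes>\<^bsub>?G\<^esub> \<beta> \<otimes>\<^bsub>?G\<^esub> \<gamma> = \<alpha> \<otimes>\<^bsub>?G\<^esub> (\<beta> \<otimes>\<^bsub>?G\<^esub> \<gamma>)"
      by (simp add: u v w presented_group_mult)
  qed
qed

datatype two_gens = X1 | X2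

definition x1 :: "two_gens word" where "x1 = [(X1, True)]"
definition x2 :: "two_gens word" where "x2 = [(X2, True)]"

end

theory Submission
  imports Defs "HOL-Complex_Analysis.Riemann_Mapping"
begin

text \<open>
  Take the two points of tangency and the intersection of the two common tangents as a basis,
  suitably scaled.  The conics become \<open>Q = 0\<close> and \<open>Q = z\<^sup>2\<close>, where \<open>Q = x y + c z\<^sup>2\<close> with
  \<open>c \<noteq> 0, 1\<close> (\<open>bitangent_normal_form\<close>).  They are members of a pencil of conics, and
  \<open>w = z\<^sup>2 / Q\<close> maps the complement \<open>X\<close> of both to the plane punctured at \<open>1\<close>.  The generic fibre
  is a conic without the two points of tangency, so it is a punctured plane.  There are two special
  fibres.  Over \<open>w = 0\<close> lies the line \<open>z = 0\<close>, with multiplicity two; over \<open>w = 1 / c\<close> lies the pair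
  of lines \<open>x y = 0\<close>, in which the circle of the generic fibre becomes contractible.  So the
  fundamental group of \<open>X\<close> is the orbifold fundamental group of the plane that is punctured at \<open>1\<close>
  and has a cone point of order two at \<open>0\<close>: it is generated by a loop \<open>a\<close> around \<open>0\<close> and a loop
  \<open>b\<close> around \<open>1\<close>, with the only relation \<open>a\<^sup>2 = 1\<close>.  The generators \<open>x\<^sub>2 = b\<close> and
  \<open>x\<^sub>1 = a b\<^sup>-\<^sup>1\<close> give the presentation of the theorem.

  That \<open>a\<close> and \<open>b\<close> generate is \<open>circles_generate\<close>.  The lines \<open>x = 0\<close> and \<open>z = 0\<close> have real
  codimension two, so loops can be moved off them (\<open>homotopic_path_avoiding_zero\<close>,
  \<open>loops_generate_union\<close>).  What is left of \<open>X\<close> is the product of a punctured plane and the plane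
  punctured at \<open>0\<close> and \<open>1\<close>; loops of the first factor are null-homotopic in \<open>X\<close>
  (\<open>fibre_loop_null\<close>), and circles around the two punctures generate the fundamental group of the
  second.  The relation \<open>a\<^sup>2 = 1\<close> holds because \<open>a\<^sup>2\<close>, up to a loop in a fibre, bounds a disc
  transverse to the double fibre (\<open>circle0_squared\<close>).

  That there are no further relations is shown by a homomorphism in the opposite direction.  Given
  any group with elements \<open>\<tau>\<close> and \<open>\<beta>\<close> such that \<open>\<tau>\<^sup>2 = 1\<close>, there is a homotopy invariant of
  paths in \<open>X\<close> that sends \<open>a\<close> to \<open>\<tau>\<close> and \<open>b\<close> to \<open>\<beta>\<close> (\<open>monodromy_circles\<close>).  It multiplies up
  the crossings of cuts in the \<open>w\<close>-plane and, near the double fibre, the crossings of a cut in the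
  plane of a square root of \<open>w\<close>; its homotopy invariance is a general fact about open covers
  (\<open>monodromy_homotopic\<close>).  With the presented group itself as the group of values, the invariant is
  inverse to the evaluation of words in the generators (\<open>fundamental_group_base\<close>).
\<close>

section \<open>Paths up to homotopy in an arbitrary space\<close>

lemma path_const: "path (\<lambda>_. x)"
  by (simp add: path_def)

lemma pathstart_const [simp]: "pathstart (\<lambda>_. x) = x" and pathfinish_const [simp]: "pathfinish (\<lambda>_. x) = x"
  for x :: "'a::topological_space"
  by (simp_all add: pathstart_def pathfinish_def)

lemma path_neighbourhood:
  fixes p :: "real \<Rightarrow> 'a::topological_space"
  assumes "path p" "t \<in> {0..1}" "open N" "p t \<in> N"
  obtains d where "d > 0" "\<And>s. s \<in> {0..1} \<Longrightarrow> \<bar>s - t\<bar> < d \<Longrightarrow> p s \<in> N"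
proof -
  have "\<forall>\<^sub>F s in at t within {0..1}. p s \<in> N"
    using assms unfolding path_def continuous_on_def by (blast intro: topological_tendstoD)
  then obtain d where "d > 0" "\<forall>s\<in>{0..1}. s \<noteq> t \<and> dist s t < d \<longrightarrow> p s \<in> N"
    unfolding eventually_at by blast
  with assms(4) show thesis
    by (intro that[of d]) (auto simp: dist_real_def)
qed

text \<open>The groupoid laws hold in every topological space because a path factors through \<open>{0..1}\<close>:
  each law is the image of a homotopy between two paths in this interval.\<close>

lemma homotopic_paths_reparametrized:
  assumes "path p" "path_image p \<subseteq> X" "homotopic_paths {0..1} f g"
  shows "homotopic_paths X (p \<circ> f) (p \<circ> g)"
  using assms by (intro homotopic_paths_continuous_image[where S = "{0..1}"])
    (auto simp: path_def path_image_def)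

lemma homotopic_paths_const_left:
  assumes "path p" "path_image p \<subseteq> X" "pathstart p = x"
  shows "homotopic_paths X ((\<lambda>_. x) +++ p) p"
proof -
  have "p \<circ> (linepath 0 0 +++ linepath 0 1) = (\<lambda>_. x) +++ p" "p \<circ> linepath 0 1 = p"
    using assms(3) by (auto simp: joinpaths_def linepath_def fun_eq_iff pathstart_def)
  with homotopic_paths_reparametrized[OF assms(1,2)
      homotopic_paths_lid'[of "linepath 0 (1::real)" "{0..1}" 0]]
  show ?thesis by (simp add: closed_segment_eq_real_ivl)
qed

lemma homotopic_paths_const_right:
  assumes "path p" "path_image p \<subseteq> X" "pathfinish p = x"
  shows "homotopic_paths X (p +++ (\<lambda>_. x)) p"
proof -
  have "p \<circ> (linepath 0 1 +++ linepath 1 1) = p +++ (\<lambda>_. x)" "p \<circ> linepath 0 1 = p"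
    using assms(3) by (auto simp: joinpaths_def linepath_def fun_eq_iff pathfinish_def)
  with homotopic_paths_reparametrized[OF assms(1,2)
      homotopic_paths_rid'[of "linepath 0 (1::real)" "{0..1}" 1]]
  show ?thesis by (simp add: closed_segment_eq_real_ivl)
qed

lemma homotopic_paths_inverse_right:
  assumes "path p" "path_image p \<subseteq> X" "pathstart p = x"
  shows "homotopic_paths X (p +++ reversepath p) (\<lambda>_. x)"
proof -
  have "p \<circ> (linepath 0 1 +++ linepath 1 0) = p +++ reversepath p" "p \<circ> linepath 0 0 = (\<lambda>_. x)"
    using assms(3)
    by (auto simp: joinpaths_def linepath_def fun_eq_iff pathstart_def reversepath_def algebra_simps)
  with homotopic_paths_reparametrized[OF assms(1,2), of "linepath 0 1 +++ linepath 1 0" "linepath 0 0"]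
    homotopic_paths_rinv[of "linepath 0 (1::real)" "{0..1}"]
  show ?thesis by (simp add: closed_segment_eq_real_ivl)
qed

lemma homotopic_paths_inverse_left:
  assumes "path p" "path_image p \<subseteq> X" "pathfinish p = x"
  shows "homotopic_paths X (reversepath p +++ p) (\<lambda>_. x)"
  using homotopic_paths_inverse_right[of "reversepath p" X x] assms by simp

lemma piece_of_path:
  assumes "path p" "path_image p \<subseteq> X" "u \<in> {0..1}" "v \<in> {0..1}"
  shows "path (p \<circ> linepath u v)" "path_image (p \<circ> linepath u v) \<subseteq> X"
    "path_image (p \<circ> linepath u v) = p ` closed_segment u v"
    "pathstart (p \<circ> linepath u v) = p u" "pathfinish (p \<circ> linepath u v) = p v"
proof -
  have uv: "closed_segment u v \<subseteq> {0..1}"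
    using assms(3,4) by (auto simp: closed_segment_eq_real_ivl)
  show "path (p \<circ> linepath u v)"
    using assms(1) uv by (intro path_continuous_image) (auto simp: path_def intro: continuous_on_subset)
  show im: "path_image (p \<circ> linepath u v) = p ` closed_segment u v"
    by (simp add: path_image_compose)
  show "path_image (p \<circ> linepath u v) \<subseteq> X"
    unfolding im using assms(2) uv by (auto simp: path_image_def)
  show "pathstart (p \<circ> linepath u v) = p u" "pathfinish (p \<circ> linepath u v) = p v"
    by (simp_all add: pathstart_compose pathfinish_compose)
qed

lemma homotopic_paths_pieces_join:
  assumes "path p" "path_image p \<subseteq> X" "u \<in> {0..1}" "v \<in> {0..1}" "w \<in> {0..1}"
  shows "homotopic_paths X ((p \<circ> linepath u v) +++ (p \<circ> linepath v w)) (p \<circ> linepath u w)"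
proof -
  have "homotopic_paths {0..1} (linepath u v +++ linepath v w) (linepath u w)"
  proof (rule homotopic_paths_linear)
    fix t :: real assume t: "t \<in> {0..1}"
    have "path_image (linepath u v +++ linepath v w) \<subseteq> {0..1}" "path_image (linepath u w) \<subseteq> {0..1}"
      using assms(3-5) by (auto simp: path_image_join closed_segment_eq_real_ivl split: if_splits)
    with t have "(linepath u v +++ linepath v w) t \<in> {0..1}" "linepath u w t \<in> {0..1}"
      unfolding path_image_def by blast+
    then show "closed_segment ((linepath u v +++ linepath v w) t) (linepath u w t) \<subseteq> {0..1}"
      by (intro closed_segment_subset) auto
  qed auto
  from homotopic_paths_reparametrized[OF assms(1,2) this] show ?thesis
    by (simp add: path_compose_join)
qed

lemma homotopic_paths_Pair:
  assumes "homotopic_paths S p p'" "homotopic_paths T q q'"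
  shows "homotopic_paths (S \<times> T) (\<lambda>t. (p t, q t)) (\<lambda>t. (p' t, q' t))"
proof -
  obtain h where h: "continuous_on ({0..1} \<times> {0..1}) h" "h \<in> ({0..1} \<times> {0..1}) \<rightarrow> S"
    "\<forall>x \<in> {0..1}. h (0,x) = p x" "\<forall>x \<in> {0..1}. h (1,x) = p' x"
    "\<forall>t \<in> {0..1::real}. pathstart (h \<circ> Pair t) = pathstart p \<and> pathfinish (h \<circ> Pair t) = pathfinish p"
    using assms(1) unfolding homotopic_paths by blast
  obtain k where k: "continuous_on ({0..1} \<times> {0..1}) k" "k \<in> ({0..1} \<times> {0..1}) \<rightarrow> T"
    "\<forall>x \<in> {0..1}. k (0,x) = q x" "\<forall>x \<in> {0..1}. k (1,x) = q' x"
    "\<forall>t \<in> {0..1::real}. pathstart (k \<circ> Pair t) = pathstart q \<and> pathfinish (k \<circ> Pair t) = pathfinish q"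
    using assms(2) unfolding homotopic_paths by blast
  show ?thesis
    unfolding homotopic_paths
    using h k by (intro exI[of _ "\<lambda>x. (h x, k x)"])
      (auto intro!: continuous_on_Pair simp: pathstart_def pathfinish_def)
qed

abbreviation loop_class :: "'a::topological_space set \<Rightarrow> 'a \<Rightarrow> (real \<Rightarrow> 'a) \<Rightarrow> (real \<Rightarrow> 'a) set"
  where "loop_class X b p \<equiv> loop_homotopy X b `` {p}"

lemma in_carrier_fundamental_group:
  "\<alpha> \<in> carrier (fundamental_group X b) \<longleftrightarrow> (\<exists>p\<in>loops X b. \<alpha> = loop_class X b p)"
  by (auto simp: fundamental_group_def quotient_def)

lemma loop_class_in_carrier: "p \<in> loops X b \<Longrightarrow> loop_class X b p \<in> carrier (fundamental_group X b)"
  by (auto simp: in_carrier_fundamental_group)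

lemma one_fundamental_group: "\<one>\<^bsub>fundamental_group X b\<^esub> = loop_class X b (\<lambda>_. b)"
  by (simp add: fundamental_group_def)

lemma loop_class_eqI: "p \<in> loops X b \<Longrightarrow> homotopic_paths X p q \<Longrightarrow> loop_class X b p = loop_class X b q"
proof (rule equiv_class_eq[OF equiv_loop_homotopy])
  assume "p \<in> loops X b" "homotopic_paths X p q"
  then show "(p, q) \<in> loop_homotopy X b"
    using homotopic_paths_imp_path[of X p q] homotopic_paths_imp_subset[of X p q]
      homotopic_paths_imp_pathstart[of X p q] homotopic_paths_imp_pathfinish[of X p q]
    by (auto simp: loop_homotopy_def loops_def)
qed

lemma loop_class_eqD:
  assumes "loop_class X b p = loop_class X b q" "q \<in> loops X b"
  shows "homotopic_paths X p q"
proof -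
  have "(p, q) \<in> loop_homotopy X b"
    using eq_equiv_class[OF assms(1) equiv_loop_homotopy assms(2)] .
  then show ?thesis by (simp add: loop_homotopy_def)
qed

lemma loop_class_reverse:
  assumes "p \<in> loops X b"
  shows "loop_class X b (reversepath p) = inv\<^bsub>fundamental_group X b\<^esub> (loop_class X b p)"
proof -
  have b: "b \<in> X" using assms by (auto simp: loops_def path_image_def pathstart_def)
  interpret group "fundamental_group X b" by (rule group_fundamental_group[OF b])
  have "loop_class X b (reversepath p) \<otimes>\<^bsub>fundamental_group X b\<^esub> loop_class X b p = \<one>\<^bsub>fundamental_group X b\<^esub>"
    using equiv_class_eq[OF equiv_loop_homotopy loop_homotopy_linv[OF assms]]
    by (simp add: fundamental_group_mult assms loops_reverse one_fundamental_group)
  then show ?thesis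
    using inv_equality loop_class_in_carrier[OF assms] loop_class_in_carrier[OF loops_reverse[OF assms]]
    by metis
qed

lemma loops_conjugate:
  assumes "path \<gamma>" "path_image \<gamma> \<subseteq> X" "pathstart \<gamma> = b" "pathfinish \<gamma> = pathstart p"
    "path p" "path_image p \<subseteq> X"
    "path \<delta>" "path_image \<delta> \<subseteq> X" "pathstart \<delta> = b" "pathfinish \<delta> = pathfinish p"
  shows "\<gamma> +++ (p +++ reversepath \<delta>) \<in> loops X b"
  using assms by (auto simp: loops_def path_image_join)

text \<open>When consecutive paths are closed up by tails from the base point, the tail in the middle is run
  backwards and forwards, hence cancels.\<close>

lemma loop_class_conjugate_join:
  fixes X :: "'a::topological_space set"
  assumes \<gamma>: "path \<gamma>" "path_image \<gamma> \<subseteq> X" "pathstart \<gamma> = b" "pathfinish \<gamma> = pathstart p"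
    and p: "path p" "path_image p \<subseteq> X"
    and \<delta>: "path \<delta>" "path_image \<delta> \<subseteq> X" "pathstart \<delta> = b" "pathfinish \<delta> = pathfinish p"
    and q: "path q" "path_image q \<subseteq> X" "pathstart q = pathfinish p"
    and \<epsilon>: "path \<epsilon>" "path_image \<epsilon> \<subseteq> X" "pathstart \<epsilon> = b" "pathfinish \<epsilon> = pathfinish q"
  shows "homotopic_paths X ((\<gamma> +++ (p +++ reversepath \<delta>)) +++ (\<delta> +++ (q +++ reversepath \<epsilon>)))
    (\<gamma> +++ ((p +++ q) +++ reversepath \<epsilon>))"
proof -
  let ?h = "homotopic_paths X"
  let ?t = "q +++ reversepath \<epsilon>"
  have t: "path ?t" "path_image ?t \<subseteq> X" "pathstart ?t = pathfinish p"
    using q \<epsilon> by (auto simp: path_image_join)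
  have "?h ((\<gamma> +++ (p +++ reversepath \<delta>)) +++ (\<delta> +++ ?t)) (\<gamma> +++ ((p +++ reversepath \<delta>) +++ (\<delta> +++ ?t)))"
    by (rule homotopic_paths_sym, rule homotopic_paths_assoc)
      (use \<gamma> p \<delta> t in \<open>auto simp: path_image_join\<close>)
  also have "?h \<dots> (\<gamma> +++ (p +++ (reversepath \<delta> +++ (\<delta> +++ ?t))))"
    by (rule homotopic_paths_join, simp add: \<gamma>, rule homotopic_paths_sym, rule homotopic_paths_assoc)
      (use \<gamma> p \<delta> t in \<open>auto simp: path_image_join\<close>)
  also have "?h \<dots> (\<gamma> +++ (p +++ ((reversepath \<delta> +++ \<delta>) +++ ?t)))"
    by (rule homotopic_paths_join, simp add: \<gamma>, rule homotopic_paths_join, simp add: p,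
        rule homotopic_paths_assoc)
      (use \<gamma> p \<delta> t in \<open>auto simp: path_image_join\<close>)
  also have "?h \<dots> (\<gamma> +++ (p +++ ((\<lambda>_. pathfinish p) +++ ?t)))"
    by (rule homotopic_paths_join, simp add: \<gamma>, rule homotopic_paths_join, simp add: p,
        rule homotopic_paths_join, rule homotopic_paths_inverse_left)
      (use \<gamma> p \<delta> t in \<open>auto simp: path_image_join\<close>)
  also have "?h \<dots> (\<gamma> +++ (p +++ ?t))"
    by (rule homotopic_paths_join, simp add: \<gamma>, rule homotopic_paths_join, simp add: p,
        rule homotopic_paths_const_left)
      (use \<gamma> p \<delta> t in \<open>auto simp: path_image_join\<close>)
  also have "?h \<dots> (\<gamma> +++ ((p +++ q) +++ reversepath \<epsilon>))"
    by (rule homotopic_paths_join, simp add: \<gamma>, rule homotopic_paths_assoc)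
      (use \<gamma> p q \<epsilon> in \<open>auto simp: path_image_join\<close>)
  finally show ?thesis .
qed

section \<open>Generation of the fundamental group\<close>

text \<open>A loop is subdivided into local paths.  Closed up by the tails \<open>\<gamma>\<close> that join its ends to the base point,
  each local path is a loop with class in \<open>H\<close>, and the loop is the product of these up to
  homotopy and up to conjugation by the tail \<open>\<gamma> b\<close>.\<close>

lemma subgroup_eq_fundamental_group:
  fixes X :: "'a::topological_space set"
  assumes b: "b \<in> X" and H: "subgroup H (fundamental_group X b)"
    and \<gamma>: "\<And>x. x \<in> X \<Longrightarrow> path (\<gamma> x) \<and> path_image (\<gamma> x) \<subseteq> X \<and> pathstart (\<gamma> x) = b \<and> pathfinish (\<gamma> x) = x"
    and \<gamma>b: "loop_class X b (\<gamma> b) \<in> H"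
    and local: "\<And>x. x \<in> X \<Longrightarrow> \<exists>N. open N \<and> x \<in> N \<and>
      (\<forall>p. path p \<and> path_image p \<subseteq> N \<inter> X \<longrightarrow>
        loop_class X b (\<gamma> (pathstart p) +++ (p +++ reversepath (\<gamma> (pathfinish p)))) \<in> H)"
  shows "H = carrier (fundamental_group X b)"
proof
  let ?P = "fundamental_group X b"
  interpret group ?P by (rule group_fundamental_group[OF b])
  show "H \<subseteq> carrier ?P" using H by (rule subgroup.subset)
  let ?c = "\<lambda>p. \<gamma> (pathstart p) +++ (p +++ reversepath (\<gamma> (pathfinish p)))"
  show "carrier ?P \<subseteq> H"
  proof
    fix \<alpha> assume "\<alpha> \<in> carrier ?P"
    then obtain p where p: "p \<in> loops X b" and \<alpha>: "\<alpha> = loop_class X b p"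
      by (auto simp: in_carrier_fundamental_group)
    have pp: "path p" "path_image p \<subseteq> X" and pX: "p t \<in> X" if "t \<in> {0..1}" for t
      using p that by (auto simp: loops_def path_image_def)
    note pp = pp[of 0, simplified]
    have sub: "path (p \<circ> linepath u v)" "path_image (p \<circ> linepath u v) \<subseteq> X"
      "pathstart (p \<circ> linepath u v) = p u" "pathfinish (p \<circ> linepath u v) = p v"
      if "u \<in> {0..1}" "v \<in> {0..1}" for u v
      using piece_of_path[OF pp that] by auto
    have c_loop: "?c (p \<circ> linepath u v) \<in> loops X b" if "u \<in> {0..1}" "v \<in> {0..1}" for u v
      using \<gamma>[OF pX[OF that(1)]] \<gamma>[OF pX[OF that(2)]] sub[OF that] by (intro loops_conjugate) auto
    have "0 \<le> u \<longrightarrow> v \<le> 1 \<longrightarrow> u \<le> v \<longrightarrow> loop_class X b (?c (p \<circ> linepath u v)) \<in> H"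
      if ends01: "0 \<le> u" "u \<le> v" "v \<le> 1" for u v
    proof (induction rule: Bolzano[OF ends01(2), consumes 0])
      case (1 u v w)
      show ?case
      proof (intro impI)
        assume uw: "0 \<le> u" "w \<le> 1" "u \<le> w"
        with 1 have uvw: "u \<in> {0..1}" "v \<in> {0..1}" "w \<in> {0..1}" by auto
        note tails = \<gamma>[OF pX[OF uvw(1)]] \<gamma>[OF pX[OF uvw(2)]] \<gamma>[OF pX[OF uvw(3)]]
        have "homotopic_paths X (?c (p \<circ> linepath u v) +++ ?c (p \<circ> linepath v w))
            (\<gamma> (p u) +++ (((p \<circ> linepath u v) +++ (p \<circ> linepath v w)) +++ reversepath (\<gamma> (p w))))"
          using tails sub uvw by simp (intro loop_class_conjugate_join; simp)
        also have "homotopic_paths X \<dots> (\<gamma> (p u) +++ ((p \<circ> linepath u w) +++ reversepath (\<gamma> (p w))))"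
          using tails sub uvw pp
          by (intro homotopic_paths_join homotopic_paths_pieces_join) auto
        finally have "loop_class X b (?c (p \<circ> linepath u v) +++ ?c (p \<circ> linepath v w))
            = loop_class X b (?c (p \<circ> linepath u w))"
          using sub(3,4) uvw by (intro loop_class_eqI loops_join[OF c_loop c_loop]) simp_all
        moreover have "loop_class X b (?c (p \<circ> linepath u v)) \<otimes>\<^bsub>?P\<^esub> loop_class X b (?c (p \<circ> linepath v w)) \<in> H"
        proof (rule subgroup.m_closed[OF H])
          show "loop_class X b (?c (p \<circ> linepath u v)) \<in> H"
            using 1(1) uw(1) uvw(2) 1(3) by (meson atLeastAtMost_iff)
          show "loop_class X b (?c (p \<circ> linepath v w)) \<in> H"
            using 1(2) uw(2) uvw(2) 1(4) by (meson atLeastAtMost_iff)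
        qed
        ultimately show "loop_class X b (?c (p \<circ> linepath u w)) \<in> H"
          using c_loop uvw by (simp add: fundamental_group_mult)
      qed
    next
      case (2 t)
      then have t: "t \<in> {0..1}" using ends01 by simp
      obtain N where N: "open N" "p t \<in> N"
        "\<And>q. path q \<Longrightarrow> path_image q \<subseteq> N \<inter> X \<Longrightarrow> loop_class X b (?c q) \<in> H"
        using local[OF pX[OF t]] by blast
      obtain d where d: "d > 0" "\<And>s. s \<in> {0..1} \<Longrightarrow> \<bar>s - t\<bar> < d \<Longrightarrow> p s \<in> N"
        using path_neighbourhood[OF pp(1) t N(1,2)] by blast
      show ?case
      proof (intro exI conjI allI impI)
        fix u v assume uv: "u \<le> t \<and> t \<le> v \<and> v - u < d" "0 \<le> u" "v \<le> 1" "u \<le> v"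
        then have "path_image (p \<circ> linepath u v) \<subseteq> N"
          using d(2) piece_of_path(3)[OF pp, of u v] by (auto simp: closed_segment_eq_real_ivl)
        then show "loop_class X b (?c (p \<circ> linepath u v)) \<in> H"
          using uv sub[of u v] by (intro N(3)) auto
      qed (use d in auto)
    qed
    from this[of 0 1] have cH: "loop_class X b (\<gamma> b +++ (p +++ reversepath (\<gamma> b))) \<in> H"
      using p by (simp add: loops_def piece_of_path(4,5)[OF pp] pathstart_def pathfinish_def)
        (simp add: linepath_def o_def)
    have \<gamma>b_loop: "\<gamma> b \<in> loops X b" using \<gamma>[OF b] by (simp add: loops_def)
    let ?g = "loop_class X b (\<gamma> b)"
    have "loop_class X b (\<gamma> b +++ (p +++ reversepath (\<gamma> b))) = ?g \<otimes>\<^bsub>?P\<^esub> (\<alpha> \<otimes>\<^bsub>?P\<^esub> inv\<^bsub>?P\<^esub> ?g)"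
      using \<gamma>b_loop p by (simp add: fundamental_group_mult[symmetric] loops_join loops_reverse \<alpha> loop_class_reverse[symmetric])
    with cH have "?g \<otimes>\<^bsub>?P\<^esub> (\<alpha> \<otimes>\<^bsub>?P\<^esub> inv\<^bsub>?P\<^esub> ?g) \<in> H" by simp
    with \<gamma>b have "inv\<^bsub>?P\<^esub> ?g \<otimes>\<^bsub>?P\<^esub> (?g \<otimes>\<^bsub>?P\<^esub> (\<alpha> \<otimes>\<^bsub>?P\<^esub> inv\<^bsub>?P\<^esub> ?g)) \<otimes>\<^bsub>?P\<^esub> ?g \<in> H"
      by (metis subgroup.m_closed[OF H] subgroup.m_inv_closed[OF H])
    then show "\<alpha> \<in> H"
      using loop_class_in_carrier[OF \<gamma>b_loop] loop_class_in_carrier[OF p]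
      by (simp add: m_assoc[symmetric] \<alpha>) (simp add: m_assoc)
  qed
qed

section \<open>Monodromy with respect to a labelled cover\<close>

text \<open>The points of each set \<open>U i\<close> of an open cover carry labels \<open>h i\<close> in a group; along a path
  inside \<open>U i\<close> the label changes by a right factor, and two sets that both contain the path have to
  agree on that factor.  Multiplying the factors along a subdivision sends any path to a group
  element.  In other words, the labels trivialise a principal bundle with discrete fibre over each
  \<open>U i\<close>, and the product is its monodromy.\<close>

locale labelled_cover = group G for G (structure) +
  fixes X :: "'x::topological_space set" and I :: "'i set" and U :: "'i \<Rightarrow> 'x set"
    and h :: "'i \<Rightarrow> 'x \<Rightarrow> 'a"
  assumes open_U: "i \<in> I \<Longrightarrow> open (U i)"
    and cover: "x \<in> X \<Longrightarrow> \<exists>i\<in>I. x \<in> U i"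
    and label_closed: "i \<in> I \<Longrightarrow> x \<in> U i \<Longrightarrow> h i x \<in> carrier G"
    and compatible: "\<lbrakk>i \<in> I; j \<in> I; path p; path_image p \<subseteq> U i \<inter> U j\<rbrakk> \<Longrightarrow>
      inv h i (pathstart p) \<otimes> h i (pathfinish p) = inv h j (pathstart p) \<otimes> h j (pathfinish p)"
begin

text \<open>The value over \<open>{a..b}\<close> of some subdivision; it is a relation as long as it may depend on the
  subdivision.\<close>

inductive increment :: "(real \<Rightarrow> 'x) \<Rightarrow> real \<Rightarrow> real \<Rightarrow> 'a \<Rightarrow> bool" for p where
  within: "\<lbrakk>i \<in> I; a \<le> b; p ` {a..b} \<subseteq> U i\<rbrakk> \<Longrightarrow> increment p a b (inv h i (p a) \<otimes> h i (p b))"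
| concat: "increment p a b g \<Longrightarrow> increment p b c g' \<Longrightarrow> increment p a c (g \<otimes> g')"

lemma telescope:
  "\<lbrakk>x \<in> carrier G; y \<in> carrier G; z \<in> carrier G\<rbrakk> \<Longrightarrow> (inv x \<otimes> y) \<otimes> (inv y \<otimes> z) = inv x \<otimes> z"
  by (metis inv_closed inv_solve_left' m_assoc m_closed)

lemma increment_le: "increment p a b g \<Longrightarrow> a \<le> b"
  by (induction rule: increment.induct) auto

lemma increment_closed: "increment p a b g \<Longrightarrow> g \<in> carrier G"
proof (induction rule: increment.induct)
  case (within i a b)
  then have "p a \<in> U i" "p b \<in> U i" by auto
  then show ?case using within label_closed by auto
qed auto

lemma increment_split:
  assumes "increment p a b g" "a \<le> c" "c \<le> b"
  shows "\<exists>g1 g2. increment p a c g1 \<and> increment p c b g2 \<and> g = g1 \<otimes> g2"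
  using assms
proof (induction arbitrary: c rule: increment.induct)
  case (within i a b)
  then have "p ` {a..c} \<subseteq> U i" "p ` {c..b} \<subseteq> U i" "p a \<in> U i" "p b \<in> U i" "p c \<in> U i" by auto
  then show ?case
    using within.prems label_closed[OF within.hyps(1)]
    by (intro exI[of _ "inv h i (p a) \<otimes> h i (p c)"] exI[of _ "inv h i (p c) \<otimes> h i (p b)"] conjI
        increment.within[OF within.hyps(1)]) (auto simp: telescope)
next
  case (concat a b g d g')
  show ?case
  proof (cases "c \<le> b")
    case True
    then obtain g1 g2 where "increment p a c g1" "increment p c b g2" "g = g1 \<otimes> g2"
      using concat.IH(1) concat.prems by blast
    with concat.hyps(2) show ?thesis
      by (intro exI[of _ g1] exI[of _ "g2 \<otimes> g'"])
        (auto intro: increment.concat simp: m_assoc increment_closed)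
  next
    case False
    then obtain g1 g2 where "increment p b c g1" "increment p c d g2" "g' = g1 \<otimes> g2"
      using concat.IH(2)[of c] concat.prems by auto
    with concat.hyps(1) show ?thesis
      by (intro exI[of _ "g \<otimes> g1"] exI[of _ g2])
        (auto intro: increment.concat simp: m_assoc increment_closed)
  qed
qed

text \<open>Inside one set of the cover the factors of any subdivision telescope.\<close>

lemma increment_within_eq:
  assumes "increment p a b g" "path p" "0 \<le> a" "b \<le> 1" "i \<in> I" "p ` {a..b} \<subseteq> U i"
  shows "g = inv h i (p a) \<otimes> h i (p b)"
  using assms
proof (induction rule: increment.induct)
  case (within j a b)
  have ab: "a \<in> {0..1}" "b \<in> {0..1}" using within by auto
  note piece = piece_of_path[OF \<open>path p\<close> subset_refl ab]
  show ?case
    using compatible[of j i "p \<circ> linepath a b"] piece within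
    by (simp add: closed_segment_eq_real_ivl)
next
  case (concat a b g c g')
  have le: "a \<le> b" "b \<le> c" using concat.hyps by (auto dest: increment_le)
  then have "p ` {a..b} \<subseteq> U i" "p ` {b..c} \<subseteq> U i" "p a \<in> U i" "p b \<in> U i" "p c \<in> U i"
    using concat.prems(5) by auto
  with concat le show ?case
    using label_closed[OF \<open>i \<in> I\<close>] by (simp add: telescope)
qed

text \<open>Refine the second subdivision by the points of the first.\<close>

lemma increment_unique:
  assumes "increment p a b g" "increment p a b g'" "path p" "0 \<le> a" "b \<le> 1"
  shows "g = g'"
  using assms
proof (induction arbitrary: g' rule: increment.induct)
  case (within i a b)
  then show ?case using increment_within_eq by metis
next
  case (concat a b g c k)
  have le: "a \<le> b" "b \<le> c" using concat.hyps by (auto dest: increment_le)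
  obtain g1 g2 where "increment p a b g1" "increment p b c g2" "g' = g1 \<otimes> g2"
    using increment_split[OF concat.prems(1) le] by blast
  then show ?case using concat le by (metis order.trans)
qed

lemma increment_exists:
  assumes "path p" "path_image p \<subseteq> X" "0 \<le> a" "a \<le> b" "b \<le> 1"
  shows "\<exists>g. increment p a b g"
proof -
  have "0 \<le> a \<longrightarrow> b \<le> 1 \<longrightarrow> a \<le> b \<longrightarrow> (\<exists>g. increment p a b g)"
  proof (induction rule: Bolzano[OF \<open>a \<le> b\<close>, consumes 0])
    case (1 a b c)
    then show ?case by (meson increment.concat order.trans)
  next
    case (2 t)
    then have t: "t \<in> {0..1}" using assms by simp
    then have "p t \<in> X" using assms(2) by (auto simp: path_image_def)
    then obtain i where i: "i \<in> I" "p t \<in> U i" using cover by blast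
    obtain d where d: "d > 0" "\<And>s. s \<in> {0..1} \<Longrightarrow> \<bar>s - t\<bar> < d \<Longrightarrow> p s \<in> U i"
      using path_neighbourhood[OF assms(1) t open_U[OF i(1)] i(2)] by blast
    show ?case
    proof (intro exI[of _ d] conjI allI impI d(1))
      fix u v assume "u \<le> t \<and> t \<le> v \<and> v - u < d" "0 \<le> u" "v \<le> 1" "u \<le> v"
      then have "p ` {u..v} \<subseteq> U i" by (auto intro!: d(2))
      from increment.within[OF i(1) \<open>u \<le> v\<close> this] show "\<exists>g. increment p u v g" by blast
    qed
  qed
  with assms show ?thesis by blast
qed

lemma increment_affine:
  assumes "increment p a b g" "m > 0" "\<And>t. t \<in> {a..b} \<Longrightarrow> q (m * t + n) = p t"
  shows "increment q (m * a + n) (m * b + n) g"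
  using assms(1,3)
proof (induction rule: increment.induct)
  case (within i a b)
  have "q ` {m * a + n..m * b + n} = q ` ((\<lambda>t. m * t + n) ` {a..b})"
    using \<open>m > 0\<close> within(2) by (simp add: image_affinity_atLeastAtMost)
  also have "\<dots> = p ` {a..b}" using within by (simp add: image_image)
  finally show ?case
    using increment.within[of i "m * a + n" "m * b + n" q] within \<open>m > 0\<close> by simp
next
  case (concat a b g c g')
  have "a \<le> b" "b \<le> c" using concat.hyps by (auto dest: increment_le)
  with concat show ?case by (intro increment.concat[of q _ "m * b + n"]) auto
qed

definition monodromy :: "(real \<Rightarrow> 'x) \<Rightarrow> 'a" where
  "monodromy p = (THE g. increment p 0 1 g)"

lemma monodromy_eqI: "path p \<Longrightarrow> increment p 0 1 g \<Longrightarrow> monodromy p = g"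
  unfolding monodromy_def by (blast intro: increment_unique)

lemma increment_monodromy: "path p \<Longrightarrow> path_image p \<subseteq> X \<Longrightarrow> increment p 0 1 (monodromy p)"
  using increment_exists[of p 0 1] monodromy_eqI by fastforce

lemma monodromy_closed: "path p \<Longrightarrow> path_image p \<subseteq> X \<Longrightarrow> monodromy p \<in> carrier G"
  using increment_monodromy increment_closed by blast

lemma monodromy_const:
  assumes "x \<in> X" "\<And>t. t \<in> {0..1} \<Longrightarrow> p t = x"
  shows "monodromy p = \<one>"
proof -
  obtain i where i: "i \<in> I" "x \<in> U i" using cover[OF assms(1)] by blast
  have "path p" unfolding path_def by (rule continuous_on_eq[of _ "\<lambda>_. x"]) (simp_all add: assms(2))
  moreover have "increment p 0 1 (inv h i (p 0) \<otimes> h i (p 1))"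
    using i assms by (intro increment.within) auto
  ultimately show ?thesis
    using monodromy_eqI label_closed[OF i] assms(2) by fastforce
qed

lemma monodromy_join:
  assumes "path p" "path_image p \<subseteq> X" "path q" "path_image q \<subseteq> X" "pathfinish p = pathstart q"
  shows "monodromy (p +++ q) = monodromy p \<otimes> monodromy q"
proof -
  have "increment (p +++ q) (1/2 * 0 + 0) (1/2 * 1 + 0) (monodromy p)"
    by (rule increment_affine[OF increment_monodromy[OF assms(1,2)]]) (auto simp: joinpaths_def)
  moreover have "increment (p +++ q) (1/2 * 0 + 1/2) (1/2 * 1 + 1/2) (monodromy q)"
    by (rule increment_affine[OF increment_monodromy[OF assms(3,4)]])
      (use assms(5) in \<open>auto simp: joinpaths_def pathstart_def pathfinish_def field_simps\<close>)
  ultimately have "increment (p +++ q) 0 1 (monodromy p \<otimes> monodromy q)"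
    using increment.concat[of "p +++ q" 0 "1/2" _ 1] by simp
  with assms show ?thesis by (intro monodromy_eqI) auto
qed

text \<open>Fix a row \<open>s0\<close> of a homotopy.  Over a short stretch of the path the rows near \<open>s0\<close> stay in
  one set of the cover, so the rectangle between the two rows commutes; rectangles side by side
  compose.\<close>

lemma monodromy_rows_locally_constant:
  fixes H :: "real \<times> real \<Rightarrow> 'x"
  assumes H: "continuous_on ({0..1} \<times> {0..1}) H" "H \<in> {0..1} \<times> {0..1} \<rightarrow> X"
    and ends: "\<And>s. s \<in> {0..1} \<Longrightarrow> H (s, 0) = x" "\<And>s. s \<in> {0..1} \<Longrightarrow> H (s, 1) = y"
    and s0: "s0 \<in> {0..1}"
  shows "\<exists>d>0. \<forall>s\<in>{0..1}. \<bar>s - s0\<bar> < d \<longrightarrow>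
    monodromy (\<lambda>t. H (s, t)) = monodromy (\<lambda>t. H (s0, t))"
proof -
  define row where "row s = (\<lambda>t. H (s, t))" for s
  define col where "col s t = (\<lambda>r. H (s0 + r * (s - s0), t))" for s t
  have between: "s0 + r * (s - s0) \<in> {0..1}" "\<bar>r * (s - s0)\<bar> \<le> \<bar>s - s0\<bar>"
    if "s \<in> {0..1}" "r \<in> {0..1}" for s r
  proof -
    have "s0 + r * (s - s0) = (1 - r) * s0 + r * s" by (simp add: algebra_simps)
    moreover have "(1 - r) * s0 + r * s \<le> (1 - r) * 1 + r * 1"
      using that s0 by (intro add_mono mult_left_mono) auto
    ultimately show "s0 + r * (s - s0) \<in> {0..1}"
      using that s0 by auto
    show "\<bar>r * (s - s0)\<bar> \<le> \<bar>s - s0\<bar>"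
      using that by (simp add: abs_mult mult_left_le_one_le)
  qed
  have row: "path (row s)" "path_image (row s) \<subseteq> X" if "s \<in> {0..1}" for s
    using that H(2) unfolding row_def path_def path_image_def
    by (auto intro!: continuous_on_compose2[OF H(1)] continuous_intros)
  have col: "path (col s t)" "path_image (col s t) \<subseteq> X" if "s \<in> {0..1}" "t \<in> {0..1}" for s t
    using that H(2) between unfolding col_def path_def path_image_def
    by (auto intro!: continuous_on_compose2[OF H(1)] continuous_intros)
  define commutes where "commutes a b s \<longleftrightarrow> (\<forall>g g' e e'. increment (row s) a b g \<longrightarrow>
      increment (row s0) a b g' \<longrightarrow> increment (col s a) 0 1 e \<longrightarrow> increment (col s b) 0 1 e' \<longrightarrow>
      e \<otimes> g = g' \<otimes> e')" for a b s
  have "0 \<le> a \<longrightarrow> b \<le> 1 \<longrightarrow> a \<le> b \<longrightarrow> (\<exists>d>0. \<forall>s\<in>{0..1}. \<bar>s - s0\<bar> < d \<longrightarrow> commutes a b s)"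
    if ends01: "0 \<le> a" "a \<le> b" "b \<le> 1" for a b
  proof (induction rule: Bolzano[OF ends01(2), consumes 0])
    case (1 a b c)
    show ?case
    proof (intro impI)
      assume ac: "0 \<le> a" "c \<le> 1" "a \<le> c"
      obtain d d' where d: "d > 0" "\<And>s. s\<in>{0..1} \<Longrightarrow> \<bar>s - s0\<bar> < d \<Longrightarrow> commutes a b s"
        and d': "d' > 0" "\<And>s. s\<in>{0..1} \<Longrightarrow> \<bar>s - s0\<bar> < d' \<Longrightarrow> commutes b c s"
        using 1(1)[rule_format] 1(2)[rule_format] 1(3,4) ac by auto
      show "\<exists>d>0. \<forall>s\<in>{0..1}. \<bar>s - s0\<bar> < d \<longrightarrow> commutes a c s"
      proof (intro exI[of _ "min d d'"] conjI ballI impI)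
        fix s :: real assume s: "s \<in> {0..1}" "\<bar>s - s0\<bar> < min d d'"
        show "commutes a c s"
          unfolding commutes_def
        proof (intro allI impI)
          fix g g' e e'
          assume gs: "increment (row s) a c g" "increment (row s0) a c g'"
            and e: "increment (col s a) 0 1 e" and e': "increment (col s c) 0 1 e'"
          obtain g1 g2 where g: "increment (row s) a b g1" "increment (row s) b c g2" "g = g1 \<otimes> g2"
            using increment_split[OF gs(1) 1(3,4)] by blast
          obtain g1' g2' where g': "increment (row s0) a b g1'" "increment (row s0) b c g2'"
            "g' = g1' \<otimes> g2'"
            using increment_split[OF gs(2) 1(3,4)] by blast
          obtain f where f: "increment (col s b) 0 1 f"
            using increment_exists[OF col[OF s(1)], of b 0 1] 1(3,4) ac by auto
          have com: "e \<otimes> g1 = g1' \<otimes> f" "f \<otimes> g2 = g2' \<otimes> e'"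
            using d(2)[OF s(1)] d'(2)[OF s(1)] s(2) g g' e e' f unfolding commutes_def by auto
          note closed = g(1,2)[THEN increment_closed] g'(1,2)[THEN increment_closed]
            e[THEN increment_closed] e'[THEN increment_closed] f[THEN increment_closed]
          have "e \<otimes> (g1 \<otimes> g2) = g1' \<otimes> (f \<otimes> g2)"
            using com(1) closed by (simp add: m_assoc[symmetric])
          also have "\<dots> = g1' \<otimes> g2' \<otimes> e'"
            using com(2) closed by (simp add: m_assoc)
          finally show "e \<otimes> g = g' \<otimes> e'" using g(3) g'(3) by simp
        qed
      qed (use d d' in auto)
    qed
  next
    case (2 t)
    then have t: "t \<in> {0..1}" using ends01 by simp
    then have "H (s0, t) \<in> X" using H(2) s0 by auto
    then obtain i where i: "i \<in> I" "H (s0, t) \<in> U i" using cover by blast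
    have "\<forall>\<^sub>F z in at (s0, t) within {0..1} \<times> {0..1}. H z \<in> U i"
      using H(1) s0 t i open_U[OF i(1)] unfolding continuous_on_def
      by (intro topological_tendstoD) auto
    then obtain d where d: "d > 0"
      "\<forall>z\<in>{0..1} \<times> {0..1}. z \<noteq> (s0, t) \<and> dist z (s0, t) < d \<longrightarrow> H z \<in> U i"
      unfolding eventually_at by blast
    have near: "H (s, u) \<in> U i" if "s \<in> {0..1}" "u \<in> {0..1}" "\<bar>s - s0\<bar> < d/2" "\<bar>u - t\<bar> < d/2" for s u
    proof -
      have "dist (s, u) (s0, t) \<le> \<bar>s - s0\<bar> + \<bar>u - t\<bar>"
        unfolding dist_Pair_Pair dist_real_def using sqrt_sum_squares_le_sum_abs by fastforce
      with that d i show ?thesis by (cases "(s, u) = (s0, t)") auto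
    qed
    show ?case
    proof (rule exI[of _ "d/2"], intro conjI allI impI)
      show "d/2 > 0" using d(1) by simp
      fix a b assume ab: "a \<le> t \<and> t \<le> b \<and> b - a < d/2" "0 \<le> a" "b \<le> 1" "a \<le> b"
      show "\<exists>d>0. \<forall>s\<in>{0..1}. \<bar>s - s0\<bar> < d \<longrightarrow> commutes a b s"
      proof (intro exI[of _ "d/2"] conjI ballI impI)
        show "d/2 > 0" using d(1) by simp
        fix s :: real assume s: "s \<in> {0..1}" "\<bar>s - s0\<bar> < d/2"
        have inU: "row s ` {a..b} \<subseteq> U i" "row s0 ` {a..b} \<subseteq> U i"
          "col s a ` {0..1} \<subseteq> U i" "col s b ` {0..1} \<subseteq> U i"
        proof -
          have ab01: "a \<in> {0..1}" "b \<in> {0..1}" "\<bar>a - t\<bar> < d/2" "\<bar>b - t\<bar> < d/2" using ab by auto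
          have "H (s0 + r * (s - s0), u) \<in> U i"
            if "r \<in> {0..1}" "u \<in> {0..1}" "\<bar>u - t\<bar> < d/2" for r u
          proof (rule near[OF between(1)[OF s(1) that(1)] that(2) _ that(3)])
            show "\<bar>s0 + r * (s - s0) - s0\<bar> < d/2"
              using between(2)[OF s(1) that(1)] s(2) by linarith
          qed
          with ab01 show "col s a ` {0..1} \<subseteq> U i" "col s b ` {0..1} \<subseteq> U i"
            unfolding col_def by blast+
          have "H (r, u) \<in> U i" if "r \<in> {s, s0}" "u \<in> {a..b}" for r u
          proof (rule near)
            show "\<bar>u - t\<bar> < d/2" using that ab by (simp add: abs_if)
          qed (use that ab s s0 d(1) in auto)
          then show "row s ` {a..b} \<subseteq> U i" "row s0 ` {a..b} \<subseteq> U i"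
            unfolding row_def by blast+
        qed
        have corners: "row s a \<in> U i" "row s b \<in> U i" "row s0 a \<in> U i" "row s0 b \<in> U i"
          using inU ab by auto
        have ends: "col s a 0 = row s0 a" "col s a 1 = row s a" "col s b 0 = row s0 b" "col s b 1 = row s b"
          by (simp_all add: col_def row_def)
        show "commutes a b s"
          unfolding commutes_def
        proof (intro allI impI)
          fix g g' e e'
          assume inc: "increment (row s) a b g" "increment (row s0) a b g'"
            "increment (col s a) 0 1 e" "increment (col s b) 0 1 e'"
          have eqs: "g = inv h i (row s a) \<otimes> h i (row s b)" "g' = inv h i (row s0 a) \<otimes> h i (row s0 b)"
            "e = inv h i (row s0 a) \<otimes> h i (row s a)" "e' = inv h i (row s0 b) \<otimes> h i (row s b)"
            using increment_within_eq[OF inc(1) row(1)[OF s(1)] _ _ i(1) inU(1)]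
              increment_within_eq[OF inc(2) row(1)[OF s0] _ _ i(1) inU(2)]
              increment_within_eq[OF inc(3) col(1)[OF s(1)] _ _ i(1) inU(3)]
              increment_within_eq[OF inc(4) col(1)[OF s(1)] _ _ i(1) inU(4)] ab
            by (auto simp: ends)
          show "e \<otimes> g = g' \<otimes> e'"
            unfolding eqs using corners label_closed[OF i(1)] by (simp add: telescope)
        qed
      qed
    qed
  qed
  from this[of 0 1] obtain d where d: "d > 0"
    "\<And>s. s \<in> {0..1} \<Longrightarrow> \<bar>s - s0\<bar> < d \<Longrightarrow> commutes 0 1 s" by auto
  have xy: "x \<in> X" "y \<in> X" using H(2) ends[of 0] by fastforce+
  have "monodromy (row s) = monodromy (row s0)" if s: "s \<in> {0..1}" "\<bar>s - s0\<bar> < d" for s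
  proof -
    have "H (s0 + r * (s - s0), 0) = x \<and> H (s0 + r * (s - s0), 1) = y" if "r \<in> {0..1}" for r
      using ends between(1)[OF s(1) that] by blast
    then have one: "monodromy (col s 0) = \<one>" "monodromy (col s 1) = \<one>"
      using monodromy_const[OF xy(1), of "col s 0"] monodromy_const[OF xy(2), of "col s 1"]
      unfolding col_def by blast+
    have "monodromy (col s 0) \<otimes> monodromy (row s) = monodromy (row s0) \<otimes> monodromy (col s 1)"
      using d(2)[OF s] s(1) s0 row col increment_monodromy unfolding commutes_def by auto
    then show ?thesis
      using one row[OF s(1)] row[OF s0] by (simp add: monodromy_closed)
  qed
  with d(1) show ?thesis unfolding row_def by blast
qed

lemma monodromy_homotopic:
  assumes "homotopic_paths X p q"
  shows "monodromy p = monodromy q"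
proof -
  obtain H where H: "continuous_on ({0..1} \<times> {0..1}) H" "H \<in> ({0..1} \<times> {0..1}) \<rightarrow> X"
    "\<forall>t \<in> {0..1}. H (0,t) = p t" "\<forall>t \<in> {0..1}. H (1,t) = q t"
    "\<forall>s \<in> {0..1::real}. pathstart (H \<circ> Pair s) = pathstart p \<and> pathfinish (H \<circ> Pair s) = pathfinish p"
    using assms unfolding homotopic_paths by blast
  have "0 \<le> a \<longrightarrow> b \<le> 1 \<longrightarrow> a \<le> b \<longrightarrow> monodromy (\<lambda>t. H (a, t)) = monodromy (\<lambda>t. H (b, t))"
    if ends01: "0 \<le> a" "a \<le> b" "b \<le> 1" for a b
  proof (induction rule: Bolzano[OF ends01(2), consumes 0])
    case (1 a b c)
    then show ?case by auto
  next
    case (2 s)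
    then have s: "s \<in> {0..1}" using ends01 by simp
    have ends: "\<And>s. s \<in> {0..1} \<Longrightarrow> H (s, 0) = pathstart p" "\<And>s. s \<in> {0..1} \<Longrightarrow> H (s, 1) = pathfinish p"
      using H(5) by (auto simp: pathstart_def pathfinish_def)
    obtain d where d: "d > 0" "\<And>s'. s'\<in>{0..1} \<Longrightarrow> \<bar>s' - s\<bar> < d \<Longrightarrow>
        monodromy (\<lambda>t. H (s', t)) = monodromy (\<lambda>t. H (s, t))"
      using monodromy_rows_locally_constant[OF H(1,2) ends s] by blast
    show ?case
    proof (intro exI[of _ d] conjI allI impI d(1))
      fix a b assume "a \<le> s \<and> s \<le> b \<and> b - a < d" "0 \<le> a" "b \<le> 1" "a \<le> b"
      then show "monodromy (\<lambda>t. H (a, t)) = monodromy (\<lambda>t. H (b, t))"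
        using d(2)[of a] d(2)[of b] by auto
    qed
  qed
  then have rows: "monodromy (\<lambda>t. H (0, t)) = monodromy (\<lambda>t. H (1, t))" by simp
  have cong: "monodromy g = monodromy f"
    if "path f" "path_image f \<subseteq> X" "\<And>t. t \<in> {0..1} \<Longrightarrow> g t = f t" for f g
  proof (rule monodromy_eqI)
    show "path g" using that(1,3) unfolding path_def by (metis continuous_on_cong)
    have "increment g (1 * 0 + 0) (1 * 1 + 0) (monodromy f)"
      by (rule increment_affine[OF increment_monodromy[OF that(1,2)]]) (use that(3) in auto)
    then show "increment g 0 1 (monodromy f)" by simp
  qed
  have "monodromy (\<lambda>t. H (0, t)) = monodromy p" "monodromy (\<lambda>t. H (1, t)) = monodromy q"
    by (rule cong; use H(3,4) homotopic_paths_imp_path[OF assms] homotopic_paths_imp_subset[OF assms]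
      in blast)+
  with rows show ?thesis by simp
qed

end

section \<open>Loops under continuous maps and in unions\<close>

lemma loops_compose:
  assumes "p \<in> loops X b" "continuous_on X f" "f \<in> X \<rightarrow> Y"
  shows "f \<circ> p \<in> loops Y (f b)"
  using assms unfolding loops_def
  by (auto simp: path_image_compose pathstart_compose pathfinish_compose
      intro!: path_continuous_image elim: continuous_on_subset)

text \<open>The preimage of a subgroup under the homomorphism that a continuous map induces, described by
  representatives; by \<open>in_vimage_subgroup\<close> membership depends only on the class.\<close>

definition vimage_subgroup ::
    "'a::topological_space set \<Rightarrow> 'a \<Rightarrow> ('a \<Rightarrow> 'b::topological_space) \<Rightarrow> 'b set \<Rightarrow> (real \<Rightarrow> 'b) set set
      \<Rightarrow> (real \<Rightarrow> 'a) set set"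
  where "vimage_subgroup X b f Y H = {loop_class X b p | p. p \<in> loops X b \<and> loop_class Y (f b) (f \<circ> p) \<in> H}"

context
  fixes X :: "'a::topological_space set" and Y :: "'b::topological_space set"
    and f :: "'a \<Rightarrow> 'b" and b and H
  assumes f: "continuous_on X f" "f \<in> X \<rightarrow> Y" and b: "b \<in> X"
    and H: "subgroup H (fundamental_group Y (f b))"
begin

lemma in_vimage_subgroup:
  assumes "p \<in> loops X b"
  shows "loop_class X b p \<in> vimage_subgroup X b f Y H \<longleftrightarrow> loop_class Y (f b) (f \<circ> p) \<in> H"
proof
  assume "loop_class X b p \<in> vimage_subgroup X b f Y H"
  then obtain q where q: "q \<in> loops X b" "loop_class X b p = loop_class X b q" "loop_class Y (f b) (f \<circ> q) \<in> H"
    unfolding vimage_subgroup_def by auto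
  have "homotopic_paths X p q" using loop_class_eqD[OF q(2,1)] .
  then have "homotopic_paths Y (f \<circ> p) (f \<circ> q)"
    using f by (rule homotopic_paths_continuous_image)
  then have "loop_class Y (f b) (f \<circ> p) = loop_class Y (f b) (f \<circ> q)"
    by (rule loop_class_eqI[OF loops_compose[OF assms f]])
  with q(3) show "loop_class Y (f b) (f \<circ> p) \<in> H" by simp
qed (use assms in \<open>auto simp: vimage_subgroup_def\<close>)

lemma subgroup_vimage_subgroup: "subgroup (vimage_subgroup X b f Y H) (fundamental_group X b)"
proof -
  let ?P = "fundamental_group X b" and ?Q = "fundamental_group Y (f b)"
  interpret P: group ?P by (rule group_fundamental_group[OF b])
  interpret Q: group ?Q by (rule group_fundamental_group) (use f b in auto)
  note loops = loops_compose[OF _ f, of _ b]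
  show ?thesis
  proof (rule P.subgroupI)
    show "vimage_subgroup X b f Y H \<subseteq> carrier ?P"
      by (auto simp: vimage_subgroup_def loop_class_in_carrier)
    have "f \<circ> (\<lambda>_. b) = (\<lambda>_. f b)" by auto
    then have "loop_class Y (f b) (f \<circ> (\<lambda>_. b)) \<in> H"
      using subgroup.one_closed[OF H] by (simp add: one_fundamental_group)
    then show "vimage_subgroup X b f Y H \<noteq> {}"
      using loops_const[OF b] unfolding vimage_subgroup_def by blast
  next
    fix \<alpha> assume "\<alpha> \<in> vimage_subgroup X b f Y H"
    then obtain p where p: "p \<in> loops X b" "loop_class Y (f b) (f \<circ> p) \<in> H" and \<alpha>: "\<alpha> = loop_class X b p"
      unfolding vimage_subgroup_def by blast
    have "loop_class Y (f b) (f \<circ> reversepath p) = inv\<^bsub>?Q\<^esub> loop_class Y (f b) (f \<circ> p)"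
      using loop_class_reverse[OF loops[OF p(1)]] by (simp add: reversepath_o o_assoc)
    then have "loop_class X b (reversepath p) \<in> vimage_subgroup X b f Y H"
      using p subgroup.m_inv_closed[OF H] loops_reverse[OF p(1)] unfolding vimage_subgroup_def by auto
    then show "inv\<^bsub>?P\<^esub> \<alpha> \<in> vimage_subgroup X b f Y H"
      by (simp add: \<alpha> loop_class_reverse[OF p(1)])
    fix \<beta> assume "\<beta> \<in> vimage_subgroup X b f Y H"
    then obtain q where q: "q \<in> loops X b" "loop_class Y (f b) (f \<circ> q) \<in> H" and \<beta>: "\<beta> = loop_class X b q"
      unfolding vimage_subgroup_def by blast
    have "loop_class Y (f b) (f \<circ> (p +++ q)) = loop_class Y (f b) (f \<circ> p) \<otimes>\<^bsub>?Q\<^esub> loop_class Y (f b) (f \<circ> q)"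
      using loops[OF p(1)] loops[OF q(1)] by (simp add: fundamental_group_mult path_compose_join)
    then have "loop_class X b (p +++ q) \<in> vimage_subgroup X b f Y H"
      using p q subgroup.m_closed[OF H] loops_join[OF p(1) q(1)] unfolding vimage_subgroup_def by auto
    then show "\<alpha> \<otimes>\<^bsub>?P\<^esub> \<beta> \<in> vimage_subgroup X b f Y H"
      by (simp add: \<alpha> \<beta> fundamental_group_mult p q)
  qed
qed

text \<open>Generation by \<open>A\<close> is expressed as the absence of a proper subgroup that contains \<open>A\<close>; in this form it
  applies to the preimage of \<open>H\<close>.\<close>

lemma loop_class_image_in_subgroup:
  assumes gen: "\<And>K. subgroup K (fundamental_group X b) \<Longrightarrow> (\<And>p. p \<in> A \<Longrightarrow> loop_class X b p \<in> K) \<Longrightarrow>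
      K = carrier (fundamental_group X b)"
    and A: "A \<subseteq> loops X b" "\<And>p. p \<in> A \<Longrightarrow> loop_class Y (f b) (f \<circ> p) \<in> H"
    and p: "p \<in> loops X b"
  shows "loop_class Y (f b) (f \<circ> p) \<in> H"
proof -
  have "vimage_subgroup X b f Y H = carrier (fundamental_group X b)"
    using A by (intro gen subgroup_vimage_subgroup) (auto simp: in_vimage_subgroup subset_iff)
  then show ?thesis
    using loop_class_in_carrier[OF p] in_vimage_subgroup[OF p] by simp
qed

end

text \<open>The generation half of the Seifert--van Kampen theorem: loops in two path-connected open sets
  with path-connected intersection generate the fundamental group of the union.  The tail to a point
  of the intersection is chosen inside the intersection, so that it serves both sets.\<close>

lemma loops_generate_union:
  fixes U V :: "'a::topological_space set"
  assumes "open U" "open V" and b: "b \<in> U \<inter> V"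
    and conn: "path_connected U" "path_connected V" "path_connected (U \<inter> V)"
    and H: "subgroup H (fundamental_group (U \<union> V) b)"
    and HU: "\<And>p. p \<in> loops U b \<Longrightarrow> loop_class (U \<union> V) b p \<in> H"
    and HV: "\<And>p. p \<in> loops V b \<Longrightarrow> loop_class (U \<union> V) b p \<in> H"
  shows "H = carrier (fundamental_group (U \<union> V) b)"
proof -
  define tail where "tail x g \<longleftrightarrow> path g \<and> pathstart g = b \<and> pathfinish g = x \<and>
      (x \<in> U \<longrightarrow> path_image g \<subseteq> U) \<and> (x \<in> V \<longrightarrow> path_image g \<subseteq> V)" for x g
  have "\<exists>g. tail x g" if x: "x \<in> U \<union> V" for x
  proof -
    consider "x \<in> U \<inter> V" | "x \<in> U" "x \<notin> V" | "x \<in> V" "x \<notin> U" using x by blast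
    then obtain g where "path g" "pathstart g = b" "pathfinish g = x"
      "(x \<in> U \<longrightarrow> path_image g \<subseteq> U) \<and> (x \<in> V \<longrightarrow> path_image g \<subseteq> V)"
      using conn b unfolding path_connected_def by cases (metis Int_iff Int_subset_iff)+
    then show ?thesis unfolding tail_def by blast
  qed
  then obtain \<gamma> where "\<And>x. x \<in> U \<union> V \<Longrightarrow> tail x (\<gamma> x)" by metis
  then have \<gamma>: "path (\<gamma> x)" "pathstart (\<gamma> x) = b" "pathfinish (\<gamma> x) = x"
    "x \<in> U \<Longrightarrow> path_image (\<gamma> x) \<subseteq> U" "x \<in> V \<Longrightarrow> path_image (\<gamma> x) \<subseteq> V" if "x \<in> U \<union> V" for x
    using that unfolding tail_def by auto
  have ends: "pathstart p \<in> W" "pathfinish p \<in> W" if "path_image p \<subseteq> W" for p W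
    using that pathstart_in_path_image[of p] pathfinish_in_path_image[of p] by auto
  have inU: "loop_class (U \<union> V) b (\<gamma> (pathstart p) +++ (p +++ reversepath (\<gamma> (pathfinish p)))) \<in> H"
    if "path p" "path_image p \<subseteq> U" for p
    using that ends[OF that(2)] by (intro HU loops_conjugate) (auto simp: \<gamma>)
  have inV: "loop_class (U \<union> V) b (\<gamma> (pathstart p) +++ (p +++ reversepath (\<gamma> (pathfinish p)))) \<in> H"
    if "path p" "path_image p \<subseteq> V" for p
    using that ends[OF that(2)] by (intro HV loops_conjugate) (auto simp: \<gamma>)
  show ?thesis
  proof (rule subgroup_eq_fundamental_group[where \<gamma> = \<gamma>])
    show "b \<in> U \<union> V" using b by auto
    show "loop_class (U \<union> V) b (\<gamma> b) \<in> H"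
      using b \<gamma>[of b] by (intro HU) (auto simp: loops_def)
    fix x assume x: "x \<in> U \<union> V"
    show "path (\<gamma> x) \<and> path_image (\<gamma> x) \<subseteq> U \<union> V \<and> pathstart (\<gamma> x) = b \<and> pathfinish (\<gamma> x) = x"
      using \<gamma>[OF x] x by blast
    show "\<exists>N. open N \<and> x \<in> N \<and> (\<forall>p. path p \<and> path_image p \<subseteq> N \<inter> (U \<union> V) \<longrightarrow>
      loop_class (U \<union> V) b (\<gamma> (pathstart p) +++ p +++ reversepath (\<gamma> (pathfinish p))) \<in> H)"
    proof (cases "x \<in> U")
      case True
      then show ?thesis using inU \<open>open U\<close> by (intro exI[of _ U]) auto
    next
      case False
      then show ?thesis using x inV \<open>open V\<close> by (intro exI[of _ V]) auto
    qed
  qed (fact H)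
qed

section \<open>Loops in open subsets of complex spaces\<close>

text \<open>A polynomial approximation of the path sweeps out a null set, even after division by
  \<open>t * (1 - t)\<close>; hence a small generic multiple of \<open>t * (1 - t)\<close>, added to the first coordinate,
  makes that coordinate nonzero and keeps the ends.\<close>

lemma homotopic_path_avoiding_zero:
  fixes S :: "(complex \<times> 'b::euclidean_space) set"
  assumes "open S" "path p" "path_image p \<subseteq> S" "fst (pathstart p) \<noteq> 0" "fst (pathfinish p) \<noteq> 0"
  obtains q where "homotopic_paths S p q" "path_image q \<subseteq> {z. fst z \<noteq> 0}"
proof -
  obtain e where e: "e > 0" "(\<Union>z\<in>path_image p. ball z e) \<subseteq> S"
    using compact_subset_open_imp_ball_epsilon_subset[OF compact_path_image[OF assms(2)] assms(1,3)] by blast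
  obtain r where r: "polynomial_function r" "pathstart r = pathstart p" "pathfinish r = pathfinish p"
    "\<And>t. t \<in> {0..1} \<Longrightarrow> norm (r t - p t) < e / 2"
    using path_approx_polynomial_function[OF assms(2), of "e/2"] e(1) by auto
  define N where "N = (\<lambda>t::real. - inverse (t * (1 - t)) *\<^sub>R fst (r t)) ` {0<..<1}"
  have "polynomial_function (\<lambda>t. fst (r t))"
    using polynomial_function_compose[OF r(1) polynomial_function_bounded_linear[OF bounded_linear_fst]]
    by (simp add: o_def)
  then have "(\<lambda>t. fst (r t)) differentiable at t" for t
    by (rule differentiable_at_polynomial_function)
  then have "(\<lambda>t. - inverse (t * (1 - t)) *\<^sub>R fst (r t)) differentiable_on {0<..<1}"
    by (intro differentiable_at_imp_differentiable_on differentiable_scaleR) (auto intro!: derivative_intros)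
  then have "negligible N"
    unfolding N_def by (intro negligible_differentiable_image_lowdim) auto
  moreover have "\<not> negligible (ball (0::complex) (e/2))"
    using e(1) by (intro open_not_negligible) auto
  ultimately obtain c where c: "c \<notin> N" "norm c < e/2"
    using negligible_subset[of N "ball 0 (e/2)"] by (auto simp: subset_iff)
  define q where "q t = r t + (t * (1 - t)) *\<^sub>R (c, 0)" for t :: real
  have q_ends: "pathstart q = pathstart p" "pathfinish q = pathfinish p"
    using r(2,3) by (simp_all add: q_def pathstart_def pathfinish_def zero_prod_def[symmetric])
  have near: "norm (q t - p t) < e" if "t \<in> {0..1}" for t
  proof -
    have "0 \<le> t * (1 - t)" "t * (1 - t) \<le> 1" using that by (auto intro: mult_le_one)
    then have "norm ((t * (1 - t)) *\<^sub>R (c, 0::'b)) \<le> norm c"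
      by (simp add: norm_Pair mult_left_le_one_le abs_mult)
    then have "norm (q t - r t) < e/2" using c(2) by (simp add: q_def)
    with r(4)[OF that] show ?thesis using norm_triangle_lt[of "q t - r t" "r t - p t" e] by simp
  qed
  show thesis
  proof
    have "path r" using r(1) by (rule path_polynomial_function)
    then have "path q" unfolding q_def path_def by (intro continuous_intros)
    then show "homotopic_paths S p q"
    proof (rule homotopic_paths_linear[OF assms(2)])
      fix t :: real assume t: "t \<in> {0..1}"
      have "closed_segment (p t) (q t) \<subseteq> ball (p t) e"
        using near[OF t] e(1) by (intro closed_segment_subset) (auto simp: dist_norm norm_minus_commute)
      also have "\<dots> \<subseteq> S" using e(2) t unfolding path_image_def by blast
      finally show "closed_segment (p t) (q t) \<subseteq> S" .
    qed (use q_ends in simp_all)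
    have "fst (q t) \<noteq> 0" if "t \<in> {0..1}" for t
    proof (cases "t \<in> {0, 1}")
      case True
      then show ?thesis using assms(4,5) q_ends by (auto simp: pathstart_def pathfinish_def)
    next
      case False
      then have t: "0 < t" "t < 1" using that by auto
      show ?thesis
      proof
        assume "fst (q t) = 0"
        then have "c = - inverse (t * (1 - t)) *\<^sub>R fst (r t)"
          using t by (simp add: q_def eq_neg_iff_add_eq_0 field_simps scaleR_conv_of_real)
        with t have "c \<in> N" unfolding N_def by auto
        with c(1) show False ..
      qed
    qed
    then show "path_image q \<subseteq> {z. fst z \<noteq> 0}" by (auto simp: path_image_def)
  qed
qed

text \<open>In the twice punctured plane, a loop in a half-plane around one puncture is determined by its
  winding number: a homotopy in the plane punctured once is pushed back into the half-plane
  radially.\<close>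

lemma loop_class_half_plane:
  assumes H: "subgroup H (fundamental_group (- {0, 1}) (1/2))"
    and circle: "loop_class (- {0, 1}) (1/2) (circlepath 0 (1/2)) \<in> H"
    and p: "p \<in> loops ({z. Re z < 2/3} - {0}) (1/2)"
  shows "loop_class (- {0, 1::complex}) (1/2) p \<in> H"
proof -
  let ?P = "fundamental_group (- {0, 1::complex}) (1/2)"
  let ?a = "circlepath 0 (1/2)"
  let ?K = "{z. Re z \<le> 2/3} - {0::complex}"
  have K: "?K \<subseteq> - {0, 1}" by auto
  have loopsK: "q \<in> loops (- {0, 1}) (1/2)" if "q \<in> loops ?K (1/2)" for q
    using that K by (auto simp: loops_def)
  interpret group ?P by (rule group_fundamental_group) auto
  have a: "?a \<in> loops ?K (1/2)"
  proof -
    have "path_image ?a \<subseteq> ?K"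
    proof
      fix z assume "z \<in> path_image ?a"
      then have z: "norm z = 1/2" by (simp add: sphere_def)
      then have "z \<noteq> 0" by auto
      with z show "z \<in> ?K" using complex_Re_le_cmod[of z] by simp
    qed
    then show ?thesis by (simp add: loops_def)
  qed
  have wa: "winding_number ?a 0 = 1" by (rule winding_number_circlepath_centre) simp
  let ?cls = "loop_class (- {0, 1}) (1/2)"
  have join: "d +++ c \<in> loops ?K (1/2)" "winding_number (d +++ c) 0 = winding_number d 0 + winding_number c 0"
      "?cls (d +++ c) \<in> H"
    if c: "c \<in> loops ?K (1/2)" "?cls c \<in> H" and d: "d \<in> loops ?K (1/2)" "?cls d \<in> H" for c d
  proof -
    show "d +++ c \<in> loops ?K (1/2)" by (rule loops_join[OF d(1) c(1)])
    show "winding_number (d +++ c) 0 = winding_number d 0 + winding_number c 0"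
    proof (rule winding_number_join)
      show "pathfinish d = pathstart c" using c(1) d(1) by (simp only: loops_def mem_Collect_eq)
    qed (use c(1) d(1) in \<open>auto simp: loops_def\<close>)
    show "?cls (d +++ c) \<in> H"
      using subgroup.m_closed[OF H d(2) c(2)] by (simp only: fundamental_group_mult[OF loopsK[OF d(1)] loopsK[OF c(1)]])
  qed
  have rev: "?cls (reversepath ?a) \<in> H" "winding_number (reversepath ?a) 0 = - 1"
    using subgroup.m_inv_closed[OF H circle] a wa
    by (auto simp only: loop_class_reverse[OF loopsK[OF a]]) (auto simp: loops_def winding_number_reversepath)
  have power: "\<exists>c \<in> loops ?K (1/2). winding_number c 0 = of_int n \<and> ?cls c \<in> H" for n
  proof (induction n rule: int_induct[where k = 0])
    case base
    have "(\<lambda>_. 1/2) \<in> loops ?K (1/2)" by (rule loops_const) simp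
    then show ?case
      using subgroup.one_closed[OF H]
      by (intro bexI[of _ "\<lambda>_. 1/2"]) (auto simp: one_fundamental_group winding_number_zero_const)
  next
    case (step1 i)
    then obtain c where c: "c \<in> loops ?K (1/2)" "winding_number c 0 = of_int i" "?cls c \<in> H" by blast
    show ?case using join[OF c(1,3) a circle] by (intro bexI[of _ "?a +++ c"]) (simp_all add: c(2) wa)
  next
    case (step2 i)
    then obtain c where c: "c \<in> loops ?K (1/2)" "winding_number c 0 = of_int i" "?cls c \<in> H" by blast
    show ?case using join[OF c(1,3) loops_reverse[OF a] rev(1)]
      by (intro bexI[of _ "reversepath ?a +++ c"]) (simp_all add: c(2) rev(2))
  qed
  have pp: "path p" "path_image p \<subseteq> {z. Re z < 2/3} - {0}" "pathstart p = 1/2" "pathfinish p = 1/2"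
    using p by (auto simp: loops_def)
  then have closed: "pathfinish p = pathstart p" by metis
  have "winding_number p 0 \<in> \<int>" by (rule integer_winding_number) (use pp closed in auto)
  then obtain n where "winding_number p 0 = of_int n" by (auto elim: Ints_cases)
  then obtain c where c: "c \<in> loops ?K (1/2)" "winding_number p 0 = winding_number c 0"
    "loop_class (- {0, 1}) (1/2) c \<in> H" using power by metis
  then have hom: "homotopic_paths (- {0}) p c"
  proof (subst winding_number_homotopic_paths_eq[symmetric])
    show "pathstart c = pathstart p" "pathfinish c = pathfinish p"
      using c(1) pp(3,4) by (simp_all only: loops_def mem_Collect_eq)
  qed (use pp c(1) in \<open>auto simp: loops_def\<close>)
  \<comment> \<open>the radial retraction onto the part with real part at most \<open>2/3\<close>, which misses the puncture \<open>1\<close>\<close>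
  define r where "r z = (2/3 / max (2/3) (Re z)) *\<^sub>R z" for z :: complex
  have "continuous_on (- {0}) r"
    unfolding r_def by (intro continuous_intros) auto
  moreover have "r z \<in> - {0, 1}" if "z \<noteq> 0" for z
  proof -
    have "Re (r z) \<le> 2/3" unfolding r_def by (auto simp: max_def field_simps)
    then have "r z \<noteq> 1" by auto
    moreover have "r z \<noteq> 0" using that by (auto simp: r_def)
    ultimately show ?thesis by simp
  qed
  ultimately have h: "homotopic_paths (- {0, 1}) (r \<circ> p) (r \<circ> c)"
    by (intro homotopic_paths_continuous_image[OF hom]) auto
  have fixed: "homotopic_paths (- {0, 1}) q (r \<circ> q)" if "q \<in> loops ?K (1/2)" for q
  proof (rule homotopic_paths_eq)
    fix t :: real assume "t \<in> {0..1}"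
    then have "Re (q t) \<le> 2/3" using that unfolding loops_def path_image_def by blast
    then show "q t = (r \<circ> q) t" by (simp add: r_def max_absorb1)
  qed (use loopsK[OF that] in \<open>auto simp: loops_def\<close>)
  have pK: "p \<in> loops ?K (1/2)" using pp by (auto simp: loops_def)
  have "homotopic_paths (- {0, 1}) p c"
    using fixed[OF pK] h homotopic_paths_sym[OF fixed[OF c(1)]] by (blast intro: homotopic_paths_trans)
  from loop_class_eqI[OF loopsK[OF pK] this] c(3) show ?thesis by simp
qed

text \<open>Two half-planes around one puncture each overlap in a convex strip that contains \<open>1/2\<close>.  The
  reflection \<open>z \<mapsto> 1 - z\<close> exchanges the punctures and the half-planes.\<close>

lemma circles_generate_twice_punctured_plane:
  assumes H: "subgroup H (fundamental_group (- {0, 1::complex}) (1/2))"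
    and circles: "loop_class (- {0, 1}) (1/2) (circlepath 0 (1/2)) \<in> H"
      "loop_class (- {0, 1}) (1/2) (\<lambda>t. 1 - circlepath 0 (1/2) t) \<in> H"
  shows "H = carrier (fundamental_group (- {0, 1::complex}) (1/2))"
proof -
  let ?X = "- {0, 1::complex}"
  let ?U = "{z. Re z < 2/3} - {0::complex}" and ?V = "{z. Re z > 1/3} - {1::complex}"
  let ?r = "\<lambda>z::complex. 1 - z"
  have UV: "?U \<union> ?V = ?X" by (auto simp: complex_eq_iff)
  have open_half: "open {z. Re z < 2/3}" "open {z. Re z > 1/3}"
    by (rule open_halfspace_Re_lt open_halfspace_Re_gt)+
  have conn: "path_connected ?U" "path_connected ?V" "path_connected (?U \<inter> ?V)"
  proof -
    show "path_connected ?U" "path_connected ?V"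
      by (intro connected_open_path_connected connected_open_delete open_delete open_half
          convex_connected convex_halfspace_Re_lt convex_halfspace_Re_gt; simp)+
    have "?U \<inter> ?V = {z. Re z < 2/3} \<inter> {z. Re z > 1/3}" by auto
    then show "path_connected (?U \<inter> ?V)"
      by (simp only: convex_imp_path_connected convex_Int convex_halfspace_Re_lt convex_halfspace_Re_gt)
  qed
  have r: "continuous_on ?X ?r" "?r \<in> ?X \<rightarrow> ?X" by (auto intro!: continuous_intros)
  have H': "subgroup H (fundamental_group ?X (?r (1/2)))" using H by simp
  have in_r: "loop_class ?X (1/2) p \<in> vimage_subgroup ?X (1/2) ?r ?X H \<longleftrightarrow>
      loop_class ?X (1/2) (?r \<circ> p) \<in> H" if "p \<in> loops ?X (1/2)" for p
    using in_vimage_subgroup[OF r _ H' that] by simp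
  have circle: "circlepath 0 (1/2) \<in> loops ?X (1/2)"
  proof -
    have "z \<notin> path_image (circlepath 0 (1/2))" if "norm z \<noteq> 1/2" for z
      using that by (simp add: sphere_def)
    then show ?thesis by (auto simp: loops_def)
  qed
  have HV: "loop_class ?X (1/2) p \<in> H" if p: "p \<in> loops ?V (1/2)" for p
  proof -
    have rp: "?r \<circ> p \<in> loops ?U (1/2)"
    proof -
      have "?V \<subseteq> ?X" by auto
      then have "?r \<circ> p \<in> loops ?U (?r (1/2))"
        using continuous_on_subset[OF r(1)] by (intro loops_compose[OF p]) auto
      then show ?thesis by simp
    qed
    then have rpX: "?r \<circ> p \<in> loops ?X (1/2)" using UV by (auto simp: loops_def)
    have "loop_class ?X (1/2) (?r \<circ> p) \<in> vimage_subgroup ?X (1/2) ?r ?X H"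
    proof (rule loop_class_half_plane[OF _ _ rp])
      show "subgroup (vimage_subgroup ?X (1/2) ?r ?X H) (fundamental_group ?X (1/2))"
        using subgroup_vimage_subgroup[OF r _ H'] by simp
      show "loop_class ?X (1/2) (circlepath 0 (1/2)) \<in> vimage_subgroup ?X (1/2) ?r ?X H"
        using circles(2) by (simp add: in_r[OF circle] o_def)
    qed
    then show ?thesis using in_r[OF rpX] by (simp add: o_def)
  qed
  have "H = carrier (fundamental_group (?U \<union> ?V) (1/2))"
    by (rule loops_generate_union)
      (use open_half conn HV loop_class_half_plane[OF H circles(1)] H in \<open>auto simp only: UV, auto\<close>)
  then show ?thesis by (simp only: UV)
qed

text \<open>A point with first coordinate \<open>0\<close> is joined within a ball to one where it is not \<open>0\<close>.\<close>

lemma path_connected_open_if_punctured: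
  fixes S :: "(complex \<times> 'b::euclidean_space) set"
  assumes S: "open S" and conn: "path_connected (S \<inter> {z. fst z \<noteq> 0})"
  shows "path_connected S"
proof -
  have near: "\<exists>b \<in> S \<inter> {z. fst z \<noteq> 0}. path_component S a b" if a: "a \<in> S" for a
  proof (cases "fst a = 0")
    case True
    obtain e where e: "e > 0" "ball a e \<subseteq> S" using openE[OF S a] by metis
    define b where "b = a + (of_real (e/2), 0)"
    have "dist a b = e/2" using e(1) by (simp add: b_def dist_norm norm_Pair)
    then have "closed_segment a b \<subseteq> ball a e"
      using e(1) by (intro closed_segment_subset) auto
    then have "closed_segment a b \<subseteq> S" using e(2) by blast
    then have "path_component S a b"
      unfolding path_component_def by (intro exI[of _ "linepath a b"]) auto
    moreover have "fst b \<noteq> 0" using e(1) True by (simp add: b_def)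
    ultimately show ?thesis using path_component_mem(2)[of S a b] by blast
  next
    case False
    with a have "a \<in> S \<inter> {z. fst z \<noteq> 0}" by simp
    then show ?thesis using path_component_refl[OF a] by blast
  qed
  show ?thesis
    unfolding path_connected_component
  proof (intro ballI)
    fix a a' assume "a \<in> S" "a' \<in> S"
    then obtain b b' where b: "b \<in> S \<inter> {z. fst z \<noteq> 0}" "path_component S a b"
      "b' \<in> S \<inter> {z. fst z \<noteq> 0}" "path_component S a' b'" using near[of a] near[of a'] by blast
    then have "path_component S b b'"
      using conn path_component_of_subset[of "S \<inter> {z. fst z \<noteq> 0}" S b b']
      unfolding path_connected_component by blast
    then show "path_component S a a'"
      using path_component_trans[OF path_component_trans[OF b(2)] path_component_sym[OF b(4)]] by blast
  qed
qed

section \<open>The projective plane in homogeneous coordinates\<close>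

definition homogeneous :: "(complex \<times> complex \<times> complex \<Rightarrow> 'b) \<Rightarrow> bool"
  where "homogeneous g \<longleftrightarrow> (\<forall>k x y z. k \<noteq> 0 \<longrightarrow> g (k * x, k * y, k * z) = g (x, y, z))"

text \<open>The properties of \<^const>\<open>proj\<close> that matter hold equally after composition with a linear isomorphism;
  a change of coordinates is thus a change of \<open>\<pi>\<close>.\<close>

locale homogeneous_coordinates =
  fixes \<pi> :: "complex \<times> complex \<times> complex \<Rightarrow> 'a::topological_space"
  assumes \<pi>_eq_iff: "(x, y, z) \<noteq> 0 \<Longrightarrow> w \<noteq> 0 \<Longrightarrow>
      \<pi> (x, y, z) = \<pi> w \<longleftrightarrow> (\<exists>k. k \<noteq> 0 \<and> w = (k * x, k * y, k * z))"
    and \<pi>_surj: "\<exists>v. v \<noteq> 0 \<and> \<pi> v = P"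
    and open_iff: "open W \<longleftrightarrow> open {v. v \<noteq> 0 \<and> \<pi> v \<in> W}"
begin

lemma continuous_on_\<pi>: "continuous_on (- {0}) \<pi>"
proof -
  have "open (\<pi> -` W \<inter> - {0})" if "open W" for W
  proof -
    have "\<pi> -` W \<inter> - {0} = {v. v \<noteq> 0 \<and> \<pi> v \<in> W}" by auto
    then show ?thesis using that open_iff by simp
  qed
  then show ?thesis by (subst continuous_on_open_vimage) (simp_all add: open_Compl)
qed

lemma continuous_on_\<pi>_compose:
  assumes "continuous_on S f" "\<And>s. s \<in> S \<Longrightarrow> f s \<noteq> 0"
  shows "continuous_on S (\<lambda>s. \<pi> (f s))"
  by (rule continuous_on_compose2[OF continuous_on_\<pi> assms(1)]) (use assms(2) in auto)

definition region :: "(complex \<times> complex \<times> complex \<Rightarrow> bool) \<Rightarrow> 'a set"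
  where "region P = \<pi> ` {v. v \<noteq> 0 \<and> P v}"

text \<open>Meant for \<open>g\<close> homogeneous of degree \<open>0\<close>, which has the same value at all representatives.\<close>

definition descend :: "(complex \<times> complex \<times> complex \<Rightarrow> 'b) \<Rightarrow> 'a \<Rightarrow> 'b"
  where "descend g P = g (SOME v. v \<noteq> 0 \<and> \<pi> v = P)"

lemma homogeneous_eq:
  assumes "homogeneous g" "v \<noteq> 0" "w \<noteq> 0" "\<pi> v = \<pi> w"
  shows "g v = g w"
proof -
  obtain x y z where v: "v = (x, y, z)" by (cases v)
  obtain k where "k \<noteq> 0" "w = (k * x, k * y, k * z)"
    using \<pi>_eq_iff[of x y z w] assms(2-4) unfolding v by blast
  then show ?thesis using assms(1) unfolding homogeneous_def v by simp
qed

lemma in_region: "homogeneous P \<Longrightarrow> v \<noteq> 0 \<Longrightarrow> \<pi> v \<in> region P \<longleftrightarrow> P v"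
  unfolding region_def using homogeneous_eq[of P v] by blast

lemma regionE:
  assumes "x \<in> region P"
  obtains v where "v \<noteq> 0" "x = \<pi> v" "P v"
  using assms by (auto simp: region_def)

lemma descend: "homogeneous g \<Longrightarrow> v \<noteq> 0 \<Longrightarrow> descend g (\<pi> v) = g v"
  unfolding descend_def
  using someI[of "\<lambda>u. u \<noteq> 0 \<and> \<pi> u = \<pi> v" v] by (intro homogeneous_eq[of g]) blast+

lemma open_region: "homogeneous P \<Longrightarrow> open {v. v \<noteq> 0 \<and> P v} \<Longrightarrow> open (region P)"
  by (subst open_iff) (simp add: in_region cong: conj_cong)

lemma continuous_on_descend:
  fixes g :: "complex \<times> complex \<times> complex \<Rightarrow> 'b::topological_space"
  assumes P: "homogeneous P" "open {v. v \<noteq> 0 \<and> P v}"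
    and g: "homogeneous g" "continuous_on {v. v \<noteq> 0 \<and> P v} g"
  shows "continuous_on (region P) (descend g)"
proof -
  have "open (descend g -` B \<inter> region P)" if "open B" for B
  proof -
    have "{v. v \<noteq> 0 \<and> \<pi> v \<in> descend g -` B \<inter> region P} = g -` B \<inter> {v. v \<noteq> 0 \<and> P v}"
      by (auto simp: in_region[OF P(1)] descend[OF g(1)])
    moreover have "open (g -` B \<inter> {v. v \<noteq> 0 \<and> P v})"
      using g(2) P(2) that by (simp add: continuous_on_open_vimage)
    ultimately show ?thesis by (subst open_iff) simp
  qed
  then show ?thesis by (simp add: continuous_on_open_vimage open_region[OF P])
qed

end

section \<open>The complement of two bitangent conics in normal form\<close>

text \<open>The conics are \<open>x y + c z\<^sup>2 = 0\<close> and \<open>x y + (c - 1) z\<^sup>2 = 0\<close>.  They are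
  tangent at the points \<open>(1, 0, 0)\<close> and \<open>(0, 1, 0)\<close>, where the tangents are \<open>y = 0\<close> and \<open>x = 0\<close>.\<close>

locale bitangent_conics = homogeneous_coordinates \<pi>
  for \<pi> :: "complex \<times> complex \<times> complex \<Rightarrow> 'a::topological_space" +
  fixes c :: complex
  assumes c: "c \<noteq> 0" "c \<noteq> 1"
begin

definition Q :: "complex \<times> complex \<times> complex \<Rightarrow> complex"
  where "Q = (\<lambda>(x, y, z). x * y + c * z\<^sup>2)"

lemma Q_scale: "Q (k * x, k * y, k * z) = k\<^sup>2 * Q (x, y, z)"
  by (simp add: Q_def algebra_simps power2_eq_square)

lemma Q_nonzeroD: "Q v \<noteq> 0 \<Longrightarrow> v \<noteq> 0"
  by (auto simp: Q_def zero_prod_def)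

lemma continuous_on_Q [continuous_intros]: "continuous_on S f \<Longrightarrow> continuous_on S (\<lambda>s. Q (f s))"
  unfolding Q_def split_def by (intro continuous_intros)

definition off_conics :: "complex \<times> complex \<times> complex \<Rightarrow> bool"
  where "off_conics = (\<lambda>(x, y, z). Q (x, y, z) \<noteq> 0 \<and> Q (x, y, z) \<noteq> z\<^sup>2)"

abbreviation X :: "'a set" where "X \<equiv> region off_conics"

abbreviation cone1 :: "complex \<times> complex \<times> complex \<Rightarrow> bool" where
  "cone1 \<equiv> (\<lambda>(x, y, z). off_conics (x, y, z) \<and> z \<noteq> 0)"
abbreviation cone2 :: "complex \<times> complex \<times> complex \<Rightarrow> bool" where
  "cone2 \<equiv> (\<lambda>(x, y, z). off_conics (x, y, z) \<and> x \<noteq> 0)"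

definition U1 :: "'a set" where "U1 = region cone1"
definition U2 :: "'a set" where "U2 = region cone2"

lemma homogeneous_off_conics: "homogeneous off_conics"
  by (auto simp: homogeneous_def off_conics_def Q_scale power_mult_distrib)

lemma open_off_conics: "open {v. v \<noteq> 0 \<and> off_conics v}"
proof -
  have "{v. v \<noteq> 0 \<and> off_conics v} = {v. Q v \<noteq> 0} \<inter> {v. Q v \<noteq> (snd (snd v))\<^sup>2}"
    by (auto simp: off_conics_def dest: Q_nonzeroD)
  then show ?thesis
    by (simp add: open_Int open_Collect_neq continuous_intros)
qed

lemma U_homogeneous:
  "homogeneous cone1"
  "homogeneous cone2"
  using homogeneous_off_conics by (auto simp: homogeneous_def)

lemma U_open_cone:
  "open {v. v \<noteq> 0 \<and> cone1 v}"
  "open {v. v \<noteq> 0 \<and> cone2 v}"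
proof -
  have "{v. v \<noteq> 0 \<and> cone1 v}
      = {v. v \<noteq> 0 \<and> off_conics v} \<inter> {v. snd (snd v) \<noteq> 0}"
    "{v. v \<noteq> 0 \<and> cone2 v}
      = {v. v \<noteq> 0 \<and> off_conics v} \<inter> {v. fst v \<noteq> 0}"
    by auto
  then show "open {v. v \<noteq> 0 \<and> cone1 v}"
    "open {v. v \<noteq> 0 \<and> cone2 v}"
    by (simp_all only: open_Int open_off_conics open_Collect_neq continuous_intros)
qed

lemma open_U: "open U1" "open U2"
  unfolding U1_def U2_def by (intro open_region U_homogeneous U_open_cone)+

lemma X_eq: "X = U1 \<union> U2"
proof -
  have "z \<noteq> 0 \<or> x \<noteq> 0" if "off_conics (x, y, z)" for x y z
    using that by (auto simp: off_conics_def Q_def)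
  then show ?thesis by (fastforce simp: U1_def U2_def region_def)
qed

text \<open>The charts \<open>z = 1\<close> and \<open>x = 1\<close>.  In each of them the first coordinate is the one that vanishes on the
  line missing from the other chart; hence the order \<open>(z, y)\<close> in the second.\<close>

definition S1 :: "(complex \<times> complex) set" where "S1 = {(x, y). off_conics (x, y, 1)}"
definition S2 :: "(complex \<times> complex) set" where "S2 = {(z, y). off_conics (1, y, z)}"
definition chart1 :: "complex \<times> complex \<Rightarrow> 'a" where "chart1 = (\<lambda>(x, y). \<pi> (x, y, 1))"
definition chart2 :: "complex \<times> complex \<Rightarrow> 'a" where "chart2 = (\<lambda>(z, y). \<pi> (1, y, z))"

lemma continuous_on_chart12: "continuous_on S chart1" "continuous_on S chart2"
  unfolding chart1_def chart2_def split_def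
  by (intro continuous_on_\<pi>_compose continuous_intros; simp add: zero_prod_def)+

lemma chart1_mem: "p \<in> S1 \<Longrightarrow> chart1 p \<in> U1" and chart2_mem: "p \<in> S2 \<Longrightarrow> chart2 p \<in> U2"
  by (auto simp: S1_def S2_def chart1_def chart2_def U1_def U2_def region_def zero_prod_def
      split: prod.splits)

lemma U_subset_X: "U1 \<subseteq> X" "U2 \<subseteq> X"
  using X_eq by auto

lemma open_S: "open S1" "open S2"
proof -
  have "S1 = {p. Q (fst p, snd p, 1) \<noteq> 0} \<inter> {p. Q (fst p, snd p, 1) \<noteq> 1}"
    "S2 = {p. Q (1, snd p, fst p) \<noteq> 0} \<inter> {p. Q (1, snd p, fst p) \<noteq> (fst p)\<^sup>2}"
    by (auto simp: S1_def S2_def off_conics_def)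
  then show "open S1" "open S2"
    by (simp_all add: open_Int open_Collect_neq continuous_intros)
qed

lemma scale_\<pi>: "k \<noteq> 0 \<Longrightarrow> (x, y, z) \<noteq> 0 \<Longrightarrow> \<pi> (k * x, k * y, k * z) = \<pi> (x, y, z)"
  by (subst eq_commute, subst \<pi>_eq_iff) (auto simp: zero_prod_def)

lemma inverse_on_region:
  assumes P: "homogeneous P" "open {v. v \<noteq> 0 \<and> P v}"
    and h: "homogeneous h" "continuous_on {v. v \<noteq> 0 \<and> P v} h"
    and f: "\<And>v. v \<noteq> 0 \<Longrightarrow> P v \<Longrightarrow> h v \<in> S \<and> f (h v) = \<pi> v"
    and g: "\<And>p. \<exists>v. v \<noteq> 0 \<and> f p = \<pi> v \<and> h v = p"
  shows "\<exists>g. continuous_on (region P) g \<and> g \<in> region P \<rightarrow> S \<and>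
    (\<forall>R\<in>region P. f (g R) = R) \<and> (\<forall>p\<in>S. g (f p) = p)"
proof (intro exI[of _ "descend h"] conjI ballI)
  show "continuous_on (region P) (descend h)" by (rule continuous_on_descend[OF P h])
  have mem: "descend h R \<in> S \<and> f (descend h R) = R" if R: "R \<in> region P" for R
  proof -
    obtain v where v: "v \<noteq> 0" "R = \<pi> v" "P v" using R by (rule regionE)
    show ?thesis using f[OF v(1,3)] unfolding v(2) descend[OF h(1) v(1)] .
  qed
  then show "descend h \<in> region P \<rightarrow> S" by blast
  show "f (descend h R) = R" if "R \<in> region P" for R using mem[OF that] by blast
  fix p
  obtain v where v: "v \<noteq> 0" "f p = \<pi> v" "h v = p" using g by blast
  show "descend h (f p) = p" unfolding v(2) descend[OF h(1) v(1)] by (rule v(3))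
qed

lemma chart1_inverse:
  "\<exists>g. continuous_on U1 g \<and> g \<in> U1 \<rightarrow> S1 \<and> (\<forall>P\<in>U1. chart1 (g P) = P) \<and> (\<forall>p\<in>S1. g (chart1 p) = p)"
  unfolding U1_def
proof (rule inverse_on_region[OF U_homogeneous(1) U_open_cone(1)])
  let ?h = "\<lambda>(x, y, z). (x / z, y / z) :: complex \<times> complex"
  show hom: "homogeneous ?h" by (simp add: homogeneous_def)
  show "continuous_on {v. v \<noteq> 0 \<and> cone1 v} ?h"
    unfolding split_def by (intro continuous_intros) auto
  fix v assume "v \<noteq> 0" "cone1 v"
  moreover obtain x y z where xyz: "v = (x, y, z)" by (cases v)
  ultimately have v: "(x, y, z) \<noteq> 0" "off_conics (x, y, z)" "z \<noteq> 0" by simp_all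
  have "(inverse z * x, inverse z * y, inverse z * z) = (x / z, y / z, 1)"
    using v(3) by (simp add: divide_inverse mult.commute)
  then have "off_conics (x / z, y / z, 1)" "\<pi> (x / z, y / z, 1) = \<pi> (x, y, z)"
    using homogeneous_off_conics[unfolded homogeneous_def, rule_format,
        OF nonzero_imp_inverse_nonzero[OF v(3)], of x y z] v(2)
      scale_\<pi>[OF nonzero_imp_inverse_nonzero[OF v(3)] v(1)] by simp_all
  then show "?h v \<in> S1 \<and> chart1 (?h v) = \<pi> v" by (simp add: xyz S1_def chart1_def)
next
  fix p show "\<exists>v. v \<noteq> 0 \<and> chart1 p = \<pi> v \<and> (\<lambda>(x, y, z). (x / z, y / z)) v = p"
    by (intro exI[of _ "(fst p, snd p, 1)"]) (simp add: chart1_def zero_prod_def split_def)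
qed

lemma chart2_inverse:
  "\<exists>g. continuous_on U2 g \<and> g \<in> U2 \<rightarrow> S2 \<and> (\<forall>P\<in>U2. chart2 (g P) = P) \<and> (\<forall>p\<in>S2. g (chart2 p) = p)"
  unfolding U2_def
proof (rule inverse_on_region[OF U_homogeneous(2) U_open_cone(2)])
  let ?h = "\<lambda>(x, y, z). (z / x, y / x) :: complex \<times> complex"
  show hom: "homogeneous ?h" by (simp add: homogeneous_def)
  show "continuous_on {v. v \<noteq> 0 \<and> cone2 v} ?h"
    unfolding split_def by (intro continuous_intros) auto
  fix v assume "v \<noteq> 0" "cone2 v"
  moreover obtain x y z where xyz: "v = (x, y, z)" by (cases v)
  ultimately have v: "(x, y, z) \<noteq> 0" "off_conics (x, y, z)" "x \<noteq> 0" by simp_all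
  have "(inverse x * x, inverse x * y, inverse x * z) = (1, y / x, z / x)"
    using v(3) by (simp add: divide_inverse mult.commute)
  then have "off_conics (1, y / x, z / x)" "\<pi> (1, y / x, z / x) = \<pi> (x, y, z)"
    using homogeneous_off_conics[unfolded homogeneous_def, rule_format,
        OF nonzero_imp_inverse_nonzero[OF v(3)], of x y z] v(2)
      scale_\<pi>[OF nonzero_imp_inverse_nonzero[OF v(3)] v(1)] by simp_all
  then show "?h v \<in> S2 \<and> chart2 (?h v) = \<pi> v" by (simp add: xyz S2_def chart2_def)
next
  fix p show "\<exists>v. v \<noteq> 0 \<and> chart2 p = \<pi> v \<and> (\<lambda>(x, y, z). (z / x, y / x)) v = p"
    by (intro exI[of _ "(1, snd p, fst p)"]) (simp add: chart2_def zero_prod_def split_def)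
qed

text \<open>Away from the lines \<open>x = 0\<close> and \<open>z = 0\<close>, the functions \<open>x / z\<close> and \<open>w = z\<^sup>2 / Q\<close> are
  coordinates: there the complement is the product of a punctured plane, with coordinate \<open>x / z\<close>,
  and a twice punctured plane, with coordinate \<open>w\<close>.\<close>

definition T :: "(complex \<times> complex) set" where "T = (- {0}) \<times> (- {0, 1})"
definition to_S1 :: "complex \<times> complex \<Rightarrow> complex \<times> complex"
  where "to_S1 = (\<lambda>(u, w). (u, (1 / w - c) / u))"
definition chart :: "complex \<times> complex \<Rightarrow> 'a" where "chart p = chart1 (to_S1 p)"

lemma continuous_on_to_S1: "continuous_on T to_S1"
  unfolding T_def to_S1_def split_def by (intro continuous_intros) auto

lemma to_S1_image: "to_S1 ` T = S1 \<inter> {p. fst p \<noteq> 0}"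
proof
  show "to_S1 ` T \<subseteq> S1 \<inter> {p. fst p \<noteq> 0}"
    by (auto simp: T_def to_S1_def S1_def off_conics_def Q_def)
  show "S1 \<inter> {p. fst p \<noteq> 0} \<subseteq> to_S1 ` T"
  proof
    fix p assume p: "p \<in> S1 \<inter> {p. fst p \<noteq> 0}"
    obtain x y where xy: "p = (x, y)" by (cases p)
    have "(x, 1 / (x * y + c)) \<in> T" "p = to_S1 (x, 1 / (x * y + c))"
      using p by (auto simp: xy S1_def off_conics_def Q_def T_def to_S1_def)
    then show "p \<in> to_S1 ` T" by blast
  qed
qed

lemma continuous_on_chart: "continuous_on T chart"
  unfolding chart_def by (rule continuous_on_compose2[OF continuous_on_chart12(1) continuous_on_to_S1 subset_UNIV])

lemma chart_mem: "p \<in> T \<Longrightarrow> chart p \<in> U1 \<inter> U2"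
proof -
  assume p: "p \<in> T"
  obtain x y where xy: "to_S1 p = (x, y)" by (cases "to_S1 p")
  have "(x, y) \<in> S1" "x \<noteq> 0" using to_S1_image p xy by (metis IntD1 imageI, force)
  then have "off_conics (x, y, 1)" "(x, y, 1) \<noteq> 0" by (auto simp: S1_def zero_prod_def)
  with \<open>x \<noteq> 0\<close> show ?thesis
    unfolding chart_def xy chart1_def U1_def U2_def region_def by force
qed

lemma chart_X: "p \<in> T \<Longrightarrow> chart p \<in> X"
  using chart_mem U_subset_X by blast

lemma chart_image: "chart ` T = U1 \<inter> U2"
proof
  show "chart ` T \<subseteq> U1 \<inter> U2" using chart_mem by blast
  show "U1 \<inter> U2 \<subseteq> chart ` T"
  proof
    fix P assume P: "P \<in> U1 \<inter> U2"
    obtain g where g: "continuous_on U1 g" "g \<in> U1 \<rightarrow> S1" "\<forall>P\<in>U1. chart1 (g P) = P"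
      using chart1_inverse by blast
    obtain x y where xy: "g P = (x, y)" by (cases "g P")
    have eq: "P = \<pi> (x, y, 1)" using g(3) P xy by (auto simp: chart1_def)
    have "x \<noteq> 0" using P unfolding eq U2_def by (simp add: in_region[OF U_homogeneous(2)] zero_prod_def)
    moreover have "g P \<in> S1" using g(2) P by auto
    ultimately have "g P \<in> to_S1 ` T" by (simp add: to_S1_image xy)
    then obtain t where "t \<in> T" "g P = to_S1 t" by blast
    moreover have "chart1 (g P) = P" using g(3) P by blast
    ultimately have "P = chart t" by (simp add: chart_def)
    with \<open>t \<in> T\<close> show "P \<in> chart ` T" by blast
  qed
qed

lemma path_connected_T: "path_connected T"
  unfolding T_def
  by (intro path_connected_Times path_connected_complement_countable) auto

lemma path_connected_U:
  "path_connected U1" "path_connected U2" "path_connected (U1 \<inter> U2)"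
proof -
  show conn: "path_connected (U1 \<inter> U2)"
    unfolding chart_image[symmetric]
    by (rule path_connected_continuous_image[OF continuous_on_chart path_connected_T])
  have "path_connected (S1 \<inter> {p. fst p \<noteq> 0})"
    unfolding to_S1_image[symmetric]
    by (rule path_connected_continuous_image[OF continuous_on_to_S1 path_connected_T])
  then have "path_connected S1" by (rule path_connected_open_if_punctured[OF open_S(1)])
  moreover have "chart1 ` S1 = U1"
  proof -
    obtain g where g: "continuous_on U1 g" "g \<in> U1 \<rightarrow> S1" "\<forall>P\<in>U1. chart1 (g P) = P"
      using chart1_inverse by blast
    have "P \<in> chart1 ` S1" if "P \<in> U1" for P using that g(2,3) by (intro image_eqI[of P chart1 "g P"]) auto
    then show ?thesis using chart1_mem by blast
  qed
  ultimately show "path_connected U1"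
    using path_connected_continuous_image[OF continuous_on_chart12(1), of S1] by simp
  obtain g where g: "continuous_on U2 g" "g \<in> U2 \<rightarrow> S2" "\<forall>P\<in>U2. chart2 (g P) = P"
    "\<forall>p\<in>S2. g (chart2 p) = p" using chart2_inverse by blast
  have "g ` (U1 \<inter> U2) = S2 \<inter> {p. fst p \<noteq> 0}"
  proof -
    have iff: "chart2 p \<in> U1 \<longleftrightarrow> fst p \<noteq> 0" if "p \<in> S2" for p
      using that unfolding U1_def chart2_def S2_def
      by (auto simp: in_region[OF U_homogeneous(1)] zero_prod_def)
    show ?thesis
    proof (intro subset_antisym subsetI)
      fix p assume "p \<in> g ` (U1 \<inter> U2)"
      then obtain P where P: "P \<in> U1" "P \<in> U2" "p = g P" by blast
      then have "p \<in> S2" "chart2 p = P" using g by auto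
      then show "p \<in> S2 \<inter> {p. fst p \<noteq> 0}" using iff[of p] P by simp
    next
      fix p assume p: "p \<in> S2 \<inter> {p. fst p \<noteq> 0}"
      then have "chart2 p \<in> U1 \<inter> U2" "g (chart2 p) = p" using iff chart2_mem g(4) by auto
      then show "p \<in> g ` (U1 \<inter> U2)" by force
    qed
  qed
  then have "path_connected (S2 \<inter> {p. fst p \<noteq> 0})"
    using path_connected_continuous_image[OF continuous_on_subset[OF g(1) Int_lower2] conn] by simp
  then have "path_connected S2" by (rule path_connected_open_if_punctured[OF open_S(2)])
  moreover have "chart2 ` S2 = U2"
  proof -
    have "P \<in> chart2 ` S2" if "P \<in> U2" for P using that g(2,3) by (intro image_eqI[of P chart2 "g P"]) auto
    then show ?thesis using chart2_mem by blast
  qed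
  ultimately show "path_connected U2"
    using path_connected_continuous_image[OF continuous_on_chart12(2), of S2] by simp
qed

lemma path_connected_X: "path_connected X"
  unfolding X_eq
proof (rule path_connected_Un[OF path_connected_U(1,2)])
  have "(1, 1/2) \<in> T" by (simp add: T_def)
  then show "U1 \<inter> U2 \<noteq> {}" using chart_mem by blast
qed

end

section \<open>Generators of the complement and a relation between them\<close>

context bitangent_conics
begin

definition base :: 'a where "base = chart (1, 1/2)"

lemma base_X: "base \<in> X"
  unfolding base_def by (rule chart_X) (simp add: T_def)

definition lift_loop :: "(real \<Rightarrow> complex) \<Rightarrow> real \<Rightarrow> 'a"
  where "lift_loop p = (\<lambda>w. chart (1, w)) \<circ> p"

lemma lift: "continuous_on (- {0, 1}) (\<lambda>w. chart (1, w))" "(\<lambda>w. chart (1, w)) \<in> - {0, 1} \<rightarrow> X"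
proof -
  show "continuous_on (- {0, 1}) (\<lambda>w. chart (1, w))"
    by (rule continuous_on_compose2[OF continuous_on_chart]) (auto intro!: continuous_intros simp: T_def)
  show "(\<lambda>w. chart (1, w)) \<in> - {0, 1} \<rightarrow> X"
    by (auto intro!: chart_X simp: T_def)
qed

lemma lift_loop_loops: "p \<in> loops (- {0, 1}) (1/2) \<Longrightarrow> lift_loop p \<in> loops X base"
  unfolding lift_loop_def base_def by (rule loops_compose[OF _ lift])

lemma homotopic_in_X:
  assumes "homotopic_paths T p q"
  shows "homotopic_paths X (chart \<circ> p) (chart \<circ> q)"
  using assms continuous_on_chart by (rule homotopic_paths_continuous_image) (auto intro: chart_X)

text \<open>Along a path \<open>d\<close> in the \<open>w\<close>-plane the loop is pushed to the fibre over \<open>w = 1 / c\<close>, which consists of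
  the lines \<open>x = 0\<close> and \<open>y = 0\<close>; in the line \<open>y = 0\<close> it can be contracted.\<close>

lemma fibre_loop_null:
  assumes "u \<in> loops (- {0}) 1"
  shows "homotopic_paths X (\<lambda>t. chart (u t, 1/2)) (\<lambda>_. base)"
proof -
  note [trans] = homotopic_paths_trans
  have u: "path u" "path_image u \<subseteq> - {0}" "pathstart u = 1" "pathfinish u = 1"
    using assms by (auto simp: loops_def)
  have "path_connected (- {0, 1::complex})"
    by (rule path_connected_complement_countable) auto
  then obtain d where d: "path d" "path_image d \<subseteq> - {0, 1}" "pathstart d = 1/2" "pathfinish d = 1/c"
    using c unfolding path_connected_def by (metis (no_types) ComplI divide_eq_0_iff divide_eq_1_iff
        empty_iff insert_iff one_neq_zero zero_neq_numeral numeral_eq_one_iff semiring_norm(85))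
  let ?h = "homotopic_paths (- {0::complex})" and ?k = "homotopic_paths (- {0, 1::complex})"
  have 1: "?h u ((\<lambda>_. 1) +++ (u +++ (\<lambda>_. 1)))"
  proof (rule homotopic_paths_sym)
    have "?h ((\<lambda>_. 1) +++ (u +++ (\<lambda>_. 1))) ((\<lambda>_. 1) +++ u)"
      by (rule homotopic_paths_join, simp add: path_const path_image_def,
          rule homotopic_paths_const_right) (use u in auto)
    also have "?h \<dots> u" by (rule homotopic_paths_const_left) (use u in auto)
    finally show "?h ((\<lambda>_. 1) +++ (u +++ (\<lambda>_. 1))) u" .
  qed
  have 2: "?k (\<lambda>_. 1/2) (d +++ ((\<lambda>_. 1/c) +++ reversepath d))"
  proof (rule homotopic_paths_sym)
    have "?k (d +++ ((\<lambda>_. 1/c) +++ reversepath d)) (d +++ reversepath d)"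
      by (rule homotopic_paths_join, simp add: d, rule homotopic_paths_const_left)
        (use d in auto)
    also have "?k \<dots> (\<lambda>_. 1/2)" by (rule homotopic_paths_inverse_right) (use d in auto)
    finally show "?k (d +++ ((\<lambda>_. 1/c) +++ reversepath d)) (\<lambda>_. 1/2)" .
  qed
  define e where "e = (\<lambda>t. (1::complex, d t))"
  have e: "path e" "path_image e \<subseteq> T" "pathstart e = (1, 1/2)" "pathfinish e = (1, 1/c)"
    using d by (auto simp: e_def path_def path_image_def pathstart_def pathfinish_def T_def
        intro!: continuous_intros)
  have ce: "path (chart \<circ> e)" "path_image (chart \<circ> e) \<subseteq> X" "pathstart (chart \<circ> e) = base"
    "pathfinish (chart \<circ> e) = chart (1, 1/c)"
    using e chart_X continuous_on_subset[OF continuous_on_chart e(2)]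
    by (auto simp: path_image_compose pathstart_compose pathfinish_compose base_def intro: path_continuous_image)
  define v where "v = (\<lambda>t. (u t, 1/c))"
  have v: "path v" "path_image v \<subseteq> T" "pathstart v = (1, 1/c)" "pathfinish v = (1, 1/c)"
    using u c by (auto simp: v_def path_def path_image_def pathstart_def pathfinish_def T_def
        intro!: continuous_intros)
  have join: "(\<lambda>t. (((\<lambda>_. 1) +++ (u +++ (\<lambda>_. 1))) t, (d +++ ((\<lambda>_. 1/c) +++ reversepath d)) t))
      = e +++ (v +++ reversepath e)"
    by (auto simp: joinpaths_def e_def v_def reversepath_def fun_eq_iff)
  have "homotopic_paths T (\<lambda>t. (u t, 1/2)) (e +++ (v +++ reversepath e))"
    unfolding T_def join[symmetric] by (rule homotopic_paths_Pair[OF 1 2])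
  from homotopic_in_X[OF this]
  have "homotopic_paths X (\<lambda>t. chart (u t, 1/2)) ((chart \<circ> e) +++ ((chart \<circ> v) +++ reversepath (chart \<circ> e)))"
    by (simp add: path_compose_join reversepath_o o_assoc) (simp add: o_def)
  also have "homotopic_paths X \<dots> ((chart \<circ> e) +++ ((\<lambda>_. chart (1, 1/c)) +++ reversepath (chart \<circ> e)))"
  proof -
    have line: "continuous_on UNIV (\<lambda>x. chart1 (x, 0))" "(\<lambda>x. chart1 (x, 0)) \<in> UNIV \<rightarrow> X"
      using c chart1_mem U_subset_X(1)
      by (auto intro!: continuous_on_compose2[OF continuous_on_chart12(1)] continuous_intros)
        (auto simp: S1_def off_conics_def Q_def subset_iff)
    have "homotopic_paths UNIV u (\<lambda>_. 1)"
      by (rule homotopic_paths_linear) (use u in \<open>auto simp: pathstart_def pathfinish_def path_const\<close>)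
    from homotopic_paths_continuous_image[OF this line]
    have "homotopic_paths X (chart \<circ> v) (\<lambda>_. chart (1, 1/c))"
      by (simp add: o_def v_def chart_def to_S1_def)
    then show ?thesis
      using ce v(3,4) by (intro homotopic_paths_join)
        (simp_all add: pathstart_compose pathfinish_compose)
  qed
  also have "homotopic_paths X \<dots> (\<lambda>_. base)"
  proof -
    have "homotopic_paths X ((chart \<circ> e) +++ ((\<lambda>_. chart (1, 1/c)) +++ reversepath (chart \<circ> e)))
        ((chart \<circ> e) +++ reversepath (chart \<circ> e))"
      by (rule homotopic_paths_join, simp add: ce, rule homotopic_paths_const_left)
        (use ce in auto)
    also have "homotopic_paths X \<dots> (\<lambda>_. base)"
      by (rule homotopic_paths_inverse_right) (use ce in auto)
    finally show ?thesis .
  qed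
  finally show ?thesis .
qed

lemma loops_T_components:
  assumes "p \<in> loops T (1, 1/2)"
  shows "fst \<circ> p \<in> loops (- {0}) 1" "snd \<circ> p \<in> loops (- {0, 1}) (1/2)"
proof -
  have "fst \<circ> p \<in> loops (- {0}) (fst (1::complex, 1/2::complex))"
    by (rule loops_compose[OF assms]) (auto simp: T_def intro!: continuous_intros)
  moreover have "snd \<circ> p \<in> loops (- {0, 1}) (snd (1::complex, 1/2::complex))"
    by (rule loops_compose[OF assms]) (auto simp: T_def intro!: continuous_intros)
  ultimately show "fst \<circ> p \<in> loops (- {0}) 1" "snd \<circ> p \<in> loops (- {0, 1}) (1/2)"
    by simp_all
qed

text \<open>A loop in the product is homotopic to a loop in the fibre followed by a loop over the \<open>w\<close>-plane, and
  the former is null-homotopic.\<close>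

lemma loop_class_chart:
  assumes p: "p \<in> loops T (1, 1/2)"
  shows "loop_class X base (chart \<circ> p) = loop_class X base (lift_loop (snd \<circ> p))"
proof -
  note fst_p = loops_T_components(1)[OF p] and snd_p = loops_T_components(2)[OF p]
  let ?v = "\<lambda>t. (fst (p t), 1/2)" and ?w = "\<lambda>t. (1, snd (p t))"
  have "homotopic_paths (- {0}) (fst \<circ> p) ((fst \<circ> p) +++ (\<lambda>_. 1))"
    by (rule homotopic_paths_sym, rule homotopic_paths_const_right) (use fst_p in \<open>auto simp: loops_def\<close>)
  moreover have "homotopic_paths (- {0, 1}) (snd \<circ> p) ((\<lambda>_. 1/2) +++ (snd \<circ> p))"
    by (rule homotopic_paths_sym, rule homotopic_paths_const_left) (use snd_p in \<open>auto simp: loops_def\<close>)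
  ultimately have "homotopic_paths T (\<lambda>t. ((fst \<circ> p) t, (snd \<circ> p) t))
      (\<lambda>t. (((fst \<circ> p) +++ (\<lambda>_. 1)) t, ((\<lambda>_. 1/2) +++ (snd \<circ> p)) t))"
    unfolding T_def by (rule homotopic_paths_Pair)
  moreover have "(\<lambda>t. (((fst \<circ> p) +++ (\<lambda>_. 1)) t, ((\<lambda>_. 1/2) +++ (snd \<circ> p)) t)) = ?v +++ ?w"
    by (auto simp: joinpaths_def fun_eq_iff)
  ultimately have "homotopic_paths T p (?v +++ ?w)" by (simp add: o_def)
  from homotopic_in_X[OF this]
  have "homotopic_paths X (chart \<circ> p) ((\<lambda>t. chart (?v t)) +++ lift_loop (snd \<circ> p))"
    by (simp add: path_compose_join lift_loop_def) (simp add: o_def)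
  also have "homotopic_paths X \<dots> ((\<lambda>_. base) +++ lift_loop (snd \<circ> p))"
  proof (rule homotopic_paths_join)
    show "homotopic_paths X (\<lambda>t. chart (?v t)) (\<lambda>_. base)"
      using fibre_loop_null[OF fst_p] by simp
    from homotopic_paths_imp_pathfinish[OF this]
    show "pathfinish (\<lambda>t. chart (?v t)) = pathstart (lift_loop (snd \<circ> p))"
      using lift_loop_loops[OF snd_p] by (simp add: loops_def)
  qed (use lift_loop_loops[OF snd_p] in \<open>simp add: loops_def\<close>)
  also have "homotopic_paths X \<dots> (lift_loop (snd \<circ> p))"
    by (rule homotopic_paths_const_left) (use lift_loop_loops[OF snd_p] in \<open>auto simp: loops_def\<close>)
  finally have "homotopic_paths X (chart \<circ> p) (lift_loop (snd \<circ> p))" .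
  moreover have "chart \<circ> p \<in> loops X base"
    unfolding base_def by (rule loops_compose[OF p continuous_on_chart]) (auto intro: chart_X)
  ultimately show ?thesis by (intro loop_class_eqI)
qed

definition circle0 :: "real \<Rightarrow> complex" where "circle0 = circlepath 0 (1/2)"
definition circle1 :: "real \<Rightarrow> complex" where "circle1 = (\<lambda>t. 1 - circlepath 0 (1/2) t)"

lemma circle_loops: "circle0 \<in> loops (- {0, 1}) (1/2)" "circle1 \<in> loops (- {0, 1}) (1/2)"
proof -
  have "z \<notin> path_image circle0" if "norm z \<noteq> 1/2" for z
    using that by (simp add: circle0_def sphere_def)
  from this[of 0] this[of 1] show c0: "circle0 \<in> loops (- {0, 1}) (1/2)"
    by (auto simp: loops_def circle0_def)
  have "circle1 = (\<lambda>z. 1 - z) \<circ> circle0" by (simp add: circle0_def circle1_def o_def)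
  moreover have "(\<lambda>z. 1 - z) \<circ> circle0 \<in> loops (- {0, 1}) (1 - 1/2)"
    by (rule loops_compose[OF c0]) (auto intro!: continuous_intros)
  ultimately show "circle1 \<in> loops (- {0, 1}) (1/2)" by simp
qed

text \<open>Pulled back along the chart \<open>f\<close>, the loop is moved off the line where the first coordinate vanishes.\<close>

lemma loop_class_eq_avoiding:
  fixes S :: "(complex \<times> complex) set"
  assumes p: "p \<in> loops U base"
    and chart: "open S" "continuous_on UNIV f" "f ` S \<subseteq> U" "f ` (S \<inter> {s. fst s \<noteq> 0}) \<subseteq> U1 \<inter> U2" "U \<subseteq> X"
    and g: "continuous_on U g" "g \<in> U \<rightarrow> S" "\<forall>P\<in>U. f (g P) = P" "fst (g base) \<noteq> (0::complex)"
  shows "\<exists>q \<in> loops (U1 \<inter> U2) base. loop_class X base p = loop_class X base q"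
proof -
  have gp: "g \<circ> p \<in> loops S (g base)" by (rule loops_compose[OF p g(1,2)])
  obtain r where r: "homotopic_paths S (g \<circ> p) r" "path_image r \<subseteq> {s. fst s \<noteq> 0}"
    using homotopic_path_avoiding_zero[OF chart(1), of "g \<circ> p"] gp g(4) unfolding loops_def by auto
  have pU: "p t \<in> U" if "t \<in> {0..1}" for t using p that by (auto simp: loops_def path_image_def)
  have "base \<in> U" using pU[of 0] p by (simp add: loops_def pathstart_def)
  then have fb: "f (g base) = base" using g(3) by blast
  have fS: "continuous_on S f" "f \<in> S \<rightarrow> X" using chart(2,3,5) by (auto elim: continuous_on_subset)
  have "homotopic_paths X p (f \<circ> (g \<circ> p))"
    using p chart(5) g(3) pU by (intro homotopic_paths_eq) (auto simp: loops_def)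
  also have "homotopic_paths X \<dots> (f \<circ> r)"
    by (rule homotopic_paths_continuous_image[OF r(1) fS])
  finally have "loop_class X base p = loop_class X base (f \<circ> r)"
    using p chart(5) by (intro loop_class_eqI) (auto simp: loops_def)
  moreover have "f \<circ> r \<in> loops (U1 \<inter> U2) base"
  proof -
    have "r \<in> loops (S \<inter> {s. fst s \<noteq> 0}) (g base)"
      using r gp homotopic_paths_imp_path[OF r(1)] homotopic_paths_imp_subset[OF r(1)]
        homotopic_paths_imp_pathstart[OF r(1)] homotopic_paths_imp_pathfinish[OF r(1)]
      by (simp add: loops_def)
    then have "f \<circ> r \<in> loops (U1 \<inter> U2) (f (g base))"
      by (rule loops_compose) (use chart(2,4) continuous_on_subset in blast)+
    then show ?thesis by (simp add: fb)
  qed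
  ultimately show ?thesis by blast
qed

lemma chart_inverse:
  assumes "q \<in> loops (U1 \<inter> U2) base"
  shows "\<exists>p \<in> loops T (1, 1/2). loop_class X base q = loop_class X base (chart \<circ> p)"
proof -
  obtain g where g: "continuous_on U1 g" "g \<in> U1 \<rightarrow> S1" "\<forall>P\<in>U1. chart1 (g P) = P" "\<forall>p\<in>S1. g (chart1 p) = p"
    using chart1_inverse by blast
  define k where "k P = (fst (g P), 1 / (fst (g P) * snd (g P) + c))" for P
  have k_chart: "k (chart s) = s" if "s \<in> T" for s
  proof -
    obtain u w where s: "s = (u, w)" by (cases s)
    have "to_S1 s \<in> S1" using that to_S1_image by blast
    then have "g (chart s) = to_S1 s" using g(4) by (simp add: chart_def)
    then show ?thesis using that by (simp add: k_def s to_S1_def T_def)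
  qed
  have k: "k P \<in> T \<and> chart (k P) = P" if "P \<in> U1 \<inter> U2" for P
    using that k_chart unfolding chart_image[symmetric] by auto
  have "continuous_on (U1 \<inter> U2) k"
  proof -
    have "fst (g P) * snd (g P) + c \<noteq> 0" if "P \<in> U1 \<inter> U2" for P
    proof -
      have "g P \<in> S1" using g(2) that by auto
      then show ?thesis by (cases "g P") (auto simp: S1_def off_conics_def Q_def)
    qed
    then show ?thesis
      unfolding k_def by (intro continuous_intros continuous_on_subset[OF g(1)]) auto
  qed
  then have "k \<circ> q \<in> loops T (k base)"
    using k by (intro loops_compose[OF assms]) auto
  moreover have "k base = (1, 1/2)" unfolding base_def by (rule k_chart) (simp add: T_def)
  moreover have "loop_class X base q = loop_class X base (chart \<circ> (k \<circ> q))"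
  proof (rule loop_class_eqI)
    show qX: "q \<in> loops X base" using assms U_subset_X by (auto simp: loops_def)
    show "homotopic_paths X q (chart \<circ> (k \<circ> q))"
    proof (rule homotopic_paths_eq)
      fix t :: real assume "t \<in> {0..1}"
      then have "q t \<in> U1 \<inter> U2" using assms unfolding loops_def path_image_def by blast
      then show "q t = (chart \<circ> (k \<circ> q)) t" using k by simp
    qed (use qX in \<open>auto simp: loops_def\<close>)
  qed
  ultimately show ?thesis by auto
qed

text \<open>A loop in one of the two charts can be moved off the missing line of the other chart, into the
  product; there, modulo loops in the fibre, it comes from the twice punctured \<open>w\<close>-plane.\<close>

theorem circles_generate:
  assumes H: "subgroup H (fundamental_group X base)"
    and circles: "loop_class X base (lift_loop circle0) \<in> H" "loop_class X base (lift_loop circle1) \<in> H"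
  shows "H = carrier (fundamental_group X base)"
proof -
  have lifts: "loop_class X base (lift_loop p) \<in> H" if "p \<in> loops (- {0, 1}) (1/2)" for p
  proof -
    have H': "subgroup H (fundamental_group X (chart (1, 1/2)))" using H by (simp add: base_def)
    have "loop_class X (chart (1, 1/2)) ((\<lambda>w. chart (1, w)) \<circ> p) \<in> H"
    proof (rule loop_class_image_in_subgroup[OF lift _ H', of "{circle0, circle1}"])
      fix K assume "subgroup K (fundamental_group (- {0, 1::complex}) (1/2))"
        "\<And>p. p \<in> {circle0, circle1} \<Longrightarrow> loop_class (- {0, 1}) (1/2) p \<in> K"
      then show "K = carrier (fundamental_group (- {0, 1::complex}) (1/2))"
        by (intro circles_generate_twice_punctured_plane) (auto simp: circle0_def circle1_def)
    qed (use circles circle_loops that in \<open>auto simp: lift_loop_def base_def\<close>)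
    then show ?thesis by (simp add: lift_loop_def base_def)
  qed
  have HT: "loop_class X base q \<in> H" if q: "q \<in> loops (U1 \<inter> U2) base" for q
  proof -
    obtain p where p: "p \<in> loops T (1, 1/2)" "loop_class X base q = loop_class X base (chart \<circ> p)"
      using chart_inverse[OF q] by blast
    show ?thesis
      unfolding p(2) loop_class_chart[OF p(1)] by (rule lifts[OF loops_T_components(2)[OF p(1)]])
  qed
  have b: "base \<in> U1 \<inter> U2" unfolding base_def by (rule chart_mem) (simp add: T_def)
  have "H = carrier (fundamental_group (U1 \<union> U2) base)"
  proof (rule loops_generate_union[OF open_U b path_connected_U H[unfolded X_eq]], unfold X_eq[symmetric])
    fix p assume p: "p \<in> loops U1 base"
    obtain g where g: "continuous_on U1 g" "g \<in> U1 \<rightarrow> S1" "\<forall>P\<in>U1. chart1 (g P) = P" "\<forall>p\<in>S1. g (chart1 p) = p"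
      using chart1_inverse by blast
    have "chart1 ` (S1 \<inter> {s. fst s \<noteq> 0}) \<subseteq> U1 \<inter> U2"
      unfolding to_S1_image[symmetric] image_image chart_def[symmetric] chart_image by simp
    moreover have "fst (g base) \<noteq> 0"
    proof -
      have "to_S1 (1, 1/2) \<in> S1" using to_S1_image by (auto simp: T_def)
      then have "g base = to_S1 (1, 1/2)" using g(4) by (simp add: base_def chart_def)
      then show ?thesis by (simp add: to_S1_def)
    qed
    ultimately have "\<exists>q \<in> loops (U1 \<inter> U2) base. loop_class X base p = loop_class X base q"
      using chart1_mem U_subset_X g
      by (intro loop_class_eq_avoiding[OF p open_S(1) continuous_on_chart12(1) _ _ _ g(1)]) auto
    then show "loop_class X base p \<in> H" using HT by auto
  next
    fix p assume p: "p \<in> loops U2 base"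
    obtain g where g: "continuous_on U2 g" "g \<in> U2 \<rightarrow> S2" "\<forall>P\<in>U2. chart2 (g P) = P" "\<forall>p\<in>S2. g (chart2 p) = p"
      using chart2_inverse by blast
    have "chart2 s \<in> U1 \<inter> U2" if "s \<in> S2" "fst s \<noteq> 0" for s
      using that by (cases s) (simp add: S2_def chart2_def U1_def U2_def in_region U_homogeneous zero_prod_def)
    then have "chart2 ` (S2 \<inter> {s. fst s \<noteq> 0}) \<subseteq> U1 \<inter> U2" by auto
    moreover have "fst (g base) \<noteq> 0"
    proof -
      have "base = chart2 (1, 2 - c)" by (simp add: base_def chart_def to_S1_def chart1_def chart2_def)
      moreover have "(1, 2 - c) \<in> S2" by (simp add: S2_def off_conics_def Q_def)
      ultimately show ?thesis using g(4) by simp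
    qed
    ultimately have "\<exists>q \<in> loops (U1 \<inter> U2) base. loop_class X base p = loop_class X base q"
      using chart2_mem U_subset_X g
      by (intro loop_class_eq_avoiding[OF p open_S(2) continuous_on_chart12(2) _ _ _ g(1)]) auto
    then show "loop_class X base p \<in> H" using HT by auto
  qed
  then show ?thesis by (simp add: X_eq)
qed

text \<open>The line \<open>z = 0\<close> is a double fibre of \<open>w\<close>: the disc \<open>(1, 2 - c z\<^sup>2, z)\<close> meets it at the centre,
  and \<open>w = z\<^sup>2 / 2\<close> runs twice around \<open>0\<close> along its boundary.\<close>

theorem circle0_squared:
  "loop_class X base (lift_loop circle0) \<otimes>\<^bsub>fundamental_group X base\<^esub> loop_class X base (lift_loop circle0)
    = \<one>\<^bsub>fundamental_group X base\<^esub>"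
proof -
  define z where "z = circlepath 0 1"
  have z: "path z" "path_image z \<subseteq> cball 0 1" "path_image z \<subseteq> - {0}" "pathstart z = 1" "pathfinish z = 1"
    by (auto simp: z_def sphere_def)
  have nz: "z t \<noteq> 0" for t by (simp add: z_def circlepath)
  have nz1: "(z t)\<^sup>2 \<noteq> 2" for t
  proof
    assume "(z t)\<^sup>2 = 2"
    then have "norm ((z t)\<^sup>2) = 2" by simp
    then show False by (simp add: z_def circlepath norm_power norm_mult)
  qed
  define p where "p = (\<lambda>t. (1 / z t, (z t)\<^sup>2 / 2))"
  have p: "p \<in> loops T (1, 1/2)"
    using z nz nz1 by (auto simp: p_def loops_def T_def path_def path_image_def pathstart_def pathfinish_def
        intro!: continuous_intros)
  have chart_p: "chart (p t) = chart2 (z t, 2 - c * (z t)\<^sup>2)" for t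
  proof -
    have "chart2 (z t, 2 - c * (z t)\<^sup>2) = \<pi> (inverse (z t) * 1, inverse (z t) * (2 - c * (z t)\<^sup>2), inverse (z t) * z t)"
      unfolding chart2_def using nz[of t] by (simp only: prod.case) (subst scale_\<pi>, auto simp: zero_prod_def)
    also have "\<dots> = chart (p t)"
      using nz[of t] unfolding chart_def p_def to_S1_def chart1_def
      by (simp add: field_simps power2_eq_square)
    finally show ?thesis ..
  qed
  have disc: "continuous_on (cball 0 1) (\<lambda>z. chart2 (z, 2 - c * z\<^sup>2))"
    "(\<lambda>z. chart2 (z, 2 - c * z\<^sup>2)) \<in> cball 0 1 \<rightarrow> X"
  proof -
    show "continuous_on (cball 0 1) (\<lambda>z. chart2 (z, 2 - c * z\<^sup>2))"
      by (rule continuous_on_compose2[OF continuous_on_chart12(2)]) (auto intro!: continuous_intros)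
    have "chart2 (z, 2 - c * z\<^sup>2) \<in> X" if "norm z \<le> 1" for z
    proof -
      have "norm (z\<^sup>2) \<le> 1" using that by (simp add: norm_power power_le_one)
      then have "z\<^sup>2 \<noteq> 2" by auto
      then have "(z, 2 - c * z\<^sup>2) \<in> S2" by (auto simp: S2_def off_conics_def Q_def)
      then show ?thesis using chart2_mem U_subset_X by blast
    qed
    then show "(\<lambda>z. chart2 (z, 2 - c * z\<^sup>2)) \<in> cball 0 1 \<rightarrow> X" by auto
  qed
  have "homotopic_paths (cball 0 1) z (\<lambda>_. 1)"
  proof (rule homotopic_paths_linear)
    fix t :: real assume "t \<in> {0..1}"
    then have "z t \<in> cball 0 1" using z(2) unfolding path_image_def by blast
    then show "closed_segment (z t) 1 \<subseteq> cball 0 1" by (intro closed_segment_subset) auto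
  qed (use z in \<open>auto simp: path_const\<close>)
  from homotopic_paths_continuous_image[OF this disc]
  have null: "homotopic_paths X (chart \<circ> p) (\<lambda>_. base)"
    by (simp add: o_def chart_p) (simp add: chart2_def base_def chart_def to_S1_def chart1_def)
  have "snd \<circ> p = circle0 +++ circle0"
  proof
    fix t :: real
    show "(snd \<circ> p) t = (circle0 +++ circle0) t"
      by (auto simp: p_def z_def circle0_def joinpaths_def circlepath power2_eq_square
          exp_add[symmetric] exp_diff algebra_simps)
  qed
  moreover have "lift_loop (circle0 +++ circle0) = lift_loop circle0 +++ lift_loop circle0"
    by (simp add: lift_loop_def path_compose_join)
  ultimately have "loop_class X base (lift_loop circle0 +++ lift_loop circle0) = loop_class X base (chart \<circ> p)"
    using loop_class_chart[OF p] by simp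
  also have "\<dots> = \<one>\<^bsub>fundamental_group X base\<^esub>"
    unfolding one_fundamental_group
    by (rule loop_class_eqI[OF _ null])
      (unfold base_def, rule loops_compose[OF p continuous_on_chart], auto intro: chart_X)
  finally show ?thesis
    using lift_loop_loops[OF circle_loops(1)] by (simp add: fundamental_group_mult)
qed

end

section \<open>A monodromy on the complement\<close>

lemma sign_constant_on_path:
  fixes f :: "real \<Rightarrow> real"
  assumes "continuous_on {0..1} f" "\<And>t. t \<in> {0..1} \<Longrightarrow> f t \<noteq> 0"
  shows "f 0 > 0 \<and> f 1 > 0 \<or> f 0 < 0 \<and> f 1 < 0"
proof (rule ccontr)
  assume not: "\<not> ?thesis"
  have "f 0 \<noteq> 0" "f 1 \<noteq> 0" using assms(2) by auto
  then consider "f 0 < 0" "f 1 > 0" | "f 0 > 0" "f 1 < 0" using not by linarith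
  then show False
  proof cases
    case 1
    then obtain t where "0 \<le> t" "t \<le> 1" "f t = 0" using IVT'[of f 0 0 1] assms(1) by auto
    then show False using assms(2) by auto
  next
    case 2
    then obtain t where "0 \<le> t" "t \<le> 1" "f t = 0" using IVT2'[of f 1 0 0] assms(1) by auto
    then show False using assms(2) by auto
  qed
qed

context bitangent_conics
begin

definition off_Q :: "'a set" where "off_Q = region (\<lambda>v. Q v \<noteq> 0)"
abbreviation cone_Q_x :: "complex \<times> complex \<times> complex \<Rightarrow> bool" where
  "cone_Q_x \<equiv> (\<lambda>(x, y, z). Q (x, y, z) \<noteq> 0 \<and> x \<noteq> 0)"

definition off_Q_x :: "'a set" where "off_Q_x = region cone_Q_x"

lemma off_Q_homogeneous: "homogeneous (\<lambda>v. Q v \<noteq> 0)"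
  and off_Q_x_homogeneous: "homogeneous cone_Q_x"
  by (auto simp: homogeneous_def Q_scale)

lemma off_Q_open_cone: "open {v. v \<noteq> 0 \<and> Q v \<noteq> 0}"
proof -
  have "{v. v \<noteq> 0 \<and> Q v \<noteq> 0} = {v. Q v \<noteq> 0}" by (auto dest: Q_nonzeroD)
  then show ?thesis by (simp add: open_Collect_neq continuous_intros)
qed

lemma off_Q_x_open_cone: "open {v. v \<noteq> 0 \<and> cone_Q_x v}"
proof -
  have "{v. v \<noteq> 0 \<and> cone_Q_x v} = {v. v \<noteq> 0 \<and> Q v \<noteq> 0} \<inter> {v. fst v \<noteq> 0}"
    by auto
  then show ?thesis by (simp only: open_Int off_Q_open_cone open_Collect_neq continuous_intros)
qed

text \<open>The coordinate \<open>w\<close>, and two functions near the line \<open>z = 0\<close> with \<open>w = r\<^sup>2 s\<close>: a square root of \<open>w\<close> is \<open>r\<close>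
  times a square root of \<open>s\<close>, which does not vanish.\<close>

definition w_of :: "'a \<Rightarrow> complex" where "w_of = descend (\<lambda>(x, y, z). z\<^sup>2 / Q (x, y, z))"
definition s_of :: "'a \<Rightarrow> complex" where "s_of = descend (\<lambda>(x, y, z). x\<^sup>2 / Q (x, y, z))"
definition r_of :: "'a \<Rightarrow> complex" where "r_of = descend (\<lambda>(x, y, z). z / x)"

lemma coord_homogeneous: "homogeneous (\<lambda>(x, y, z). z\<^sup>2 / Q (x, y, z))"
  "homogeneous (\<lambda>(x, y, z). x\<^sup>2 / Q (x, y, z))" "homogeneous (\<lambda>(x, y, z). z / x :: complex)"
  by (auto simp: homogeneous_def Q_scale power_mult_distrib)

lemma coord_\<pi>:
  assumes "(x, y, z) \<noteq> 0"
  shows "w_of (\<pi> (x, y, z)) = z\<^sup>2 / Q (x, y, z)" "s_of (\<pi> (x, y, z)) = x\<^sup>2 / Q (x, y, z)"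
    "r_of (\<pi> (x, y, z)) = z / x"
  unfolding w_of_def s_of_def r_of_def by (simp_all add: descend[OF _ assms] coord_homogeneous)

lemma continuous_on_coord: "continuous_on off_Q w_of" "continuous_on off_Q_x s_of" "continuous_on off_Q_x r_of"
  unfolding w_of_def s_of_def r_of_def off_Q_def off_Q_x_def
    by (intro continuous_on_descend off_Q_homogeneous off_Q_x_homogeneous off_Q_open_cone off_Q_x_open_cone coord_homogeneous;
      auto simp: split_def intro!: continuous_intros)+

lemma off_Q_x_cases:
  assumes "P \<in> off_Q_x"
  obtains x y z where "P = \<pi> (x, y, z)" "(x, y, z) \<noteq> 0" "Q (x, y, z) \<noteq> 0" "x \<noteq> 0"
proof -
  obtain v where v: "v \<noteq> 0" "P = \<pi> v" "cone_Q_x v"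
    using assms unfolding off_Q_x_def by (rule regionE)
  show thesis
    by (rule that[of "fst v" "fst (snd v)" "snd (snd v)"]) (use v in \<open>auto simp: split_def\<close>)
qed

lemma off_Q_x_subset: "off_Q_x \<subseteq> off_Q"
  unfolding off_Q_def off_Q_x_def region_def by auto

lemma coord_relations:
  assumes "P \<in> off_Q_x"
  shows "s_of P \<noteq> 0" "w_of P = (r_of P)\<^sup>2 * s_of P"
proof -
  obtain x y z where v: "P = \<pi> (x, y, z)" "(x, y, z) \<noteq> 0" "Q (x, y, z) \<noteq> 0" "x \<noteq> 0"
    using assms by (rule off_Q_x_cases)
  show "s_of P \<noteq> 0" "w_of P = (r_of P)\<^sup>2 * s_of P"
    unfolding v(1) coord_\<pi>[OF v(2)] using v(3,4) by (simp_all add: power_divide)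
qed

text \<open>Two branches of the square root, on the planes slit along the negative and along the positive real
  axis; they cover the punctured plane, which has no global branch.\<close>

definition sqrt_branch :: "bool \<Rightarrow> complex \<Rightarrow> complex"
  where "sqrt_branch \<sigma> s = (if \<sigma> then csqrt s else \<i> * csqrt (- s))"

definition zeta :: "bool \<Rightarrow> 'a \<Rightarrow> complex"
  where "zeta \<sigma> P = r_of P * sqrt_branch \<sigma> (s_of P)"

definition slit :: "bool \<Rightarrow> complex set"
  where "slit \<sigma> = {s. (if \<sigma> then s else - s) \<notin> \<real>\<^sub>\<le>\<^sub>0}"

lemma zeta_squared: "P \<in> off_Q_x \<Longrightarrow> (zeta \<sigma> P)\<^sup>2 = w_of P"
  by (simp add: zeta_def sqrt_branch_def coord_relations(2) power_mult_distrib)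

lemma open_slit: "open (slit \<sigma>)"
proof -
  have "slit \<sigma> = (\<lambda>s. if \<sigma> then s else - s) -` (- \<real>\<^sub>\<le>\<^sub>0)" by (auto simp: slit_def)
  moreover have "open \<dots>" by (rule open_vimage) (cases \<sigma>; simp add: open_Compl continuous_intros)+
  ultimately show ?thesis by simp
qed

lemma continuous_on_sqrt_branch: "continuous_on (slit \<sigma>) (sqrt_branch \<sigma>)"
proof (cases \<sigma>)
  case True
  have "continuous_on (- \<real>\<^sub>\<le>\<^sub>0) csqrt" by (rule continuous_on_csqrt)
  with True show ?thesis by (auto simp: sqrt_branch_def[abs_def] slit_def elim: continuous_on_subset)
next
  case False
  have "continuous_on {s. - s \<notin> \<real>\<^sub>\<le>\<^sub>0} (\<lambda>s. \<i> * csqrt (- s))"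
    by (intro continuous_intros continuous_on_compose2[OF continuous_on_csqrt]) auto
  with False show ?thesis by (simp add: sqrt_branch_def[abs_def] slit_def del: uminus_nonpos_Reals_iff)
qed

lemma sqrt_branch_opposite:
  assumes "Im s \<noteq> 0"
  shows "sqrt_branch False s = (if Im s > 0 then sqrt_branch True s else - sqrt_branch True s)"
proof -
  have sq: "(sqrt_branch False s)\<^sup>2 = (sqrt_branch True s)\<^sup>2" by (simp add: sqrt_branch_def power_mult_distrib)
  have Re_pos: "Re (csqrt a) > 0" if "Im a \<noteq> 0" for a
  proof -
    have "Im a = 2 * Re (csqrt a) * Im (csqrt a)" by (metis Im_power2 power2_csqrt)
    then show ?thesis using that csqrt_principal[of a] by auto
  qed
  have im: "Im s = 2 * Re (csqrt s) * Im (csqrt s)" by (metis Im_power2 power2_csqrt)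
  have opp: "Im (sqrt_branch False s) > 0" using Re_pos[of "- s"] assms by (simp add: sqrt_branch_def)
  from sq consider "sqrt_branch False s = sqrt_branch True s" | "sqrt_branch False s = - sqrt_branch True s"
    unfolding power2_eq_iff by blast
  then show ?thesis
  proof cases
    case 1
    then have "Im (csqrt s) > 0" using opp by (simp add: sqrt_branch_def)
    then have "Im s > 0" unfolding im using Re_pos[OF assms] by simp
    with 1 show ?thesis by simp
  next
    case 2
    then have "Im (csqrt s) < 0" using opp by (simp add: sqrt_branch_def)
    then have "Im s < 0" unfolding im using Re_pos[OF assms] by (simp add: mult_pos_neg)
    with 2 show ?thesis by simp
  qed
qed

end

datatype patch = Middle | Left | Right | Near bool

text \<open>Given \<open>\<tau>\<close> and \<open>\<beta>\<close> with \<open>\<tau>\<^sup>2 = 1\<close>, the following labels have monodromy \<open>\<tau>\<close> around \<open>w = 0\<close> and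
  \<open>\<beta>\<close> around \<open>w = 1\<close>.  On the patches that are given by the slit \<open>w\<close>-plane the label changes
  across the negative axis and across the real axis beyond \<open>1\<close>; on the patches around \<open>z = 0\<close>,
  where \<open>w\<close> is a square, it changes across the imaginary axis of \<open>zeta\<close>.\<close>

locale bitangent_labels = bitangent_conics \<pi> c + group G
  for \<pi> :: "complex \<times> complex \<times> complex \<Rightarrow> 'a::topological_space" and c :: complex and G (structure) +
  fixes \<tau> \<beta>
  assumes \<tau>: "\<tau> \<in> carrier G" "\<tau> \<otimes> \<tau> = \<one>" and \<beta>: "\<beta> \<in> carrier G"
begin

fun patch_set :: "patch \<Rightarrow> 'a set" where
  "patch_set Middle = {P \<in> off_Q. w_of P \<notin> \<real>\<^sub>\<le>\<^sub>0 \<and> 1 - w_of P \<notin> \<real>\<^sub>\<le>\<^sub>0}"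
| "patch_set Left = {P \<in> off_Q. - w_of P \<notin> \<real>\<^sub>\<le>\<^sub>0}"
| "patch_set Right = {P \<in> off_Q. w_of P - 1 \<notin> \<real>\<^sub>\<le>\<^sub>0}"
| "patch_set (Near \<sigma>) = {P \<in> off_Q_x. norm (w_of P) < 1 \<and> s_of P \<in> slit \<sigma>}"

definition side where "side \<zeta> = (if Re \<zeta> > 0 \<or> Re \<zeta> = 0 \<and> Im \<zeta> > 0 then \<one> else \<tau>)"

text \<open>On the line \<open>z = 0\<close> itself \<open>zeta\<close> vanishes and does not tell the two sheets of its sign apart;
  there the label of the second patch is made to fit that of the first.\<close>

fun label where
  "label Middle P = \<one>"
| "label Left P = (if Im (w_of P) \<ge> 0 then \<one> else \<tau>)"
| "label Right P = (if Im (w_of P) \<ge> 0 then \<one> else inv \<beta>)"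
| "label (Near \<sigma>) P = (if \<not> \<sigma> \<and> w_of P = 0 \<and> Im (s_of P) < 0 then \<one> else side (zeta \<sigma> P))"

lemma label_in_carrier: "label i P \<in> carrier G"
  using \<tau> \<beta> by (cases i) (auto simp: side_def)

lemma open_patch: "open (patch_set i)"
proof -
  have open_off_Q: "open {P \<in> off_Q. w_of P \<in> D}" if "open D" for D
  proof -
    have "{P \<in> off_Q. w_of P \<in> D} = w_of -` D \<inter> off_Q" by auto
    then show ?thesis
      using continuous_on_coord(1) that open_region[OF off_Q_homogeneous off_Q_open_cone]
      by (simp add: continuous_on_open_vimage off_Q_def)
  qed
  have open_off_Q_x: "open {P \<in> off_Q_x. s_of P \<in> D}" if "open D" for D
  proof -
    have "{P \<in> off_Q_x. s_of P \<in> D} = s_of -` D \<inter> off_Q_x" by auto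
    then show ?thesis
      using continuous_on_coord(2) that open_region[OF off_Q_x_homogeneous off_Q_x_open_cone]
      by (simp add: continuous_on_open_vimage off_Q_x_def)
  qed
  have slits: "open {w. f w \<notin> \<real>\<^sub>\<le>\<^sub>0}" if "continuous_on UNIV f" for f :: "complex \<Rightarrow> complex"
  proof -
    have "{w. f w \<notin> \<real>\<^sub>\<le>\<^sub>0} = f -` (- \<real>\<^sub>\<le>\<^sub>0)" by auto
    then show ?thesis using that by (auto intro!: open_vimage simp: open_Compl)
  qed
  show ?thesis
  proof (cases i)
    case Middle
    have "patch_set i = {P \<in> off_Q. w_of P \<in> {w. w \<notin> \<real>\<^sub>\<le>\<^sub>0} \<inter> {w. 1 - w \<notin> \<real>\<^sub>\<le>\<^sub>0}}" by (auto simp: Middle)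
    moreover have "open \<dots>" by (intro open_off_Q open_Int slits continuous_intros)
    ultimately show ?thesis by (simp only:)
  next
    case Left
    have "patch_set i = {P \<in> off_Q. w_of P \<in> {w. - w \<notin> \<real>\<^sub>\<le>\<^sub>0}}" by (auto simp: Left)
    moreover have "open \<dots>" by (intro open_off_Q slits continuous_intros)
    ultimately show ?thesis by (simp only:)
  next
    case Right
    have "patch_set i = {P \<in> off_Q. w_of P \<in> {w. w - 1 \<notin> \<real>\<^sub>\<le>\<^sub>0}}" by (auto simp: Right)
    moreover have "open \<dots>" by (intro open_off_Q slits continuous_intros)
    ultimately show ?thesis by (simp only:)
  next
    case (Near \<sigma>)
    have "patch_set i = {P \<in> off_Q. w_of P \<in> ball 0 1} \<inter> {P \<in> off_Q_x. s_of P \<in> slit \<sigma>}"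
      using off_Q_x_subset by (auto simp: Near)
    moreover have "open \<dots>" by (intro open_off_Q open_off_Q_x open_Int open_slit open_ball)
    ultimately show ?thesis by (simp only:)
  qed
qed

lemma patches_cover:
  assumes "P \<in> X"
  shows "\<exists>i. P \<in> patch_set i"
proof -
  obtain v where "v \<noteq> 0" "P = \<pi> v" "off_conics v" using assms by (rule regionE)
  moreover obtain x y z where "v = (x, y, z)" by (cases v)
  ultimately have v: "P = \<pi> (x, y, z)" "(x, y, z) \<noteq> 0" "off_conics (x, y, z)" by simp_all
  have Q: "Q (x, y, z) \<noteq> 0" "Q (x, y, z) \<noteq> z\<^sup>2" using v(3) by (simp_all add: off_conics_def)
  have PA: "P \<in> off_Q" unfolding v(1) off_Q_def using in_region[OF off_Q_homogeneous v(2)] Q by simp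
  show ?thesis
  proof (cases "z = 0")
    case True
    then have "x \<noteq> 0" using Q by (auto simp: Q_def)
    then have PB: "P \<in> off_Q_x" unfolding v(1) off_Q_x_def using in_region[OF off_Q_x_homogeneous v(2)] Q by simp
    have "w_of P = 0" unfolding v(1) coord_\<pi>[OF v(2)] using True by simp
    moreover have "s_of P \<in> slit True \<or> s_of P \<in> slit False"
      using coord_relations(1)[OF PB] by (auto simp: slit_def complex_nonpos_Reals_iff complex_eq_iff)
    ultimately have "P \<in> patch_set (Near True) \<or> P \<in> patch_set (Near False)"
      using PB by auto
    then show ?thesis by blast
  next
    case False
    have "w_of P \<noteq> 0" "w_of P \<noteq> 1" unfolding v(1) coord_\<pi>[OF v(2)] using False Q by auto
    then have "P \<in> patch_set Middle \<or> P \<in> patch_set Left \<or> P \<in> patch_set Right"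
      using PA by (auto simp: complex_nonpos_Reals_iff complex_eq_iff)
    then show ?thesis by blast
  qed
qed

text \<open>A common left factor at both ends cancels in the increment.\<close>

lemma same_increment:
  assumes "label j P = g \<otimes> label i P" "label j R = g \<otimes> label i R" "g \<in> carrier G"
  shows "inv label i P \<otimes> label i R = inv label j P \<otimes> label j R"
proof -
  have closed: "label i P \<in> carrier G" "label i R \<in> carrier G" by (rule label_in_carrier)+
  have "inv g \<otimes> (g \<otimes> label i R) = label i R"
    using assms(3) closed(2) by (simp only: m_assoc[symmetric] inv_closed l_inv l_one)
  then show ?thesis
    unfolding assms(1,2) using assms(3) closed by (simp only: inv_mult_group m_assoc inv_closed m_closed)
qed

definition agree where
  "agree i j \<longleftrightarrow> (\<forall>p. path p \<longrightarrow> path_image p \<subseteq> patch_set i \<inter> patch_set j \<longrightarrow>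
    inv label i (pathstart p) \<otimes> label i (pathfinish p) = inv label j (pathstart p) \<otimes> label j (pathfinish p))"

lemma agree_sym: "agree i j \<Longrightarrow> agree j i"
  unfolding agree_def by (auto simp: Int_commute)

lemma sign_along_path:
  assumes "path p" "path_image p \<subseteq> M" "continuous_on M f" "\<And>P. P \<in> M \<Longrightarrow> (f P :: real) \<noteq> 0"
  shows "f (pathstart p) > 0 \<and> f (pathfinish p) > 0 \<or> f (pathstart p) < 0 \<and> f (pathfinish p) < 0"
proof -
  have "continuous_on {0..1} (\<lambda>t. f (p t))"
    using assms(1,2) by (intro continuous_on_compose2[OF assms(3)]) (auto simp: path_def path_image_def)
  from sign_constant_on_path[OF this] show ?thesis
    using assms(2,4) unfolding pathstart_def pathfinish_def path_image_def by blast
qed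

lemma continuous_on_zeta: "continuous_on (patch_set (Near \<sigma>)) (zeta \<sigma>)"
  unfolding zeta_def
  by (intro continuous_intros continuous_on_compose2[OF continuous_on_sqrt_branch] continuous_on_subset[OF continuous_on_coord(2)]
      continuous_on_subset[OF continuous_on_coord(3)]) auto

text \<open>On the common part of two of these patches \<open>w\<close> is not real, and each label depends only on
  whether \<open>w\<close> lies above or below the real axis.\<close>

lemma agree_plane:
  assumes "i \<in> {Middle, Left, Right}" "j \<in> {Middle, Left, Right}" "i \<noteq> j"
  shows "agree i j"
  unfolding agree_def
proof (intro allI impI)
  fix p assume p: "path p" "path_image p \<subseteq> patch_set i \<inter> patch_set j"
  have "patch_set i \<inter> patch_set j \<subseteq> off_Q" using assms(1) by auto
  then have cont: "continuous_on (patch_set i \<inter> patch_set j) (\<lambda>P. Im (w_of P))"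
    by (intro continuous_intros continuous_on_subset[OF continuous_on_coord(1)])
  have nonreal: "Im (w_of P) \<noteq> 0" if "P \<in> patch_set i \<inter> patch_set j" for P
    using that assms by (auto simp: complex_nonpos_Reals_iff)
  let ?P = "pathstart p" and ?R = "pathfinish p"
  have "Im (w_of ?P) > 0 \<and> Im (w_of ?R) > 0 \<or> Im (w_of ?P) < 0 \<and> Im (w_of ?R) < 0"
    by (rule sign_along_path[OF p cont nonreal])
  then have "label k ?P = label k ?R" if "k \<in> {Middle, Left, Right}" for k
    using that by auto
  then show "inv label i ?P \<otimes> label i ?R = inv label j ?P \<otimes> label j ?R"
    using assms(1,2) label_in_carrier by simp
qed

text \<open>On the common part with \<open>Middle\<close>, \<open>Left\<close> and \<open>Right\<close>, the root \<open>zeta\<close> stays off the imaginary axis, off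
  the real axis and off both axes, respectively.  Between the quadrants that remain connected the labels of
  both patches change in the same way; for \<open>Left\<close> in the lower half-plane of \<open>zeta\<close> this uses \<open>\<tau>\<^sup>2 = 1\<close>.\<close>

lemma agree_near_plane:
  assumes "j \<in> {Middle, Left, Right}"
  shows "agree (Near \<sigma>) j"
  unfolding agree_def
proof (intro allI impI)
  fix p assume p: "path p" "path_image p \<subseteq> patch_set (Near \<sigma>) \<inter> patch_set j"
  let ?M = "patch_set (Near \<sigma>) \<inter> patch_set j" and ?P = "pathstart p" and ?R = "pathfinish p"
  have ends: "?P \<in> ?M" "?R \<in> ?M" using p(2) by auto
  have Re_cont: "continuous_on ?M (\<lambda>P. Re (zeta \<sigma> P))" and Im_cont: "continuous_on ?M (\<lambda>P. Im (zeta \<sigma> P))"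
    by (intro continuous_intros continuous_on_subset[OF continuous_on_zeta]; auto)+
  have w: "w_of P = (zeta \<sigma> P)\<^sup>2" if "P \<in> ?M" for P using that zeta_squared by simp
  have re: "Re (w_of P) = (Re (zeta \<sigma> P))\<^sup>2 - (Im (zeta \<sigma> P))\<^sup>2"
    and im: "Im (w_of P) = 2 * Re (zeta \<sigma> P) * Im (zeta \<sigma> P)" if "P \<in> ?M" for P
    unfolding w[OF that] by (simp_all add: Re_power2 Im_power2)
  have nonzero: "w_of P \<noteq> 0" if "P \<in> ?M" for P
    using that assms by (auto simp: complex_nonpos_Reals_iff)
  have label_near: "label (Near \<sigma>) P = side (zeta \<sigma> P)" if "P \<in> ?M" for P
    using nonzero[OF that] by simp
  have small: "\<bar>Re (w_of P)\<bar> < 1" if "P \<in> ?M" for P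
    using that abs_Re_le_cmod[of "w_of P"] by simp
  consider "j = Middle" | "j = Left" | "j = Right" using assms by blast
  then show "inv label (Near \<sigma>) ?P \<otimes> label (Near \<sigma>) ?R = inv label j ?P \<otimes> label j ?R"
  proof cases
    case 1
    have "Re (zeta \<sigma> P) \<noteq> 0" if "P \<in> ?M" for P
      using re[OF that] im[OF that] that by (auto simp: 1 complex_nonpos_Reals_iff)
    from sign_along_path[OF p Re_cont this] have "side (zeta \<sigma> ?P) = side (zeta \<sigma> ?R)"
      by (auto simp: side_def)
    then have "label (Near \<sigma>) ?P = label (Near \<sigma>) ?R" using label_near ends by simp
    then show ?thesis using label_in_carrier[of "Near \<sigma>"] by (simp add: 1)
  next
    case 2
    have nz: "Im (zeta \<sigma> P) \<noteq> 0" if "P \<in> ?M" for P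
      using re[OF that] im[OF that] that by (auto simp: 2 complex_nonpos_Reals_iff)
    have up: "label (Near \<sigma>) P = \<one> \<otimes> label Left P" if "P \<in> ?M" "Im (zeta \<sigma> P) > 0" for P
      using \<tau> that(2) im[OF that(1)] label_near[OF that(1)] by (auto simp: side_def zero_le_mult_iff)
    have down: "label (Near \<sigma>) P = \<tau> \<otimes> label Left P" if "P \<in> ?M" "Im (zeta \<sigma> P) < 0" for P
      using \<tau> that(2) im[OF that(1)] label_near[OF that(1)] by (auto simp: side_def zero_le_mult_iff)
    from sign_along_path[OF p Im_cont nz] show ?thesis
      unfolding 2 using same_increment[OF up up] same_increment[OF down down] ends \<tau>
      by (metis "2" one_closed)
  next
    case 3
    have nonreal: "Re (zeta \<sigma> P) \<noteq> 0" if "P \<in> ?M" for P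
      using small[OF that] im[OF that] that by (auto simp: 3 complex_nonpos_Reals_iff)
    have nonreal': "Im (zeta \<sigma> P) \<noteq> 0" if "P \<in> ?M" for P
      using small[OF that] im[OF that] that by (auto simp: 3 complex_nonpos_Reals_iff)
    note signs = sign_along_path[OF p Re_cont nonreal] sign_along_path[OF p Im_cont nonreal']
    have "side (zeta \<sigma> ?P) = side (zeta \<sigma> ?R)" using signs(1) by (auto simp: side_def)
    then have "label (Near \<sigma>) ?P = label (Near \<sigma>) ?R" using label_near ends by simp
    moreover have "label Right ?P = label Right ?R"
      using signs im[OF ends(1)] im[OF ends(2)] by (auto simp: zero_le_mult_iff)
    ultimately show ?thesis
      unfolding 3 by (simp only: l_inv[OF label_in_carrier])
  qed
qed

text \<open>The two roots \<open>zeta\<close> agree over one half of the common part and are opposite over the other; there the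
  labels differ by the factor \<open>\<tau>\<close>.\<close>

lemma agree_near: "agree (Near True) (Near False)"
  unfolding agree_def
proof (intro allI impI)
  fix p assume p: "path p" "path_image p \<subseteq> patch_set (Near True) \<inter> patch_set (Near False)"
  let ?M = "patch_set (Near True) \<inter> patch_set (Near False)" and ?P = "pathstart p" and ?R = "pathfinish p"
  have ends: "?P \<in> ?M" "?R \<in> ?M" using p(2) by auto
  have cont: "continuous_on ?M (\<lambda>P. Im (s_of P))"
    by (intro continuous_intros continuous_on_subset[OF continuous_on_coord(2)]) auto
  have nonreal: "Im (s_of P) \<noteq> 0" if "P \<in> ?M" for P
    using that by (auto simp: slit_def complex_nonpos_Reals_iff)
  have zero: "w_of P = 0 \<longleftrightarrow> zeta True P = 0" if "P \<in> ?M" for P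
    using zeta_squared[of P True] that by auto
  have up: "label (Near False) P = \<one> \<otimes> label (Near True) P" if "P \<in> ?M" "Im (s_of P) > 0" for P
    using \<tau> that(2) sqrt_branch_opposite[OF nonreal[OF that(1)]] by (simp add: zeta_def side_def)
  have down: "label (Near False) P = \<tau> \<otimes> label (Near True) P" if "P \<in> ?M" "Im (s_of P) < 0" for P
  proof -
    have z: "zeta False P = - zeta True P"
      using that(2) sqrt_branch_opposite[OF nonreal[OF that(1)]] by (simp add: zeta_def)
    show ?thesis
    proof (cases "zeta True P = 0")
      case True
      then show ?thesis using \<tau> that zero[OF that(1)] by (simp add: side_def)
    next
      case False
      then show ?thesis using \<tau> zero[OF that(1)] by (auto simp: side_def z complex_eq_iff)
    qed
  qed
  from sign_along_path[OF p cont nonreal]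
  show "inv label (Near True) ?P \<otimes> label (Near True) ?R = inv label (Near False) ?P \<otimes> label (Near False) ?R"
    using same_increment[OF up up] same_increment[OF down down] ends \<tau> by (metis one_closed)
qed

lemma agree: "agree i j"
proof -
  have refl: "agree i i" for i by (simp add: agree_def)
  consider "i \<in> {Middle, Left, Right}" | \<sigma> where "i = Near \<sigma>" by (cases i) auto
  then show ?thesis
  proof cases
    case 1
    then show ?thesis
      using agree_plane[of i j] agree_near_plane[of i] refl agree_sym by (cases j; cases "i = j") auto
  next
    case (2 \<sigma>)
    show ?thesis
    proof (cases j)
      case (Near \<sigma>')
      then show ?thesis using 2 agree_near agree_sym[OF agree_near] refl by (cases \<sigma>; cases \<sigma>') auto
    qed (use 2 agree_near_plane in auto)
  qed
qed

sublocale monodromy: labelled_cover G X UNIV patch_set label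
proof
  fix i j p assume "path p" "path_image p \<subseteq> patch_set i \<inter> patch_set j"
  then show "inv label i (pathstart p) \<otimes> label i (pathfinish p) = inv label j (pathstart p) \<otimes> label j (pathfinish p)"
    using agree[of i j] unfolding agree_def by blast
qed (auto simp: open_patch patches_cover label_in_carrier)

text \<open>The circles around the punctures are followed by thirds: the outer two stay off the negative axis
  of the circle, the middle one stays off the positive axis.\<close>

lemma unit_circle_facts:
  defines "e \<equiv> \<lambda>t::real. exp (2 * of_real pi * \<i> * of_real t)"
  shows "t \<in> {0..1/3} \<union> {2/3..1} \<Longrightarrow> e t \<notin> \<real>\<^sub>\<le>\<^sub>0" "t \<in> {1/3..2/3} \<Longrightarrow> Re (e t) < 0"
    "Im (e (1/3)) > 0" "Im (e (2/3)) < 0"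
proof -
  have e: "Re (e t) = cos (2 * pi * t)" "Im (e t) = sin (2 * pi * t)" for t
    by (simp_all add: e_def Re_exp Im_exp)
  show "t \<in> {1/3..2/3} \<Longrightarrow> Re (e t) < 0"
  proof -
    assume "t \<in> {1/3..2/3}"
    then have "0 < cos (2 * pi * t - pi)"
      by (intro cos_gt_zero_pi) (auto simp: field_simps)
    then show ?thesis by (simp add: e)
  qed
  have pos: "sin (2 * pi * t) > 0" if "0 < t" "t < 1/2" for t
    using that by (intro sin_gt_zero) (auto simp: field_simps)
  have neg: "sin (2 * pi * t) < 0" if "1/2 < t" "t < 1" for t
  proof -
    have "sin (2 * pi * (1 - t)) > 0" using that by (intro pos) auto
    moreover have "2 * pi * (1 - t) = 2 * pi - 2 * pi * t" by (simp add: algebra_simps)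
    ultimately show ?thesis by (simp add: sin_diff)
  qed
  show "Im (e (1/3)) > 0" "Im (e (2/3)) < 0" using pos[of "1/3"] neg[of "2/3"] by (simp_all add: e)
  assume t: "t \<in> {0..1/3} \<union> {2/3..1}"
  show "e t \<notin> \<real>\<^sub>\<le>\<^sub>0"
  proof (cases "t = 0 \<or> t = 1")
    case True
    then show ?thesis by (auto simp: complex_nonpos_Reals_iff e)
  next
    case False
    then have "sin (2 * pi * t) \<noteq> 0" using t pos[of t] neg[of t] by force
    then show ?thesis by (simp add: complex_nonpos_Reals_iff e)
  qed
qed

lemma w_of_chart:
  assumes "w \<in> - {0, 1}"
  shows "chart (1, w) \<in> off_Q" "w_of (chart (1, w)) = w"
proof -
  have eq: "chart (1, w) = \<pi> (1, 1 / w - c, 1)" by (simp add: chart_def to_S1_def chart1_def)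
  have nz: "(1 :: complex, 1 / w - c, 1 :: complex) \<noteq> 0" by (simp add: zero_prod_def)
  have "Q (1, 1 / w - c, 1) = 1 / w" by (simp add: Q_def)
  then show "chart (1, w) \<in> off_Q" "w_of (chart (1, w)) = w"
    unfolding eq using assms by (simp_all add: off_Q_def in_region[OF off_Q_homogeneous nz] coord_\<pi>[OF nz])
qed

lemma monodromy_circles:
  "monodromy.monodromy (lift_loop circle0) = \<tau>" "monodromy.monodromy (lift_loop circle1) = \<beta>"
proof -
  have half: "a \<in> - {0, 1}" if "a = circle0 t \<or> a = circle1 t" "t \<in> {0..1}" for a t
    using circle_loops that unfolding loops_def path_image_def by blast
  have lifted: "lift_loop circle0 t \<in> off_Q" "w_of (lift_loop circle0 t) = circle0 t"
      "lift_loop circle1 t \<in> off_Q" "w_of (lift_loop circle1 t) = circle1 t" if "t \<in> {0..1}" for t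
    using w_of_chart half that by (auto simp: lift_loop_def)
  let ?e = "\<lambda>t::real. exp (2 * of_real pi * \<i> * of_real t)"
  have circles: "circle0 t = (1/2) *\<^sub>R ?e t" "circle1 t = 1 - (1/2) *\<^sub>R ?e t" for t
    by (simp_all add: circle0_def circle1_def circlepath scaleR_conv_of_real)
  have scaled: "(1/2) *\<^sub>R a \<in> \<real>\<^sub>\<le>\<^sub>0 \<longleftrightarrow> a \<in> \<real>\<^sub>\<le>\<^sub>0" "(1/2) *\<^sub>R a \<in> \<real>\<^sub>\<ge>\<^sub>0 \<longleftrightarrow> a \<in> \<real>\<^sub>\<ge>\<^sub>0" for a :: complex
    by (auto simp: complex_nonpos_Reals_iff complex_nonneg_Reals_iff)
  have Re_e: "Re (?e t) \<le> 1" for t by (rule order_trans[OF complex_Re_le_cmod]) simp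
  have slit: "1 - (1/2) *\<^sub>R ?e t \<notin> \<real>\<^sub>\<le>\<^sub>0" for t
    using Re_e[of t] by (auto simp: complex_nonpos_Reals_iff)
  have Middle: "lift_loop circle0 t \<in> patch_set Middle" "lift_loop circle1 t \<in> patch_set Middle"
    if "t \<in> {0..1/3} \<union> {2/3..1}" for t
  proof -
    have "t \<in> {0..1}" using that by auto
    then show "lift_loop circle0 t \<in> patch_set Middle" "lift_loop circle1 t \<in> patch_set Middle"
      using slit[of t] unit_circle_facts(1)[OF that] by (simp_all add: lifted circles scaled)
  qed
  have cross: "lift_loop circle0 t \<in> patch_set Left" "lift_loop circle1 t \<in> patch_set Right"
    if "t \<in> {1/3..2/3}" for t
  proof -
    have "t \<in> {0..1}" using that by auto
    moreover have "- ?e t \<notin> \<real>\<^sub>\<le>\<^sub>0"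
      using unit_circle_facts(2)[OF that] by (simp add: complex_nonpos_Reals_iff)
    ultimately show "lift_loop circle0 t \<in> patch_set Left" "lift_loop circle1 t \<in> patch_set Right"
      by (simp_all add: lifted circles scaled)
  qed
  have inc: "monodromy.increment q 0 1 ((inv label Middle (q 0) \<otimes> label Middle (q (1/3)))
      \<otimes> (inv label i (q (1/3)) \<otimes> label i (q (2/3))) \<otimes> (inv label Middle (q (2/3)) \<otimes> label Middle (q 1)))"
    if "q ` {0..1/3} \<subseteq> patch_set Middle" "q ` {1/3..2/3} \<subseteq> patch_set i" "q ` {2/3..1} \<subseteq> patch_set Middle" for q i
    by (rule monodromy.increment.concat[where b = "2/3"], rule monodromy.increment.concat[where b = "1/3"];
      rule monodromy.increment.within[OF UNIV_I]) (use that in simp_all)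
  have third: "(1/3::real) \<in> {0..1}" "(2/3::real) \<in> {0..1}" by auto
  have sin: "Im (circle0 (1/3)) > 0" "Im (circle0 (2/3)) < 0" "Im (circle1 (1/3)) < 0" "Im (circle1 (2/3)) > 0"
    using unit_circle_facts(3,4) by (simp_all add: circles)
  have paths: "path (lift_loop circle0)" "path (lift_loop circle1)"
    using lift_loop_loops circle_loops by (auto simp: loops_def)
  show "monodromy.monodromy (lift_loop circle0) = \<tau>"
  proof (rule monodromy.monodromy_eqI[OF paths(1)])
    show "monodromy.increment (lift_loop circle0) 0 1 \<tau>"
      using inc[of "lift_loop circle0" Left, OF image_subsetI image_subsetI image_subsetI, OF Middle(1) cross(1) Middle(1)]
        sin \<tau> by (simp add: lifted third)
  qed
  show "monodromy.monodromy (lift_loop circle1) = \<beta>"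
  proof (rule monodromy.monodromy_eqI[OF paths(2)])
    show "monodromy.increment (lift_loop circle1) 0 1 \<beta>"
      using inc[of "lift_loop circle1" Right, OF image_subsetI image_subsetI image_subsetI, OF Middle(2) cross(2) Middle(2)]
        sin \<beta> by (simp add: lifted third)
  qed
qed

end

section \<open>Change of base point\<close>

lemma homotopic_paths_conjugate_back:
  assumes \<delta>: "path \<delta>" "path_image \<delta> \<subseteq> X" and p: "path p" "path_image p \<subseteq> X"
    "pathstart p = pathfinish \<delta>" "pathfinish p = pathfinish \<delta>"
  shows "homotopic_paths X (reversepath \<delta> +++ ((\<delta> +++ (p +++ reversepath \<delta>)) +++ \<delta>)) p"
proof -
  let ?h = "homotopic_paths X"
  note [simp] = \<delta> p path_image_join
  have "?h ((\<delta> +++ (p +++ reversepath \<delta>)) +++ \<delta>) (\<delta> +++ ((p +++ reversepath \<delta>) +++ \<delta>))"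
    by (rule homotopic_paths_sym, rule homotopic_paths_assoc) simp_all
  also have "?h \<dots> (\<delta> +++ (p +++ (reversepath \<delta> +++ \<delta>)))"
    by (rule homotopic_paths_join, simp, rule homotopic_paths_sym, rule homotopic_paths_assoc) simp_all
  also have "?h \<dots> (\<delta> +++ (p +++ (\<lambda>_. pathfinish \<delta>)))"
    by (rule homotopic_paths_join, simp, rule homotopic_paths_join, simp, rule homotopic_paths_inverse_left)
      simp_all
  also have "?h \<dots> (\<delta> +++ p)"
    by (rule homotopic_paths_join, simp, rule homotopic_paths_const_right) simp_all
  finally have "?h (reversepath \<delta> +++ ((\<delta> +++ (p +++ reversepath \<delta>)) +++ \<delta>)) (reversepath \<delta> +++ (\<delta> +++ p))"
    by (intro homotopic_paths_join[of X "reversepath \<delta>" "reversepath \<delta>"]) simp_all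
  also have "?h \<dots> ((reversepath \<delta> +++ \<delta>) +++ p)"
    by (rule homotopic_paths_assoc) simp_all
  also have "?h \<dots> ((\<lambda>_. pathfinish \<delta>) +++ p)"
    by (rule homotopic_paths_join, rule homotopic_paths_inverse_left) simp_all
  also have "?h \<dots> p"
    by (rule homotopic_paths_const_left) simp_all
  finally show ?thesis .
qed

theorem fundamental_group_change_base:
  fixes X :: "'a::topological_space set"
  assumes "path_connected X" "a \<in> X" "b \<in> X"
  shows "fundamental_group X b \<cong> fundamental_group X a"
proof -
  obtain \<delta> where \<delta>: "path \<delta>" "path_image \<delta> \<subseteq> X" "pathstart \<delta> = a" "pathfinish \<delta> = b"
    using assms unfolding path_connected_def by blast
  let ?c = "\<lambda>p. \<delta> +++ (p +++ reversepath \<delta>)"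
  let ?A = "fundamental_group X a" and ?B = "fundamental_group X b"
  have c_loops: "?c p \<in> loops X a" if "p \<in> loops X b" for p
    using that \<delta> by (intro loops_conjugate) (auto simp: loops_def)
  have unwind: "homotopic_paths X (reversepath \<delta> +++ (?c p +++ \<delta>)) p" if "p \<in> loops X b" for p
    using that \<delta> by (intro homotopic_paths_conjugate_back) (auto simp: loops_def)
  have c_iff: "homotopic_paths X (?c p) (?c q) \<longleftrightarrow> homotopic_paths X p q"
    if pq: "p \<in> loops X b" "q \<in> loops X b" for p q
  proof
    assume "homotopic_paths X (?c p) (?c q)"
    then have "homotopic_paths X (reversepath \<delta> +++ (?c p +++ \<delta>)) (reversepath \<delta> +++ (?c q +++ \<delta>))"
      using \<delta> pq
      by (intro homotopic_paths_join[of X "reversepath \<delta>" "reversepath \<delta>"] homotopic_paths_join[of X _ _ \<delta> \<delta>])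
        (auto simp: loops_def)
    then show "homotopic_paths X p q"
      using unwind[OF pq(1)] unwind[OF pq(2)] by (blast intro: homotopic_paths_trans homotopic_paths_sym)
  next
    assume "homotopic_paths X p q"
    then show "homotopic_paths X (?c p) (?c q)"
      using \<delta> pq
      by (intro homotopic_paths_join[of X \<delta> \<delta>] homotopic_paths_join[of X _ _ "reversepath \<delta>" "reversepath \<delta>"])
        (auto simp: loops_def)
  qed
  define f where "f \<alpha> = loop_class X a (?c (SOME p. p \<in> loops X b \<and> \<alpha> = loop_class X b p))" for \<alpha>
  have f: "f (loop_class X b p) = loop_class X a (?c p)" if p: "p \<in> loops X b" for p
  proof -
    define q where "q = (SOME q. q \<in> loops X b \<and> loop_class X b p = loop_class X b q)"
    have q: "q \<in> loops X b" "loop_class X b p = loop_class X b q"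
      using someI[of "\<lambda>q. q \<in> loops X b \<and> loop_class X b p = loop_class X b q" p] p unfolding q_def by blast+
    then have "homotopic_paths X (?c p) (?c q)" using c_iff[OF p q(1)] loop_class_eqD by blast
    then show ?thesis unfolding f_def q_def[symmetric] using loop_class_eqI[OF c_loops[OF p]] by simp
  qed
  have hom: "f \<in> hom ?B ?A"
  proof (rule homI)
    fix \<alpha> \<beta> assume "\<alpha> \<in> carrier ?B" "\<beta> \<in> carrier ?B"
    then obtain p q where p: "p \<in> loops X b" "\<alpha> = loop_class X b p" and q: "q \<in> loops X b" "\<beta> = loop_class X b q"
      by (auto simp: in_carrier_fundamental_group)
    show "f \<alpha> \<in> carrier ?A" using f[OF p(1)] c_loops[OF p(1)] p(2) loop_class_in_carrier by metis
    have "homotopic_paths X (?c p +++ ?c q) (?c (p +++ q))"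
      using \<delta> p(1) q(1) by (intro loop_class_conjugate_join) (auto simp: loops_def)
    then have "loop_class X a (?c p +++ ?c q) = loop_class X a (?c (p +++ q))"
      by (intro loop_class_eqI loops_join c_loops p(1) q(1))
    then show "f (\<alpha> \<otimes>\<^bsub>?B\<^esub> \<beta>) = f \<alpha> \<otimes>\<^bsub>?A\<^esub> f \<beta>"
      unfolding p(2) q(2) f[OF p(1)] f[OF q(1)] fundamental_group_mult[OF p(1) q(1)]
        fundamental_group_mult[OF c_loops[OF p(1)] c_loops[OF q(1)]] f[OF loops_join[OF p(1) q(1)]]
      by simp
  qed
  have "bij_betw f (carrier ?B) (carrier ?A)"
  proof (rule bij_betw_imageI)
    show "inj_on f (carrier ?B)"
    proof (rule inj_onI)
      fix \<alpha> \<beta> assume "\<alpha> \<in> carrier ?B" "\<beta> \<in> carrier ?B" and eq: "f \<alpha> = f \<beta>"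
      then obtain p q where p: "p \<in> loops X b" "\<alpha> = loop_class X b p" and q: "q \<in> loops X b" "\<beta> = loop_class X b q"
        by (auto simp: in_carrier_fundamental_group)
      have "homotopic_paths X (?c p) (?c q)"
        using eq loop_class_eqD[OF _ c_loops[OF q(1)]] unfolding p(2) q(2) f[OF p(1)] f[OF q(1)] by blast
      then show "\<alpha> = \<beta>" unfolding p(2) q(2) using c_iff[OF p(1) q(1)] loop_class_eqI[OF p(1)] by blast
    qed
    show "f ` carrier ?B = carrier ?A"
    proof
      show "f ` carrier ?B \<subseteq> carrier ?A"
        using hom by (auto simp: hom_def)
      show "carrier ?A \<subseteq> f ` carrier ?B"
      proof
        fix \<alpha> assume "\<alpha> \<in> carrier ?A"
        then obtain p where p: "p \<in> loops X a" "\<alpha> = loop_class X a p"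
          by (auto simp: in_carrier_fundamental_group)
        let ?q = "reversepath \<delta> +++ (p +++ reversepath (reversepath \<delta>))"
        have q: "?q \<in> loops X b" using p(1) \<delta> by (intro loops_conjugate) (auto simp: loops_def)
        have "homotopic_paths X (reversepath (reversepath \<delta>) +++ (?q +++ reversepath \<delta>)) p"
          using p(1) \<delta> by (intro homotopic_paths_conjugate_back) (auto simp: loops_def)
        then have "homotopic_paths X (?c ?q) p" by simp
        then have "f (loop_class X b ?q) = \<alpha>"
          unfolding f[OF q] p(2) by (rule loop_class_eqI[OF c_loops[OF q]])
        then show "\<alpha> \<in> f ` carrier ?B" using loop_class_in_carrier[OF q] by blast
      qed
    qed
  qed
  with hom have "f \<in> iso ?B ?A" by (simp add: iso_def)
  then show ?thesis by (rule is_isoI)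
qed

section \<open>Values of words\<close>

primrec word_value :: "('g, 'm) monoid_scheme \<Rightarrow> ('a \<Rightarrow> 'g) \<Rightarrow> 'a word \<Rightarrow> 'g" where
  "word_value P f [] = \<one>\<^bsub>P\<^esub>"
| "word_value P f (l # u) = (if snd l then f (fst l) else inv\<^bsub>P\<^esub> f (fst l)) \<otimes>\<^bsub>P\<^esub> word_value P f u"

context group
begin

lemma word_value_closed: "(\<And>x. f x \<in> carrier G) \<Longrightarrow> word_value G f u \<in> carrier G"
  by (induction u) auto

lemma word_value_append:
  assumes "\<And>x. f x \<in> carrier G"
  shows "word_value G f (u @ v) = word_value G f u \<otimes> word_value G f v"
proof (induction u)
  case Nil
  then show ?case by (simp add: word_value_closed[OF assms])
next
  case (Cons l u)
  then show ?case
    by (simp add: m_assoc assms word_value_closed[OF assms])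
qed

lemma word_value_cong:
  assumes f: "\<And>x. f x \<in> carrier G"
    and R: "\<And>l r. (l, r) \<in> R \<Longrightarrow> word_value G f l = word_value G f r"
  shows "word_eq R u v \<Longrightarrow> word_value G f u = word_value G f v"
proof (induction rule: word_eq.induct)
  case (cancel u x s v)
  have "word_value G f [(x, s), (x, \<not> s)] = \<one>" using f by simp
  then show ?case
    using l_one[OF word_value_closed[of f v, OF f]] by (simp only: word_value_append[OF f])
next
  case (relation l r u v)
  then show ?case by (simp only: word_value_append[OF f] R[OF relation])
next
  case (sym u v)
  then show ?case by (simp only:)
next
  case (trans u v w)
  then show ?case by (simp only:)
qed simp

text \<open>Inverses are values because every word has a left inverse in the free group.\<close>

lemma subgroup_range_word_value:
  assumes f: "\<And>x. f x \<in> carrier G"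
  shows "subgroup (range (word_value G f)) G"
proof (rule subgroupI)
  show "range (word_value G f) \<subseteq> carrier G" using word_value_closed[OF f] by auto
  fix g assume "g \<in> range (word_value G f)"
  then obtain u where u: "g = word_value G f u" by auto
  obtain v where "word_eq {} (v @ u) []" using word_eq_linv by blast
  from word_value_cong[OF f _ this] have "word_value G f (v @ u) = \<one>" by simp
  then have "word_value G f v \<otimes> g = \<one>"
    unfolding u word_value_append[OF f] .
  moreover have "g \<in> carrier G" "word_value G f v \<in> carrier G"
    unfolding u by (rule word_value_closed, rule f)+
  ultimately have "inv g = word_value G f v"
    by (rule inv_equality)
  then show "inv g \<in> range (word_value G f)" by simp
  fix h assume "h \<in> range (word_value G f)"
  then obtain w where "h = word_value G f w" by auto
  then show "g \<otimes> h \<in> range (word_value G f)"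
    unfolding u using word_value_append[of f u w, OF f] by (metis rangeI)
qed auto

end

section \<open>The group of the normal form\<close>

abbreviation bitangent_relations :: "(two_gens word \<times> two_gens word) set" where
  "bitangent_relations \<equiv> {((x1 @ x2) @ (x1 @ x2), (x2 @ x1) @ (x2 @ x1)), ((x2 @ x1) @ (x2 @ x1), [])}"

abbreviation word_class :: "('a word \<times> 'a word) set \<Rightarrow> 'a word \<Rightarrow> 'a word set" where
  "word_class R u \<equiv> word_eq_rel R `` {u}"

lemma word_class_in_carrier: "word_class R u \<in> carrier (presented_group R)"
  by (auto simp: presented_group_def quotient_def)

lemma in_carrier_presented_group: "\<alpha> \<in> carrier (presented_group R) \<longleftrightarrow> (\<exists>u. \<alpha> = word_class R u)"
  by (auto simp: presented_group_def quotient_def)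

lemma word_class_eq_iff: "word_class R u = word_class R v \<longleftrightarrow> word_eq R u v"
  using eq_equiv_class_iff[OF equiv_word_eq_rel, of u v R] by (simp add: word_eq_rel_def)

lemma word_value_presented_group:
  "word_value (presented_group R) (\<lambda>x. word_class R [(x, True)]) u = word_class R u"
proof (induction u)
  case Nil
  show ?case by (simp add: presented_group_def)
next
  case (Cons l u)
  interpret group "presented_group R" by (rule group_presented_group)
  obtain x s where l: "l = (x, s)" by (cases l)
  have "word_class R [(x, False)] \<otimes>\<^bsub>presented_group R\<^esub> word_class R [(x, True)] = \<one>\<^bsub>presented_group R\<^esub>"
    using word_eq.cancel[of R "[]" x False "[]"]
    by (simp add: presented_group_mult word_class_eq_iff) (simp add: presented_group_def word_class_eq_iff)
  then have "inv\<^bsub>presented_group R\<^esub> word_class R [(x, True)] = word_class R [(x, False)]"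
    by (intro inv_equality word_class_in_carrier)
  then show ?case using Cons by (simp add: l presented_group_mult)
qed

context bitangent_conics
begin

text \<open>Monodromy and evaluation of words are inverse to each other: the monodromy of the loop of a word
  is the class of the word.  Hence evaluation is injective on classes, and it is surjective because the
  circles generate.\<close>

theorem fundamental_group_base:
  "fundamental_group X base \<cong> presented_group bitangent_relations"
proof -
  let ?P = "fundamental_group X base" and ?R = bitangent_relations
  let ?G = "presented_group ?R"
  let ?a = "loop_class X base (lift_loop circle0)" and ?b = "loop_class X base (lift_loop circle1)"
  interpret P: group ?P by (rule group_fundamental_group[OF base_X])
  interpret G: group ?G by (rule group_presented_group)
  have rel: "word_eq ?R ((x2 @ x1) @ (x2 @ x1)) []" "word_eq ?R ((x1 @ x2) @ (x1 @ x2)) []"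
  proof -
    show 1: "word_eq ?R ((x2 @ x1) @ (x2 @ x1)) []"
      using word_eq.relation[of "(x2 @ x1) @ (x2 @ x1)" "[]" ?R "[]" "[]"] by simp
    have "word_eq ?R ((x1 @ x2) @ (x1 @ x2)) ((x2 @ x1) @ (x2 @ x1))"
      using word_eq.relation[of "(x1 @ x2) @ (x1 @ x2)" "(x2 @ x1) @ (x2 @ x1)" ?R "[]" "[]"] by simp
    then show "word_eq ?R ((x1 @ x2) @ (x1 @ x2)) []" using 1 by (rule word_eq.trans)
  qed
  interpret bitangent_labels \<pi> c ?G "word_class ?R (x1 @ x2)" "word_class ?R x2"
  proof
    show "word_class ?R (x1 @ x2) \<otimes>\<^bsub>?G\<^esub> word_class ?R (x1 @ x2) = \<one>\<^bsub>?G\<^esub>"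
      unfolding presented_group_mult using rel(2)
      by (simp add: word_class_eq_iff[symmetric] presented_group_def)
  qed (rule word_class_in_carrier)+
  let ?m = "monodromy.monodromy"
  have loopsD: "path p" "path_image p \<subseteq> X" "pathstart p = base" "pathfinish p = base" if "p \<in> loops X base" for p
    using that by (auto simp: loops_def)
  define \<Phi> where "\<Phi> \<alpha> = ?m (SOME p. p \<in> loops X base \<and> \<alpha> = loop_class X base p)" for \<alpha>
  have \<Phi>: "\<Phi> (loop_class X base p) = ?m p" if p: "p \<in> loops X base" for p
  proof -
    define q where "q = (SOME q. q \<in> loops X base \<and> loop_class X base p = loop_class X base q)"
    have "q \<in> loops X base \<and> loop_class X base p = loop_class X base q"
      using someI[of "\<lambda>q. q \<in> loops X base \<and> loop_class X base p = loop_class X base q" p] p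
      unfolding q_def by blast
    then have "?m p = ?m q" by (intro monodromy.monodromy_homotopic) (blast intro: loop_class_eqD)
    then show ?thesis unfolding \<Phi>_def q_def[symmetric] by simp
  qed
  have hom: "\<Phi> \<in> hom ?P ?G"
  proof (rule homI)
    fix \<alpha> \<beta> assume "\<alpha> \<in> carrier ?P" "\<beta> \<in> carrier ?P"
    then obtain p q where p: "p \<in> loops X base" "\<alpha> = loop_class X base p"
      and q: "q \<in> loops X base" "\<beta> = loop_class X base q"
      by (auto simp: in_carrier_fundamental_group)
    show "\<Phi> \<alpha> \<in> carrier ?G"
      unfolding p(2) \<Phi>[OF p(1)] using loopsD[OF p(1)] by (intro monodromy.monodromy_closed)
    show "\<Phi> (\<alpha> \<otimes>\<^bsub>?P\<^esub> \<beta>) = \<Phi> \<alpha> \<otimes>\<^bsub>?G\<^esub> \<Phi> \<beta>"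
      unfolding p(2) q(2) fundamental_group_mult[OF p(1) q(1)] \<Phi>[OF p(1)] \<Phi>[OF q(1)]
        \<Phi>[OF loops_join[OF p(1) q(1)]]
      using loopsD[OF p(1)] loopsD[OF q(1)] by (intro monodromy.monodromy_join) simp_all
  qed
  interpret \<Phi>: group_hom ?P ?G \<Phi>
    by (unfold_locales) (rule hom)
  note loops = lift_loop_loops[OF circle_loops(1)] lift_loop_loops[OF circle_loops(2)]
  have ab: "?a \<in> carrier ?P" "?b \<in> carrier ?P" using loops loop_class_in_carrier by blast+
  define gen where "gen x = (case x of X1 \<Rightarrow> ?a \<otimes>\<^bsub>?P\<^esub> inv\<^bsub>?P\<^esub> ?b | X2 \<Rightarrow> ?b)" for x
  have gen: "gen x \<in> carrier ?P" for x using ab by (cases x) (auto simp: gen_def)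
  have \<Phi>_gen: "\<Phi> (gen x) = word_class ?R [(x, True)]" for x
  proof -
    have "\<Phi> ?a = word_class ?R (x1 @ x2)" "\<Phi> ?b = word_class ?R x2"
      using \<Phi>[OF loops(1)] \<Phi>[OF loops(2)] monodromy_circles by simp_all
    moreover have "word_class ?R (x1 @ x2) \<otimes>\<^bsub>?G\<^esub> inv\<^bsub>?G\<^esub> word_class ?R x2 = word_class ?R x1"
    proof -
      have "word_class ?R (x1 @ x2) = word_class ?R x1 \<otimes>\<^bsub>?G\<^esub> word_class ?R x2"
        by (simp only: presented_group_mult)
      then show ?thesis by (simp only: G.m_assoc G.r_inv G.r_one G.inv_closed word_class_in_carrier)
    qed
    ultimately show ?thesis
      using ab by (cases x) (simp_all add: gen_def x1_def x2_def)
  qed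
  let ?v = "word_value ?P gen"
  have \<Phi>_value: "\<Phi> (?v u) = word_class ?R u" for u
  proof -
    have "\<Phi> (?v u) = word_value ?G (\<lambda>x. word_class ?R [(x, True)]) u"
      by (induction u) (simp_all add: \<Phi>_gen gen P.word_value_closed[OF gen])
    then show ?thesis by (simp only: word_value_presented_group)
  qed
  have value_b: "?v x2 = ?b" using ab(2) by (simp add: x2_def gen_def)
  have value_a: "?v (x1 @ x2) = ?a"
  proof -
    have "?v x1 = ?a \<otimes>\<^bsub>?P\<^esub> inv\<^bsub>?P\<^esub> ?b" using ab by (simp add: x1_def gen_def)
    then show ?thesis
      unfolding P.word_value_append[of gen x1 x2, OF gen] value_b
      using ab by (simp only: P.m_assoc P.l_inv P.r_one P.inv_closed)
  qed
  have range: "range ?v = carrier ?P"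
  proof (rule circles_generate)
    show "subgroup (range ?v) ?P" by (rule P.subgroup_range_word_value[OF gen])
    show "?a \<in> range ?v" unfolding value_a[symmetric] by (rule rangeI)
    show "?b \<in> range ?v" unfolding value_b[symmetric] by (rule rangeI)
  qed
  have value_cong: "?v u = ?v w" if "word_eq ?R u w" for u w
  proof (rule P.word_value_cong[OF gen _ that])
    have aa: "?v ((x1 @ x2) @ (x1 @ x2)) = \<one>\<^bsub>?P\<^esub>"
      unfolding P.word_value_append[of gen "x1 @ x2" "x1 @ x2", OF gen] value_a by (rule circle0_squared)
    \<comment> \<open>The two relators are conjugate by \<open>x2\<close>.\<close>
    have "?v ((x2 @ x1) @ (x2 @ x1)) \<otimes>\<^bsub>?P\<^esub> ?v x2 = ?v (x2 @ ((x1 @ x2) @ (x1 @ x2)))"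
      unfolding P.word_value_append[of gen "(x2 @ x1) @ (x2 @ x1)" x2, OF gen, symmetric]
      by (simp only: append_assoc)
    also have "\<dots> = \<one>\<^bsub>?P\<^esub> \<otimes>\<^bsub>?P\<^esub> ?v x2"
      unfolding P.word_value_append[of gen x2 "(x1 @ x2) @ (x1 @ x2)", OF gen] aa value_b
      using ab by (simp only: P.r_one P.l_one)
    finally have bb: "?v ((x2 @ x1) @ (x2 @ x1)) = \<one>\<^bsub>?P\<^esub>"
      using P.word_value_closed[of gen, OF gen] by (simp only: P.right_cancel P.one_closed)
    fix l r assume "(l, r) \<in> ?R"
    then have "?v l = \<one>\<^bsub>?P\<^esub>" "?v r = \<one>\<^bsub>?P\<^esub>"
      by (auto simp only: insert_iff empty_iff prod.inject aa bb word_value.simps)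
    then show "?v l = ?v r" by (simp only:)
  qed
  have "bij_betw \<Phi> (carrier ?P) (carrier ?G)"
  proof (rule bij_betw_imageI)
    show "inj_on \<Phi> (carrier ?P)"
    proof (rule inj_onI)
      fix \<alpha> \<beta> assume "\<alpha> \<in> carrier ?P" "\<beta> \<in> carrier ?P" and eq: "\<Phi> \<alpha> = \<Phi> \<beta>"
      then obtain u w where "\<alpha> = ?v u" "\<beta> = ?v w" unfolding range[symmetric] by blast
      moreover from this eq have "word_eq ?R u w"
        by (simp only: \<Phi>_value word_class_eq_iff)
      ultimately show "\<alpha> = \<beta>" using value_cong by (simp only:)
    qed
    show "\<Phi> ` carrier ?P = carrier ?G"
      unfolding range[symmetric] image_image \<Phi>_value
      by (auto simp only: in_carrier_presented_group intro: rangeI)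
  qed
  with hom have "\<Phi> \<in> iso ?P ?G" by (simp add: iso_def)
  then show ?thesis by (rule is_isoI)
qed

theorem fundamental_group_off_conics:
  assumes "b \<in> X"
  shows "fundamental_group X b \<cong> presented_group bitangent_relations"
  using fundamental_group_change_base[OF path_connected_X base_X assms] fundamental_group_base
  by (rule iso_trans)

end

section \<open>Normal form of two bitangent conics\<close>

definition polar :: "complex^3^3 \<Rightarrow> complex^3 \<Rightarrow> complex^3 \<Rightarrow> complex"
  where "polar A v w = (\<Sum>i\<in>UNIV. \<Sum>j\<in>UNIV. (A $ i $ j + A $ j $ i) * v $ j * w $ i)"

lemma polar_partial_deriv: "polar A v w = (\<Sum>i\<in>UNIV. partial_deriv i (quadratic_form A) v * w $ i)"
  by (simp add: polar_def partial_deriv_quadratic_form sum_distrib_right)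

lemma polar_add: "polar A v (w + w') = polar A v w + polar A v w'"
  and polar_scale: "polar A v (k *s w) = k * polar A v w"
  and polar_sym: "polar A v w = polar A w v"
  and polar_self: "polar A v v = 2 * quadratic_form A v"
  by (simp_all add: polar_def quadratic_form_def sum_3 algebra_simps)

lemma polar_add_left: "polar A (v + v') w = polar A v w + polar A v' w"
  and polar_scale_left: "polar A (k *s v) w = k * polar A v w"
  using polar_add[of A w v v'] polar_scale[of A w k v] by (simp_all add: polar_sym[of A _ w])

lemma quadratic_form_scale: "quadratic_form A (k *s v) = k\<^sup>2 * quadratic_form A v"
  by (simp add: quadratic_form_def sum_3 algebra_simps power2_eq_square)

lemma quadratic_form_add:
  "quadratic_form A (v + w) = quadratic_form A v + quadratic_form A w + polar A v w"
  by (simp add: polar_def quadratic_form_def sum_3 algebra_simps)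

text \<open>A vector in the kernel of the polar form would be a singular point of the conic.\<close>

lemma polar_nondegenerate:
  assumes "smooth_curve (quadratic_form A)" "\<And>w. polar A v w = 0"
  shows "v = 0"
proof (rule ccontr)
  assume "v \<noteq> 0"
  moreover have "quadratic_form A v = 0" using polar_self[of A v] assms(2) by simp
  ultimately obtain i where i: "partial_deriv i (quadratic_form A) v \<noteq> 0"
    using assms(1) unfolding smooth_curve_def by blast
  have "polar A v (axis i 1) = partial_deriv i (quadratic_form A) v"
    unfolding polar_partial_deriv by (simp add: axis_def if_distrib[of "\<lambda>x. _ * x"] cong: if_cong)
  with i assms(2) show False by simp
qed

lemma proj_in_zero_locus: "v \<noteq> 0 \<Longrightarrow> proj v \<in> zero_locus (quadratic_form A) \<longleftrightarrow> quadratic_form A v = 0"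
  by (auto simp: zero_locus_def proj_eq_iff quadratic_form_scale)

lemma proj_in_tangent_line: "w \<noteq> 0 \<Longrightarrow> proj w \<in> tangent_line (quadratic_form A) v \<longleftrightarrow> polar A v w = 0"
  unfolding tangent_line_def polar_partial_deriv[symmetric]
  by (auto simp: proj_eq_iff polar_scale)

definition cross :: "complex^3 \<Rightarrow> complex^3 \<Rightarrow> complex^3"
  where "cross u v = vector [u$2 * v$3 - u$3 * v$2, u$3 * v$1 - u$1 * v$3, u$1 * v$2 - u$2 * v$1]"

lemma cross_simps [simp]: "cross u v $ 1 = u$2 * v$3 - u$3 * v$2" "cross u v $ 2 = u$3 * v$1 - u$1 * v$3"
    "cross u v $ 3 = u$1 * v$2 - u$2 * v$1"
  by (simp_all add: cross_def)

lemma vec3_eq_iff: "u = v \<longleftrightarrow> u$1 = v$1 \<and> u$2 = v$2 \<and> u$3 = v$3" for u v :: "complex^3"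
  by (simp add: vec_eq_iff forall_3)

lemma cross_eq_0:
  assumes "cross u v = 0" "u \<noteq> 0"
  shows "\<exists>k. v = k *s u"
proof -
  have eqs: "u$2 * v$3 = u$3 * v$2" "u$3 * v$1 = u$1 * v$3" "u$1 * v$2 = u$2 * v$1"
    using assms(1) by (simp_all add: vec3_eq_iff)
  have "v$j * u$i = v$i * u$j" for i j
    using eqs exhaust_3[of i] exhaust_3[of j] by (auto simp: mult.commute)
  moreover obtain i where "u$i \<noteq> 0" using assms(2) by (auto simp: vec_eq_iff)
  ultimately have "v = (v$i / u$i) *s u" by (simp add: vec_eq_iff field_simps)
  then show ?thesis by blast
qed

definition gradient :: "complex^3^3 \<Rightarrow> complex^3 \<Rightarrow> complex^3"
  where "gradient A v = (\<chi> i. partial_deriv i (quadratic_form A) v)"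

lemma polar_gradient: "polar A v w = gradient A v $ 1 * w $ 1 + gradient A v $ 2 * w $ 2 + gradient A v $ 3 * w $ 3"
  by (simp add: polar_partial_deriv gradient_def sum_3)

lemma gradient_linear: "gradient A (k *s v + l *s w) = k *s gradient A v + l *s gradient A w"
  by (simp add: gradient_def vec_eq_iff partial_deriv_quadratic_form sum_3 algebra_simps)

context
  fixes A :: "complex^3^3" and p q :: "complex^3"
  assumes smooth: "smooth_curve (quadratic_form A)"
    and pq: "p \<noteq> 0" "q \<noteq> 0" "proj p \<noteq> proj q"
    and zero: "quadratic_form A p = 0" "quadratic_form A q = 0"
begin

lemma points_independent: "k *s p + l *s q = 0 \<Longrightarrow> k = 0 \<and> l = 0"
proof (rule ccontr)
  assume kl: "k *s p + l *s q = 0" and "\<not> (k = 0 \<and> l = 0)"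
  then have nz: "k \<noteq> 0" "l \<noteq> 0" using pq(1,2) by auto
  have "q = (- (k / l)) *s p"
  proof -
    have "k * p$i + l * q$i = 0" for i
      using kl by (metis vector_add_component vector_smult_component zero_index)
    then show ?thesis using nz by (simp add: vec_eq_iff field_simps eq_neg_iff_add_eq_0 add.commute)
  qed
  moreover have "- (k / l) \<noteq> 0" using nz by simp
  ultimately show False using pq proj_eq_iff[of p q] by blast
qed

lemma gradient_nonzero: "gradient A p \<noteq> 0"
proof
  assume "gradient A p = 0"
  then have "polar A p w = 0" for w by (simp add: polar_gradient)
  then show False using polar_nondegenerate[OF smooth] pq(1) by blast
qed

lemma gradients_independent:
  assumes "k *s gradient A p + l *s gradient A q = 0"
  shows "k = 0 \<and> l = 0"
proof (rule points_independent)
  have "gradient A (k *s p + l *s q) = 0" using assms by (simp add: gradient_linear)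
  then have "polar A (k *s p + l *s q) w = 0" for w by (simp add: polar_gradient)
  then show "k *s p + l *s q = 0" by (rule polar_nondegenerate[OF smooth])
qed

text \<open>The point is the cross product of the gradients, which are independent because the points are.\<close>

lemma tangents_meet: "\<exists>r. r \<noteq> 0 \<and> polar A p r = 0 \<and> polar A q r = 0"
proof (intro exI conjI)
  let ?r = "cross (gradient A p) (gradient A q)"
  show "polar A p ?r = 0" "polar A q ?r = 0" by (simp_all add: polar_gradient algebra_simps)
  show "?r \<noteq> 0"
  proof
    assume "?r = 0"
    then obtain k where "gradient A q = k *s gradient A p" using cross_eq_0 gradient_nonzero by blast
    then have "k *s gradient A p + (-1) *s gradient A q = 0" by (simp add: vec_eq_iff)
    then show False using gradients_independent by (metis neg_equal_0_iff_equal one_neq_zero)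
  qed
qed

text \<open>Otherwise both gradients would be orthogonal to both points, hence multiples of their cross
  product: the conic would contain the line through the points.\<close>

lemma polar_points_nonzero: "polar A p q \<noteq> 0"
proof
  assume pq0: "polar A p q = 0"
  let ?n = "cross p q"
  have n: "?n \<noteq> 0"
  proof
    assume "?n = 0"
    then obtain k where "q = k *s p" using cross_eq_0 pq(1) by blast
    then have "k *s p + (-1) *s q = 0" by (simp add: vec_eq_iff)
    then show False using points_independent by (metis neg_equal_0_iff_equal one_neq_zero)
  qed
  have perp: "cross ?n (gradient A v) = 0" if "polar A v p = 0" "polar A v q = 0" for v
  proof -
    have "cross ?n (gradient A v) = polar A v p *s q - polar A v q *s p"
      by (simp add: vec3_eq_iff polar_gradient algebra_simps)
    then show ?thesis using that by (simp add: vec_eq_iff)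
  qed
  have "polar A p p = 0" "polar A q q = 0" "polar A q p = 0"
    using zero pq0 by (simp_all add: polar_self polar_sym[of A q p])
  with pq0 have "cross ?n (gradient A p) = 0" "cross ?n (gradient A q) = 0"
    by (intro perp; simp)+
  then obtain k l where kl: "gradient A p = k *s ?n" "gradient A q = l *s ?n"
    using cross_eq_0[OF _ n] by blast
  have "l *s gradient A p + (- k) *s gradient A q = 0"
    unfolding kl by (simp add: vec_eq_iff)
  then have "k = 0" using gradients_independent by (metis neg_equal_0_iff_equal)
  then show False using kl(1) gradient_nonzero by simp
qed

end

text \<open>With the points of tangency and the intersection of their tangents as a basis, the forms contain only
  the monomials \<open>x y\<close> and \<open>z\<^sup>2\<close>.\<close>

definition frame :: "complex^3 \<Rightarrow> complex^3 \<Rightarrow> complex^3 \<Rightarrow> complex \<times> complex \<times> complex \<Rightarrow> complex^3"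
  where "frame p q r = (\<lambda>(x, y, z). x *s p + y *s q + z *s r)"

lemma polar_frame: "polar A v (frame p q r (x, y, z)) = x * polar A v p + y * polar A v q + z * polar A v r"
  by (simp add: frame_def polar_add polar_scale)

lemma quadratic_form_frame:
  assumes "quadratic_form A p = 0" "quadratic_form A q = 0" "polar A p r = 0" "polar A q r = 0"
  shows "quadratic_form A (frame p q r (x, y, z)) = x * y * polar A p q + z\<^sup>2 * quadratic_form A r"
  using assms
  by (simp add: frame_def quadratic_form_add quadratic_form_scale polar_add polar_add_left polar_scale polar_scale_left)

lemma surj_frame:
  assumes "\<And>x y z. frame p q r (x, y, z) = 0 \<Longrightarrow> x = 0 \<and> y = 0 \<and> z = 0"
  shows "surj (frame p q r)"
proof -
  define M :: "complex^3^3" where "M = (\<chi> i j. (if j = 1 then p else if j = 2 then q else r) $ i)"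
  have M: "M *v v = frame p q r (v$1, v$2, v$3)" for v
    by (simp add: vec_eq_iff matrix_vector_mult_def M_def frame_def sum_3 algebra_simps)
  have lin: "Vector_Spaces.linear (*s) (*s) ((*v) M)" by (rule matrix_vector_mul_linear_gen)
  have "inj ((*v) M)"
  proof (rule injI)
    fix v w assume "M *v v = M *v w"
    then have "M *v (v - w) = 0" by (simp add: matrix_vector_mult_diff_distrib)
    from assms[OF this[unfolded M]] show "v = w" by (simp add: vec3_eq_iff)
  qed
  then have "surj ((*v) M)" using lin by (rule vec.linear_inj_imp_surj[rotated])
  then show ?thesis unfolding surj_def M by blast
qed

lemma continuous_on_polar: "continuous_on S (polar A v)"
  unfolding polar_def by (intro continuous_intros)

text \<open>For the polar form, \<open>p\<close> and \<open>q\<close> are isotropic and paired with each other, and \<open>r\<close> is orthogonal to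
  both; so the coordinates of a vector are, up to constants, its polar products with the basis and depend
  on it continuously.\<close>

lemma homogeneous_coordinates_frame:
  assumes smooth: "smooth_curve (quadratic_form A)"
    and pq: "p \<noteq> 0" "q \<noteq> 0" "proj p \<noteq> proj q"
    and zero: "quadratic_form A p = 0" "quadratic_form A q = 0"
    and r: "r \<noteq> 0" "polar A p r = 0" "polar A q r = 0"
  shows "homogeneous_coordinates (\<lambda>t. proj (frame p q r t))" "bij (frame p q r)" "frame p q r t = 0 \<longleftrightarrow> t = 0"
    "quadratic_form A r \<noteq> 0"
proof -
  let ?f = "frame p q r"
  have b: "polar A p q \<noteq> 0" by (rule polar_points_nonzero[OF smooth pq zero])
  have self: "polar A p p = 0" "polar A q q = 0" using zero by (simp_all add: polar_self)
  have sym: "polar A q p = polar A p q" "polar A r p = 0" "polar A r q = 0"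
    using r polar_sym by metis+
  have zero_frame: "x = 0 \<and> y = 0 \<and> z = 0" if "?f (x, y, z) = 0" for x y z
  proof -
    have polar0: "polar A v (0 :: complex^3) = 0" for v by (simp add: polar_def)
    have "y = 0" "x = 0"
      using polar_frame[of A p p q r x y z] polar_frame[of A q p q r x y z] that b self sym r
      by (simp_all add: polar0)
    with that have "z *s r = 0" by (simp add: frame_def vec_eq_iff)
    with r(1) have "z = 0" by simp
    with \<open>x = 0\<close> \<open>y = 0\<close> show ?thesis by simp
  qed
  have surj: "surj ?f" by (rule surj_frame[OF zero_frame])
  show rr: "quadratic_form A r \<noteq> 0"
  proof
    assume "quadratic_form A r = 0"
    then have rr: "polar A r r = 0" by (simp add: polar_self)
    have "polar A r w = 0" for w
    proof -
      obtain t where "w = ?f t" using surj by (metis surjD)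
      then show ?thesis by (cases t) (simp add: polar_frame sym rr)
    qed
    then show False using polar_nondegenerate[OF smooth] r(1) by blast
  qed
  define g where "g w = (polar A q w / polar A p q, polar A p w / polar A p q, polar A r w / (2 * quadratic_form A r))" for w
  have gf: "g (?f t) = t" for t
    by (cases t) (use b rr in \<open>simp add: g_def polar_frame self sym r zero polar_self\<close>)
  have fg: "?f (g w) = w" for w
  proof -
    obtain t where "w = ?f t" using surj by (metis surjD)
    then show ?thesis by (simp add: gf)
  qed
  show "bij ?f" by (rule o_bij[of g]) (auto simp: gf fg)
  have f0: "?f t = 0 \<longleftrightarrow> t = 0" for t
    using zero_frame by (cases t) (auto simp: zero_prod_def frame_def)
  then show "?f t = 0 \<longleftrightarrow> t = 0" .
  have cont_g: "continuous_on UNIV g" unfolding g_def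
    by (intro continuous_intros continuous_on_polar) (use b rr in auto)
  have cont_f: "continuous_on UNIV ?f"
    unfolding frame_def split_def vector_scalar_mult_def
    by (intro continuous_intros continuous_on_vec_lambda)
  have scale: "?f (k * x, k * y, k * z) = k *s ?f (x, y, z)" for k x y z
    by (simp add: frame_def vec_eq_iff algebra_simps)
  show "homogeneous_coordinates (\<lambda>t. proj (?f t))"
  proof
    fix x y z :: complex and w :: "complex \<times> complex \<times> complex" assume nz: "(x, y, z) \<noteq> 0" "w \<noteq> 0"
    have "?f w = k *s ?f (x, y, z) \<longleftrightarrow> w = (k * x, k * y, k * z)" for k
      unfolding scale[symmetric] using gf by metis
    then show "proj (?f (x, y, z)) = proj (?f w) \<longleftrightarrow> (\<exists>k. k \<noteq> 0 \<and> w = (k * x, k * y, k * z))"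
      using proj_eq_iff[of "?f (x, y, z)" "?f w"] nz f0 by simp
  next
    fix P
    obtain v where "v \<noteq> 0" "proj v = P" using proj_surj by blast
    then show "\<exists>t. t \<noteq> 0 \<and> proj (?f t) = P"
      using fg f0 by (intro exI[of _ "g v"]) metis
  next
    fix W :: "cp2 set"
    have 1: "{t. t \<noteq> 0 \<and> proj (?f t) \<in> W} = ?f -` {v. v \<noteq> 0 \<and> proj v \<in> W}"
      using f0 by auto
    have 2: "{v. v \<noteq> 0 \<and> proj v \<in> W} = g -` {t. t \<noteq> 0 \<and> proj (?f t) \<in> W}"
    proof -
      have "g v = 0 \<longleftrightarrow> v = 0" for v using f0[of "g v"] unfolding fg by simp
      then show ?thesis by (simp add: vimage_def fg)
    qed
    show "open W \<longleftrightarrow> open {t. t \<noteq> 0 \<and> proj (?f t) \<in> W}"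
      unfolding open_cp2_def
    proof
      assume "open {v. v \<noteq> 0 \<and> proj v \<in> W}"
      then show "open {t. t \<noteq> 0 \<and> proj (?f t) \<in> W}" unfolding 1 by (rule open_vimage[OF _ cont_f])
    next
      assume "open {t. t \<noteq> 0 \<and> proj (?f t) \<in> W}"
      then show "open {v. v \<noteq> 0 \<and> proj v \<in> W}" by (subst 2) (rule open_vimage[OF _ cont_g])
    qed
  qed
qed

text \<open>Since the tangents coincide, the basis of the first conic serves the second as well.  The
  ratios of the two coefficients are different for different conics, and both are nonzero for smooth ones.\<close>

theorem bitangent_normal_form:
  assumes smooth: "smooth_curve (quadratic_form A)" "smooth_curve (quadratic_form B)"
    and diff: "zero_locus (quadratic_form A) \<noteq> zero_locus (quadratic_form B)"
    and card: "card (tangency_points (quadratic_form A) (quadratic_form B)) = 2"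
  shows "\<exists>\<pi> c. bitangent_conics \<pi> c \<and>
    - (zero_locus (quadratic_form A) \<union> zero_locus (quadratic_form B)) =
      homogeneous_coordinates.region \<pi> (bitangent_conics.off_conics c)"
proof -
  obtain P P' where PP: "P \<in> tangency_points (quadratic_form A) (quadratic_form B)"
    "P' \<in> tangency_points (quadratic_form A) (quadratic_form B)" "P \<noteq> P'"
    using card unfolding card_2_iff by blast
  obtain p where p: "P = proj p" "p \<noteq> 0" "quadratic_form A p = 0" "quadratic_form B p = 0"
    "tangent_line (quadratic_form A) p = tangent_line (quadratic_form B) p"
    using PP(1) unfolding tangency_points_def by blast
  obtain q where q: "P' = proj q" "q \<noteq> 0" "quadratic_form A q = 0" "quadratic_form B q = 0"
    "tangent_line (quadratic_form A) q = tangent_line (quadratic_form B) q"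
    using PP(2) unfolding tangency_points_def by blast
  have pq: "p \<noteq> 0" "q \<noteq> 0" "proj p \<noteq> proj q" using p q PP(3) by auto
  obtain r where r: "r \<noteq> 0" "polar A p r = 0" "polar A q r = 0"
    using tangents_meet[OF smooth(1) pq p(3) q(3)] by blast
  have rB: "polar B p r = 0" "polar B q r = 0"
    using r p(5) q(5) proj_in_tangent_line[OF r(1)] by blast+
  let ?a = "polar A p q" and ?b = "polar B p q"
  have ab: "?a \<noteq> 0" "?b \<noteq> 0"
    using polar_points_nonzero[OF smooth(1) pq p(3) q(3)] polar_points_nonzero[OF smooth(2) pq p(4) q(4)] by auto
  note frame = homogeneous_coordinates_frame[OF smooth(1) pq p(3) q(3)]
  have rA0: "quadratic_form A r \<noteq> 0" by (rule frame(4)[OF r])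
  have rB0: "quadratic_form B r \<noteq> 0"
    by (rule homogeneous_coordinates_frame(4)[OF smooth(2) pq p(4) q(4) r(1) rB])
  define D where "D = quadratic_form A r / ?a - quadratic_form B r / ?b"
  have D: "D \<noteq> 0"
  proof
    assume "D = 0"
    then have eq: "quadratic_form A r = ?a / ?b * quadratic_form B r" using ab by (simp add: D_def field_simps)
    have "quadratic_form A v = ?a / ?b * quadratic_form B v" for v
    proof -
      obtain x y z where v: "v = frame p q r (x, y, z)"
        using bij_is_surj[OF frame(2)[OF r]] by (metis prod_cases3 surjD)
      show ?thesis
        unfolding v quadratic_form_frame[OF p(3) q(3) r(2,3)] quadratic_form_frame[OF p(4) q(4) rB] eq
        using ab by (simp add: field_simps)
    qed
    then have "quadratic_form A v = 0 \<longleftrightarrow> quadratic_form B v = 0" for v using ab by simp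
    then show False using diff by (simp add: zero_locus_def)
  qed
  \<comment> \<open>With the coefficient of \<open>x y\<close> normalised to \<open>1\<close>, this scaling of \<open>r\<close> makes the coefficients of \<open>z\<^sup>2\<close> differ by \<open>1\<close>.\<close>
  define k where "k = csqrt (1 / D)"
  have k: "k\<^sup>2 = 1 / D" "k \<noteq> 0" using D by (simp_all add: k_def)
  define s where "s = k *s r"
  have s: "s \<noteq> 0" "polar A p s = 0" "polar A q s = 0" "polar B p s = 0" "polar B q s = 0"
    using r rB k(2) by (simp_all add: s_def polar_scale)
  have sq: "quadratic_form A s = quadratic_form A r / D" "quadratic_form B s = quadratic_form B r / D"
    by (simp_all add: s_def quadratic_form_scale k(1))
  define c where "c = quadratic_form A r / (?a * D)"
  have c1: "c - 1 = quadratic_form B r / (?b * D)"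
    using D ab by (simp add: c_def D_def field_simps)
  have c: "c \<noteq> 0" "c \<noteq> 1"
  proof -
    show "c \<noteq> 0" using rA0 ab D by (simp add: c_def)
    have "c - 1 \<noteq> 0" using rB0 ab D by (simp add: c1)
    then show "c \<noteq> 1" by simp
  qed
  let ?f = "frame p q s" and ?\<pi> = "\<lambda>t. proj (frame p q s t)"
  interpret homogeneous_coordinates ?\<pi> by (rule frame(1)[OF s(1-3)])
  interpret bitangent_conics ?\<pi> c by unfold_locales (fact c)+
  have formA: "quadratic_form A (?f (x, y, z)) = ?a * (x * y + c * z\<^sup>2)" for x y z
    unfolding quadratic_form_frame[OF p(3) q(3) s(2,3)] sq c_def using ab D by (simp add: field_simps)
  have formB: "quadratic_form B (?f (x, y, z)) = ?b * (x * y + (c - 1) * z\<^sup>2)" for x y z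
    unfolding quadratic_form_frame[OF p(4) q(4) s(4,5)] sq c1 using ab D by (simp add: field_simps)
  have "P \<in> - (zero_locus (quadratic_form A) \<union> zero_locus (quadratic_form B)) \<longleftrightarrow> P \<in> region off_conics" for P
  proof -
    obtain t where t: "t \<noteq> 0" "P = ?\<pi> t" using \<pi>_surj[of P] by auto
    obtain x y z where xyz: "t = (x, y, z)" by (cases t)
    have "?f t \<noteq> 0" using frame(3)[OF s(1-3)] t(1) by blast
    then have "P \<in> - (zero_locus (quadratic_form A) \<union> zero_locus (quadratic_form B)) \<longleftrightarrow>
        quadratic_form A (?f t) \<noteq> 0 \<and> quadratic_form B (?f t) \<noteq> 0"
      unfolding t(2) by (simp add: proj_in_zero_locus)
    also have "\<dots> \<longleftrightarrow> off_conics t"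
    proof -
      have "x * y + (c - 1) * z\<^sup>2 = (x * y + c * z\<^sup>2) - z\<^sup>2" by (simp add: algebra_simps)
      then have "x * y + (c - 1) * z\<^sup>2 = 0 \<longleftrightarrow> x * y + c * z\<^sup>2 = z\<^sup>2" by (simp only: right_minus_eq)
      then show ?thesis
        unfolding xyz formA formB mult_eq_0_iff using ab by (simp only: off_conics_def Q_def prod.case simp_thms)
    qed
    also have "\<dots> \<longleftrightarrow> P \<in> region off_conics"
      unfolding t(2) using in_region[OF homogeneous_off_conics t(1)] by simp
    finally show ?thesis .
  qed
  then have "- (zero_locus (quadratic_form A) \<union> zero_locus (quadratic_form B)) = region off_conics"
    by blast
  with bitangent_conics_axioms show ?thesis by blast
qed

section \<open>The fundamental group of the complement of two bitangent conics\<close>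

theorem proposition1p1:
  fixes F G :: "complex^3 \<Rightarrow> complex" and S :: "cp2 set" and b :: cp2
  assumes "real_quadratic_form F" and "real_quadratic_form G"
    and "smooth_curve F" and "smooth_curve G"
    and "zero_locus F \<noteq> zero_locus G"
    and "card (tangency_points F G) = 2"
    and "S = zero_locus F \<union> zero_locus G"
    and "b \<in> - S"
  shows "fundamental_group (- S) b \<cong> presented_group
    {((x1 @ x2) @ (x1 @ x2), (x2 @ x1) @ (x2 @ x1)), ((x2 @ x1) @ (x2 @ x1), [])}"
proof -
  obtain A B where AB: "F = quadratic_form A" "G = quadratic_form B"
    using assms(1,2) unfolding real_quadratic_form_def by blast
  obtain \<pi> c where conics: "bitangent_conics \<pi> c"
    and S: "- S = homogeneous_coordinates.region \<pi> (bitangent_conics.off_conics c)"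
    using bitangent_normal_form assms(3-7) unfolding AB by metis
  show ?thesis
    unfolding S by (rule bitangent_conics.fundamental_group_off_conics[OF conics]) (use assms(8) S in simp)
qed

end
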